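(* A singular foliation $\mathcal{F}$ on a Riemannian manifold $(M,g)$ defines a module SRF $(M,g,\mathcal{F})$ if and only if $H_g\in N(\mathcal{I}_{\mathcal{F}})$.
   Context: A singular foliation (SF) on a smooth manifold $M$ is a $C^\infty(M)$-submodule $\mathcal{F}$ of the compactly supported vector fields $\mathfrak{X}_c(M)$ that is closed under the Lie bracket and locally finitely generated: every $q\in M$ has an open neighborhood $U$ such that $\{X\in\mathcal{F}:\mathrm{supp}(X)\subset U\}=\langle X_1,\dots,X_N\rangle_{C_c^\infty(U)}$ for finitely many $X_a\in\mathfrak{X}(U)$. $(M,g,\mathcal{F})$ is a module SRF if $\mathcal{L}_Xg\in\Omega^1(M)\odot g_\flat(\mathcal{F})$ for every $X\in\mathcal{F}$, where $g_\flat(Y)=g(Y,\cdot)$, $\odot$ is the symmetric tensor product, and the right-hand side consists of finite sums of elements $\omega\odot g_\flat(Y)$ with $\omega\in\Omega^1(M)$, $Y\in\mathcal{F}$. Let $\{\cdot,\cdot\}_{T^*M}$ be the canonical Poisson bracket on $T^*M$ (with $\{p_i,q^j\}=\delta_i^j$). For $X\in\mathfrak{X}(M)$ let $\overline{X}(q,p)=\langle p,X|_q\rangle$. Put $\mathcal{J}_{\mathcal{F}}:=\langle\overline{X}:X\in\mathcal{F}\rangle_{C_c^\infty(T^*M)}$ and, for $U\subset T^*M$ open, $\mathcal{I}_{\mathcal{F}}(U):=\{f\in C^\infty(U):\rho f\in\mathcal{J}_{\mathcal{F}}\ \forall\rho\in C_c^\infty(U)\}$ (with $\rho f$ extended by zero).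 $N(\mathcal{I}_{\mathcal{F}}):=\{f\in C^\infty(T^*M):\{f|_U,\mathcal{I}_{\mathcal{F}}(U)\}_{T^*M}\subset\mathcal{I}_{\mathcal{F}}(U)\text{ for every open }U\subset T^*M\}$. The Hamiltonian is $H_g(q,p)=\tfrac12\langle p,g_\flat^{-1}(p)\rangle$ for $(q,p)\in T^*M$. *)

theory Defs
  imports "HOL-Analysis.Analysis"
begin

text \<open>
  A manifold is given by its atlas, a set of charts; its points and its topology are derived from
  the charts. Throughout, functions, vector fields, forms and tensors that are defined on a subset
  of the manifold are represented by total functions extended by zero; tangent vectors (covectors)
  are extended by zero to non-smooth functions (to non-tangent vectors), so that equality in HOL is
  the intended equality.
\<close>

section \<open>Smooth manifolds\<close>

primrec Ck_on :: "nat \<Rightarrow> 'b::euclidean_space set \<Rightarrow> ('b \<Rightarrow> 'c::real_normed_vector) \<Rightarrow> bool" where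
  "Ck_on 0 S f \<longleftrightarrow> continuous_on S f"
| "Ck_on (Suc k) S f \<longleftrightarrow> (\<forall>x\<in>S. f differentiable (at x)) \<and>
     (\<forall>v. Ck_on k S (\<lambda>x. frechet_derivative f (at x) v))"

text \<open>Only meant for open \<open>S\<close>.\<close>

definition smooth_on :: "'b::euclidean_space set \<Rightarrow> ('b \<Rightarrow> 'c::real_normed_vector) \<Rightarrow> bool" where
  "smooth_on S f \<longleftrightarrow> (\<forall>k. Ck_on k S f)"

type_synonym ('a, 'b) chart = "'a set \<times> ('a \<Rightarrow> 'b)"
type_synonym ('a, 'b) atlas = "('a, 'b) chart set"

definition chart_inv :: "('a, 'b) chart \<Rightarrow> 'b \<Rightarrow> 'a" where
  "chart_inv c = inv_into (fst c) (snd c)"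

definition points :: "('a, 'b) atlas \<Rightarrow> 'a set" where
  "points A = (\<Union>c\<in>A. fst c)"

text \<open>For a smooth atlas these generators form a base of the usual manifold topology, in which
  \<open>W\<close> is open iff the image of \<open>W\<close> under every chart is open.\<close>

definition mtop :: "('a, 'b::euclidean_space) atlas \<Rightarrow> 'a topology" where
  "mtop A = topology_generated_by {{q \<in> fst c. snd c q \<in> S} | c S. c \<in> A \<and> open S}"

definition smooth_atlas :: "('a, 'b::euclidean_space) atlas \<Rightarrow> bool" where
  "smooth_atlas A \<longleftrightarrow>
     (\<forall>c\<in>A. inj_on (snd c) (fst c)) \<and>
     (\<forall>c\<in>A. \<forall>d\<in>A. open (snd c ` (fst c \<inter> fst d)) \<and>
        smooth_on (snd c ` (fst c \<inter> fst d)) (snd d \<circ> chart_inv c))"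

definition smooth_manifold :: "('a, 'b::euclidean_space) atlas \<Rightarrow> bool" where
  "smooth_manifold A \<longleftrightarrow>
     smooth_atlas A \<and> Hausdorff_space (mtop A) \<and> second_countable (mtop A)"

definition smooth_funs :: "('a, 'b::euclidean_space) atlas \<Rightarrow> 'a set \<Rightarrow> ('a \<Rightarrow> real) set" where
  "smooth_funs A U = {f. (\<forall>c\<in>A. smooth_on (snd c ` (fst c \<inter> U)) (f \<circ> chart_inv c)) \<and>
     (\<forall>q. q \<notin> U \<longrightarrow> f q = 0)}"

definition supp :: "('a, 'b::euclidean_space) atlas \<Rightarrow> ('a \<Rightarrow> real) \<Rightarrow> 'a set" where
  "supp A f = mtop A closure_of {q \<in> points A. f q \<noteq> 0}"

definition smooth_funs_c :: "('a, 'b::euclidean_space) atlas \<Rightarrow> 'a set \<Rightarrow> ('a \<Rightarrow> real) set" where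
  "smooth_funs_c A U =
     {f \<in> smooth_funs A (points A). compactin (mtop A) (supp A f) \<and> supp A f \<subseteq> U}"

section \<open>Tangent and cotangent spaces, vector fields, one-forms\<close>

text \<open>Tangent vectors are the derivations at a point of the algebra of smooth functions.\<close>

type_synonym 'a tvec = "('a \<Rightarrow> real) \<Rightarrow> real"
type_synonym 'a covec = "'a tvec \<Rightarrow> real"

definition tangent_space :: "('a, 'b::euclidean_space) atlas \<Rightarrow> 'a \<Rightarrow> 'a tvec set" where
  "tangent_space A q = {v. (let C = smooth_funs A (points A) in
     (\<forall>f. f \<notin> C \<longrightarrow> v f = 0) \<and>
     (\<forall>f\<in>C. \<forall>h\<in>C. v (\<lambda>r. f r + h r) = v f + v h) \<and>
     (\<forall>f\<in>C. \<forall>a. v (\<lambda>r. a * f r) = a * v f) \<and>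
     (\<forall>f\<in>C. \<forall>h\<in>C. v (\<lambda>r. f r * h r) = f q * v h + h q * v f))}"

definition cotangent_space :: "('a, 'b::euclidean_space) atlas \<Rightarrow> 'a \<Rightarrow> 'a covec set" where
  "cotangent_space A q = {p. (let T = tangent_space A q in
     (\<forall>v. v \<notin> T \<longrightarrow> p v = 0) \<and>
     (\<forall>v\<in>T. \<forall>w\<in>T. p (\<lambda>f. v f + w f) = p v + p w) \<and>
     (\<forall>v\<in>T. \<forall>a. p (\<lambda>f. a * v f) = a * p v))}"

definition vector_fields :: "('a, 'b::euclidean_space) atlas \<Rightarrow> 'a set \<Rightarrow> ('a \<Rightarrow> 'a tvec) set" where
  "vector_fields A U = {X. (\<forall>q\<in>U. X q \<in> tangent_space A q) \<and>
     (\<forall>q. q \<notin> U \<longrightarrow> X q = (\<lambda>f. 0)) \<and>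
     (\<forall>f\<in>smooth_funs A (points A). (\<lambda>q. X q f) \<in> smooth_funs A U)}"

definition vf_supp :: "('a, 'b::euclidean_space) atlas \<Rightarrow> ('a \<Rightarrow> 'a tvec) \<Rightarrow> 'a set" where
  "vf_supp A X = mtop A closure_of {q \<in> points A. X q \<noteq> (\<lambda>f. 0)}"

definition vector_fields_c :: "('a, 'b::euclidean_space) atlas \<Rightarrow> ('a \<Rightarrow> 'a tvec) set" where
  "vector_fields_c A = {X \<in> vector_fields A (points A). compactin (mtop A) (vf_supp A X)}"

definition lie_bracket :: "('a \<Rightarrow> 'a tvec) \<Rightarrow> ('a \<Rightarrow> 'a tvec) \<Rightarrow> 'a \<Rightarrow> 'a tvec" where
  "lie_bracket X Y = (\<lambda>q f. X q (\<lambda>r. Y r f) - Y q (\<lambda>r. X r f))"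

definition one_forms :: "('a, 'b::euclidean_space) atlas \<Rightarrow> ('a \<Rightarrow> 'a covec) set" where
  "one_forms A = {\<omega>. (\<forall>q\<in>points A. \<omega> q \<in> cotangent_space A q) \<and>
     (\<forall>q. q \<notin> points A \<longrightarrow> \<omega> q = (\<lambda>v. 0)) \<and>
     (\<forall>X\<in>vector_fields A (points A). (\<lambda>q. \<omega> q (X q)) \<in> smooth_funs A (points A))}"

section \<open>Singular foliations\<close>

definition singular_foliation :: "('a, 'b::euclidean_space) atlas \<Rightarrow> ('a \<Rightarrow> 'a tvec) set \<Rightarrow> bool" where
  "singular_foliation A F \<longleftrightarrow>
     F \<subseteq> vector_fields_c A \<and>
     (\<lambda>q f. 0) \<in> F \<and>
     (\<forall>X\<in>F. \<forall>Y\<in>F. (\<lambda>q f. X q f + Y q f) \<in> F) \<and>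
     (\<forall>h\<in>smooth_funs A (points A). \<forall>X\<in>F. (\<lambda>q f. h q * X q f) \<in> F) \<and>
     (\<forall>X\<in>F. \<forall>Y\<in>F. lie_bracket X Y \<in> F) \<and>
     (\<forall>q\<in>points A. \<exists>U. openin (mtop A) U \<and> q \<in> U \<and>
        (\<exists>(N::nat) Z. (\<forall>a<N. Z a \<in> vector_fields A U) \<and>
           {X \<in> F. vf_supp A X \<subseteq> U} =
           {(\<lambda>r f. \<Sum>a<N. h a r * Z a r f) | h. \<forall>a<N. h a \<in> smooth_funs_c A U}))"

section \<open>Riemannian metrics and module SRFs\<close>

text \<open>The conclusion of the third condition makes \<open>g q\<close> bilinear (by symmetry) and zero off the
  tangent space in each argument.\<close>

definition riemannian_metric ::
  "('a, 'b::euclidean_space) atlas \<Rightarrow> ('a \<Rightarrow> 'a tvec \<Rightarrow> 'a tvec \<Rightarrow> real) \<Rightarrow> bool" where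
  "riemannian_metric A g \<longleftrightarrow>
     (\<forall>q v w. q \<notin> points A \<or> v \<notin> tangent_space A q \<longrightarrow> g q v w = 0) \<and>
     (\<forall>q v w. g q v w = g q w v) \<and>
     (\<forall>q\<in>points A. \<forall>v\<in>tangent_space A q. g q v \<in> cotangent_space A q) \<and>
     (\<forall>q\<in>points A. \<forall>v\<in>tangent_space A q. v \<noteq> (\<lambda>f. 0) \<longrightarrow> g q v v > 0) \<and>
     (\<forall>X\<in>vector_fields A (points A). \<forall>Y\<in>vector_fields A (points A).
        (\<lambda>q. g q (X q) (Y q)) \<in> smooth_funs A (points A))"

definition flat :: "('a \<Rightarrow> 'a tvec \<Rightarrow> 'a tvec \<Rightarrow> real) \<Rightarrow> ('a \<Rightarrow> 'a tvec) \<Rightarrow> 'a \<Rightarrow> 'a covec" where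
  "flat g Y = (\<lambda>q v. g q (Y q) v)"

definition sym_prod :: "('a \<Rightarrow> 'a covec) \<Rightarrow> ('a \<Rightarrow> 'a covec) \<Rightarrow> 'a \<Rightarrow> 'a tvec \<Rightarrow> 'a tvec \<Rightarrow> real" where
  "sym_prod \<alpha> \<beta> = (\<lambda>q v w. (\<alpha> q v * \<beta> q w + \<alpha> q w * \<beta> q v) / 2)"

text \<open>The tensor field \<open>L_X g\<close> through its values on pairs of vector fields \<open>V\<close>, \<open>W\<close>.\<close>

definition lie_deriv_metric ::
  "('a \<Rightarrow> 'a tvec) \<Rightarrow> ('a \<Rightarrow> 'a tvec \<Rightarrow> 'a tvec \<Rightarrow> real) \<Rightarrow>
   ('a \<Rightarrow> 'a tvec) \<Rightarrow> ('a \<Rightarrow> 'a tvec) \<Rightarrow> 'a \<Rightarrow> real" where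
  "lie_deriv_metric X g V W = (\<lambda>q. X q (\<lambda>r. g r (V r) (W r))
     - g q (lie_bracket X V q) (W q) - g q (V q) (lie_bracket X W q))"

definition module_SRF ::
  "('a, 'b::euclidean_space) atlas \<Rightarrow> ('a \<Rightarrow> 'a tvec \<Rightarrow> 'a tvec \<Rightarrow> real) \<Rightarrow>
   ('a \<Rightarrow> 'a tvec) set \<Rightarrow> bool" where
  "module_SRF A g F \<longleftrightarrow>
     (\<forall>X\<in>F. \<exists>(n::nat) \<omega> Y. (\<forall>i<n. \<omega> i \<in> one_forms A \<and> Y i \<in> F) \<and>
        (\<forall>V\<in>vector_fields A (points A). \<forall>W\<in>vector_fields A (points A).
           lie_deriv_metric X g V W =
             (\<lambda>q. \<Sum>i<n. sym_prod (\<omega> i) (flat g (Y i)) q (V q) (W q))))"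

section \<open>The cotangent bundle and its Poisson bracket\<close>

definition coord_vec :: "('a, 'b::euclidean_space) atlas \<Rightarrow> ('a, 'b) chart \<Rightarrow> 'a \<Rightarrow> 'b \<Rightarrow> 'a tvec" where
  "coord_vec A c q b = (\<lambda>f. if f \<in> smooth_funs A (points A)
     then frechet_derivative (f \<circ> chart_inv c) (at (snd c q)) b else 0)"

text \<open>The chart of the cotangent bundle induced by \<open>c\<close> maps \<open>(q, p)\<close> to the coordinates of \<open>q\<close>
  and the components \<open>p_i = p (\<partial>/\<partial>q_i)\<close>.\<close>

definition cotangent_chart ::
  "('a, 'b::euclidean_space) atlas \<Rightarrow> ('a, 'b) chart \<Rightarrow> ('a \<times> 'a covec, 'b \<times> 'b) chart" where
  "cotangent_chart A c = (Sigma (fst c) (cotangent_space A),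
     \<lambda>(q, p). (snd c q, \<Sum>b\<in>Basis. p (coord_vec A c q b) *\<^sub>R b))"

definition cotangent_bundle ::
  "('a, 'b::euclidean_space) atlas \<Rightarrow> ('a \<times> 'a covec, 'b \<times> 'b) atlas" where
  "cotangent_bundle A = cotangent_chart A ` A"

definition partial_q ::
  "('x, 'b \<times> 'b::euclidean_space) chart \<Rightarrow> ('x \<Rightarrow> real) \<Rightarrow> 'b \<Rightarrow> 'x \<Rightarrow> real" where
  "partial_q c f b x = frechet_derivative (f \<circ> chart_inv c) (at (snd c x)) (b, 0)"

definition partial_p ::
  "('x, 'b \<times> 'b::euclidean_space) chart \<Rightarrow> ('x \<Rightarrow> real) \<Rightarrow> 'b \<Rightarrow> 'x \<Rightarrow> real" where
  "partial_p c f b x = frechet_derivative (f \<circ> chart_inv c) (at (snd c x)) (0, b)"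

text \<open>The canonical bracket, normalised by \<open>{p_i, q_j} = \<delta>_ij\<close>, of functions on an open subset
  \<open>U\<close> of the cotangent bundle. The value does not depend on the choice of the induced chart.\<close>

definition poisson :: "('a, 'b::euclidean_space) atlas \<Rightarrow> ('a \<times> 'a covec) set \<Rightarrow>
    ('a \<times> 'a covec \<Rightarrow> real) \<Rightarrow> ('a \<times> 'a covec \<Rightarrow> real) \<Rightarrow> 'a \<times> 'a covec \<Rightarrow> real" where
  "poisson A U f h = (\<lambda>x. if x \<in> U then
     (let c = (SOME c. c \<in> cotangent_bundle A \<and> x \<in> fst c) in
        \<Sum>b\<in>Basis. partial_p c f b x * partial_q c h b x - partial_q c f b x * partial_p c h b x)
     else 0)"

definition fibre_linear ::
  "('a, 'b::euclidean_space) atlas \<Rightarrow> ('a \<Rightarrow> 'a tvec) \<Rightarrow> 'a \<times> 'a covec \<Rightarrow> real" where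
  "fibre_linear A X = (\<lambda>(q, p). if (q, p) \<in> points (cotangent_bundle A) then p (X q) else 0)"

definition ideal_J ::
  "('a, 'b::euclidean_space) atlas \<Rightarrow> ('a \<Rightarrow> 'a tvec) set \<Rightarrow> ('a \<times> 'a covec \<Rightarrow> real) set" where
  "ideal_J A F = {(\<lambda>x. \<Sum>i<n. h i x * fibre_linear A (X i) x) | (n::nat) h X.
     \<forall>i<n. h i \<in> smooth_funs_c (cotangent_bundle A) (points (cotangent_bundle A)) \<and> X i \<in> F}"

definition ideal_I :: "('a, 'b::euclidean_space) atlas \<Rightarrow> ('a \<Rightarrow> 'a tvec) set \<Rightarrow>
    ('a \<times> 'a covec) set \<Rightarrow> ('a \<times> 'a covec \<Rightarrow> real) set" where
  "ideal_I A F U = {f \<in> smooth_funs (cotangent_bundle A) U.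
     \<forall>\<rho>\<in>smooth_funs_c (cotangent_bundle A) U. (\<lambda>x. \<rho> x * f x) \<in> ideal_J A F}"

definition normalizer :: "('a, 'b::euclidean_space) atlas \<Rightarrow>
    (('a \<times> 'a covec) set \<Rightarrow> ('a \<times> 'a covec \<Rightarrow> real) set) \<Rightarrow> ('a \<times> 'a covec \<Rightarrow> real) set" where
  "normalizer A I = {f \<in> smooth_funs (cotangent_bundle A) (points (cotangent_bundle A)).
     \<forall>U. openin (mtop (cotangent_bundle A)) U \<longrightarrow>
       (\<forall>h\<in>I U. poisson A U (\<lambda>x. if x \<in> U then f x else 0) h \<in> I U)}"

definition hamiltonian :: "('a, 'b::euclidean_space) atlas \<Rightarrow>
    ('a \<Rightarrow> 'a tvec \<Rightarrow> 'a tvec \<Rightarrow> real) \<Rightarrow> 'a \<times> 'a covec \<Rightarrow> real" where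
  "hamiltonian A g = (\<lambda>(q, p). if (q, p) \<in> points (cotangent_bundle A)
     then p (inv_into (tangent_space A q) (g q) p) / 2 else 0)"

end

theory Submission
  imports Defs "HOL-Computational_Algebra.Polynomial"
begin

text \<open>
  The bridge between the two conditions is the identity
  \<open>{H_g, X}(q, g(v, -)) = (L_X g)(v, v) / 2\<close> for the fibre linear function of a vector field \<open>X\<close>.

  If \<open>L_X g = \<Sum> \<omega>_i \<odot> g(Y_i, -)\<close>, it says that \<open>{H_g, X}\<close> is a combination of the fibre linear functions
  of the \<open>Y_i\<close>, with coefficients \<open>\<omega>_i / 2\<close> regarded as fibre linear functions through the metric. The
  Leibniz rule in the form \<open>\<rho> {H_g, f} = {H_g, \<rho> f} - f {H_g, \<rho>}\<close> carries this over to the ideals.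

  Conversely, choose a cutoff \<open>\<rho>\<close> that is 1 on the zero section over the support of \<open>X\<close> and write
  \<open>\<rho> {H_g, X} = \<Sum> h_i Y_i\<close>. At \<open>(q, t p)\<close> the left hand side is \<open>t^2 \<rho>(q, t p) {H_g, X}(q, p)\<close> and the right
  hand side is \<open>t \<Sum> h_i(q, t p) Y_i(q, p)\<close>; dividing by \<open>t\<close> and differentiating at \<open>t = 0\<close> shows that the fibre
  derivatives of the \<open>h_i\<close> along the zero section are the required one-forms, up to the metric. Polarization
  passes from \<open>(v, v)\<close> to \<open>(v, w)\<close>.
\<close>

section \<open>Calculus of smooth functions\<close>

text \<open>Two obstacles lie outside the computation itself. Membership in \<open>ideal_J\<close>
  demands coefficients with compact support on the cotangent bundle, whereas \<open>{H_g, X}\<close>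
  is quadratic along the fibres even if \<open>X\<close> has compact support; hence statements about
  it are tested against cutoffs. For the converse a cutoff equal to 1 on a compact piece of the zero
  section suffices, because only second order behaviour at the zero section is read off: division by
  \<open>t\<close> turns the quadratic left hand side into a linear one, and the values of the
  \<open>h_i\<close> on the zero section drop out on differentiation. Off the support of
  \<open>X\<close>, where nothing is known of the cutoff, the left hand side is zero anyway. The
  other obstacle is that tangent vectors act on global functions and that \<open>poisson\<close>
  picks a chart by choice. So derivations must be identified with coordinate vectors (bump functions
  and Hadamard's lemma), and the bracket must be shown independent of the chart (symmetry of second
  derivatives), before coordinate formulas can be used.\<close>

lemma Ck_on_cong:
  assumes "open S" "\<And>x. x \<in> S \<Longrightarrow> f x = g x"
  shows "Ck_on k S f = Ck_on k S g"
  using assms(2)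
proof (induction k arbitrary: f g)
  case 0
  then show ?case by (auto cong: continuous_on_cong)
next
  case (Suc k)
  have ev: "(f has_derivative D) (at x) \<longleftrightarrow> (g has_derivative D) (at x)" if "x \<in> S" for x D
    using has_derivative_transform_within_open[OF _ assms(1) that, of f D UNIV g]
      has_derivative_transform_within_open[OF _ assms(1) that, of g D UNIV f] Suc.prems by auto
  have "f differentiable at x \<longleftrightarrow> g differentiable at x" if "x \<in> S" for x
    using ev[OF that] by (simp add: differentiable_def)
  moreover have "frechet_derivative f (at x) = frechet_derivative g (at x)" if "x \<in> S" for x
    using ev[OF that] by (simp add: frechet_derivative_def)
  ultimately show ?case
    using Suc.IH[of "\<lambda>x. frechet_derivative f (at x) _" "\<lambda>x. frechet_derivative g (at x) _"] by simp
qed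

lemma smooth_on_cong:
  assumes "open S" "\<And>x. x \<in> S \<Longrightarrow> f x = g x"
  shows "smooth_on S f = smooth_on S g"
  using Ck_on_cong[OF assms] by (simp add: smooth_on_def)

text \<open>\<open>frechet_derivative\<close> is a choice term; this rule lets the derivative be
  exhibited as a formula \<open>D\<close>. The two agree on all of \<open>S\<close>, which for open
  \<open>S\<close> is enough to exchange them in the next order.\<close>

lemma Ck_on_SucI:
  assumes "open S" "\<And>x. x \<in> S \<Longrightarrow> (f has_derivative D x) (at x)" "\<And>v. Ck_on k S (\<lambda>x. D x v)"
  shows "Ck_on (Suc k) S f"
proof -
  have "Ck_on k S (\<lambda>x. frechet_derivative f (at x) v)" for v
    using assms(3)[of v] Ck_on_cong[OF assms(1), of "\<lambda>x. frechet_derivative f (at x) v" "\<lambda>x. D x v"]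
      frechet_derivative_at[OF assms(2)] by simp
  then show ?thesis using assms(2) by (auto simp: differentiable_def)
qed

lemma Ck_on_SucD:
  assumes "Ck_on (Suc k) S f" "x \<in> S"
  shows "(f has_derivative frechet_derivative f (at x)) (at x)"
  using assms frechet_derivative_works by auto

lemma Ck_on_Suc_imp: "Ck_on (Suc k) S f \<Longrightarrow> Ck_on k S f"
proof (induction k arbitrary: f)
  case 0
  then show ?case
    by (auto intro!: continuous_at_imp_continuous_on differentiable_imp_continuous_within)
qed simp

lemma smooth_on_Ck: "smooth_on S f \<Longrightarrow> Ck_on k S f"
  by (simp add: smooth_on_def)

lemma smooth_on_has_derivative:
  "smooth_on S f \<Longrightarrow> x \<in> S \<Longrightarrow> (f has_derivative frechet_derivative f (at x)) (at x)"
  using Ck_on_SucD smooth_on_Ck by blast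

lemma smooth_on_frechet_derivative:
  "smooth_on S f \<Longrightarrow> smooth_on S (\<lambda>x. frechet_derivative f (at x) v)"
  unfolding smooth_on_def by (metis Ck_on.simps(2))

lemma smooth_on_continuous: "smooth_on S f \<Longrightarrow> continuous_on S f"
  using Ck_on.simps(1) smooth_on_Ck by metis

text \<open>Derivatives are taken in full neighbourhoods (\<open>at x\<close>, not
  \<open>at x within S\<close>), so restriction changes none of them, even if \<open>T\<close> is
  not open.\<close>

lemma Ck_on_subset: "Ck_on k S f \<Longrightarrow> T \<subseteq> S \<Longrightarrow> Ck_on k T f"
  by (induction k arbitrary: f) (auto intro: continuous_on_subset)

lemma smooth_on_subset: "smooth_on S f \<Longrightarrow> T \<subseteq> S \<Longrightarrow> smooth_on T f"
  unfolding smooth_on_def by (blast intro: Ck_on_subset)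

lemma Ck_on_UN:
  assumes "\<And>T. T \<in> \<T> \<Longrightarrow> open T \<and> Ck_on k T f"
  shows "Ck_on k (\<Union>\<T>) f"
  using assms by (induction k arbitrary: f) (auto intro!: continuous_on_open_Union)

lemma smooth_on_local:
  assumes "\<And>x. x \<in> S \<Longrightarrow> \<exists>T. open T \<and> x \<in> T \<and> smooth_on T f"
  shows "smooth_on S f"
proof -
  have "smooth_on (\<Union>{T. open T \<and> smooth_on T f}) f"
    using Ck_on_UN[of "{T. open T \<and> smooth_on T f}"] by (auto simp: smooth_on_def)
  moreover have "S \<subseteq> \<Union>{T. open T \<and> smooth_on T f}" using assms by blast
  ultimately show ?thesis by (rule smooth_on_subset)
qed

lemma Ck_on_const: "Ck_on k S (\<lambda>x. c)"
proof (induction k arbitrary: c)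
  case (Suc k)
  have "frechet_derivative (\<lambda>x. c) (at x) v = 0" for x :: 'a and v
    by simp
  then show ?case using Suc by simp
qed simp

lemma Ck_on_bounded_linear_comp:
  assumes "open S" "bounded_linear l" "Ck_on k S f"
  shows "Ck_on k S (\<lambda>x. l (f x))"
  using assms(3)
proof (induction k arbitrary: f)
  case 0
  then show ?case using assms(2) by (simp add: linear_continuous_on_compose bounded_linear.continuous_on)
next
  case (Suc k)
  show ?case
  proof (rule Ck_on_SucI[OF assms(1)])
    show "((\<lambda>x. l (f x)) has_derivative (\<lambda>v. l (frechet_derivative f (at x) v))) (at x)" if "x \<in> S" for x
      using bounded_linear.has_derivative[OF assms(2) Ck_on_SucD[OF Suc.prems that]] .
  qed (use Suc in auto)
qed

lemma Ck_on_add: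
  assumes "open S" "Ck_on k S f" "Ck_on k S g"
  shows "Ck_on k S (\<lambda>x. f x + g x)"
  using assms(2,3)
proof (induction k arbitrary: f g)
  case (Suc k)
  show ?case
  proof (rule Ck_on_SucI[OF assms(1)])
    show "((\<lambda>x. f x + g x) has_derivative (\<lambda>v. frechet_derivative f (at x) v + frechet_derivative g (at x) v)) (at x)" if "x \<in> S" for x
      using Suc.prems that by (intro has_derivative_add Ck_on_SucD)
  qed (use Suc in auto)
qed (auto intro: continuous_on_add)

lemma Ck_on_bilinear:
  assumes "open S" "bounded_bilinear p" "Ck_on k S f" "Ck_on k S g"
  shows "Ck_on k S (\<lambda>x. p (f x) (g x))"
  using assms(3,4)
proof (induction k arbitrary: f g)
  case 0
  then show ?case by (auto intro: bounded_bilinear.continuous_on[OF assms(2)])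
next
  case (Suc k)
  show ?case
  proof (rule Ck_on_SucI[OF assms(1)])
    show "((\<lambda>x. p (f x) (g x)) has_derivative (\<lambda>v. p (f x) (frechet_derivative g (at x) v) + p (frechet_derivative f (at x) v) (g x))) (at x)" if "x \<in> S" for x
      using Suc.prems that by (intro bounded_bilinear.FDERIV[OF assms(2)] Ck_on_SucD)
    show "Ck_on k S (\<lambda>x. p (f x) (frechet_derivative g (at x) v) + p (frechet_derivative f (at x) v) (g x))" for v
      using Suc.prems Ck_on_Suc_imp[OF Suc.prems(1)] Ck_on_Suc_imp[OF Suc.prems(2)]
      by (intro Ck_on_add assms(1) Suc.IH) simp_all
  qed
qed

lemma Ck_on_sum:
  assumes "open S" "\<And>i. i \<in> I \<Longrightarrow> Ck_on k S (f i)"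
  shows "Ck_on k S (\<lambda>x. \<Sum>i\<in>I. f i x)"
  using assms(2) by (induction I rule: infinite_finite_induct) (auto intro: Ck_on_const Ck_on_add assms(1))

lemma linear_basis_expansion:
  fixes l :: "'a::euclidean_space \<Rightarrow> 'b::real_vector"
  assumes "linear l"
  shows "l w = (\<Sum>b\<in>Basis. (w \<bullet> b) *\<^sub>R l b)"
proof -
  have "l w = l (\<Sum>b\<in>Basis. (w \<bullet> b) *\<^sub>R b)" by (simp only: euclidean_representation)
  then show ?thesis by (simp only: linear_sum[OF assms] linear_cmul[OF assms])
qed

text \<open>By the chain rule the derivative in direction \<open>v\<close> is a sum over the basis
  of \<open>Df v \<bullet> b\<close> times \<open>D_b g\<close> at \<open>f x\<close>. The expansion
  frees the derivative of \<open>g\<close> from a direction that depends on \<open>x\<close>, and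
  the inner map stays \<open>f\<close>, so the induction varies \<open>g\<close> only.\<close>

lemma Ck_on_compose:
  fixes f :: "'a::euclidean_space \<Rightarrow> 'b::euclidean_space" and g :: "'b \<Rightarrow> 'c::real_normed_vector"
  assumes "open S" "Ck_on k T g" "Ck_on k S f" "f ` S \<subseteq> T"
  shows "Ck_on k S (\<lambda>x. g (f x))"
  using assms(2,3)
proof (induction k arbitrary: g)
  case 0
  then show ?case using assms(4) by (auto intro: continuous_on_compose2)
next
  case (Suc k)
  show ?case
  proof (rule Ck_on_SucI[OF assms(1)])
    fix x assume x: "x \<in> S"
    let ?G = "frechet_derivative g (at (f x))"
    have G: "(g has_derivative ?G) (at (f x))"
      using Suc.prems(1) assms(4) x by (intro Ck_on_SucD) auto
    have "((\<lambda>x. g (f x)) has_derivative (\<lambda>v. ?G (frechet_derivative f (at x) v))) (at x)"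
      by (rule has_derivative_compose[OF Ck_on_SucD[OF Suc.prems(2) x] G])
    also have "(\<lambda>v. ?G (frechet_derivative f (at x) v)) =
        (\<lambda>v. \<Sum>b\<in>Basis. (frechet_derivative f (at x) v \<bullet> b) *\<^sub>R ?G b)"
      using linear_basis_expansion[OF has_derivative_linear[OF G]] by blast
    finally show "((\<lambda>x. g (f x)) has_derivative \<dots>) (at x)" .
  next
    fix v
    have "Ck_on k S (\<lambda>x. frechet_derivative f (at x) v \<bullet> b)" for b
      using Ck_on_bounded_linear_comp[OF assms(1) bounded_linear_inner_left, of k "\<lambda>x. frechet_derivative f (at x) v"]
        Suc.prems(2) by simp
    moreover have "Ck_on k S (\<lambda>x. frechet_derivative g (at (f x)) b)" for b
      using Suc.prems(1) Ck_on_Suc_imp[OF Suc.prems(2)]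
      by (intro Suc.IH[of "\<lambda>y. frechet_derivative g (at y) b"]) simp_all
    ultimately show "Ck_on k S (\<lambda>x. \<Sum>b\<in>Basis. (frechet_derivative f (at x) v \<bullet> b) *\<^sub>R frechet_derivative g (at (f x)) b)"
      by (intro Ck_on_sum Ck_on_bilinear[OF _ bounded_bilinear_scaleR] assms(1))
  qed
qed

lemma smooth_on_const: "smooth_on S (\<lambda>x. c)"
  by (simp add: smooth_on_def Ck_on_const)

lemma smooth_on_bounded_linear_comp:
  "bounded_linear l \<Longrightarrow> open S \<Longrightarrow> smooth_on S f \<Longrightarrow> smooth_on S (\<lambda>x. l (f x))"
  by (simp add: smooth_on_def Ck_on_bounded_linear_comp)

lemma smooth_on_ident: "smooth_on S (\<lambda>x. x)"
proof -
  have "Ck_on k S (\<lambda>x. x)" for k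
    by (cases k) (auto simp: Ck_on_const)
  then show ?thesis by (simp add: smooth_on_def)
qed

lemma smooth_on_linear: "bounded_linear l \<Longrightarrow> smooth_on S l"
  by (rule smooth_on_subset[OF smooth_on_bounded_linear_comp[OF _ open_UNIV smooth_on_ident]]) auto

lemma smooth_on_add:
  "open S \<Longrightarrow> smooth_on S f \<Longrightarrow> smooth_on S g \<Longrightarrow> smooth_on S (\<lambda>x. f x + g x)"
  by (simp add: smooth_on_def Ck_on_add)

lemma smooth_on_bilinear:
  "bounded_bilinear p \<Longrightarrow> open S \<Longrightarrow> smooth_on S f \<Longrightarrow> smooth_on S g \<Longrightarrow> smooth_on S (\<lambda>x. p (f x) (g x))"
  by (simp add: smooth_on_def Ck_on_bilinear)

lemmas smooth_on_scaleR = smooth_on_bilinear[OF bounded_bilinear_scaleR]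
  and smooth_on_inner = smooth_on_bilinear[OF bounded_bilinear_inner]

lemma smooth_on_mult:
  fixes f g :: "'a::euclidean_space \<Rightarrow> real"
  shows "open S \<Longrightarrow> smooth_on S f \<Longrightarrow> smooth_on S g \<Longrightarrow> smooth_on S (\<lambda>x. f x * g x)"
  by (rule smooth_on_bilinear[OF bounded_bilinear_mult])

lemma smooth_on_uminus:
  "open S \<Longrightarrow> smooth_on S f \<Longrightarrow> smooth_on S (\<lambda>x. - f x)"
  by (rule smooth_on_bounded_linear_comp[OF bounded_linear_minus[OF bounded_linear_ident]])

lemma smooth_on_diff:
  "open S \<Longrightarrow> smooth_on S f \<Longrightarrow> smooth_on S g \<Longrightarrow> smooth_on S (\<lambda>x. f x - g x)"
  using smooth_on_add[OF _ _ smooth_on_uminus, of S f g] by simp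

lemma smooth_on_sum:
  "open S \<Longrightarrow> (\<And>i. i \<in> I \<Longrightarrow> smooth_on S (f i)) \<Longrightarrow> smooth_on S (\<lambda>x. \<Sum>i\<in>I. f i x)"
  by (simp add: smooth_on_def Ck_on_sum)

lemma smooth_on_compose:
  fixes f :: "'a::euclidean_space \<Rightarrow> 'b::euclidean_space"
  shows "open S \<Longrightarrow> smooth_on T g \<Longrightarrow> smooth_on S f \<Longrightarrow> f ` S \<subseteq> T \<Longrightarrow> smooth_on S (\<lambda>x. g (f x))"
  unfolding smooth_on_def using Ck_on_compose by blast

lemma smooth_on_fst: "open S \<Longrightarrow> smooth_on S f \<Longrightarrow> smooth_on S (\<lambda>x. fst (f x))"
  by (rule smooth_on_bounded_linear_comp[OF bounded_linear_fst])

lemma smooth_on_Pair: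
  assumes "open S" "smooth_on S f" "smooth_on S g"
  shows "smooth_on S (\<lambda>x. (f x, g x))"
proof -
  have "smooth_on S (\<lambda>x. (f x, 0) + (0, g x))"
    using smooth_on_bounded_linear_comp[OF bounded_linear_Pair[OF bounded_linear_ident bounded_linear_zero] assms(1,2)]
      smooth_on_bounded_linear_comp[OF bounded_linear_Pair[OF bounded_linear_zero bounded_linear_ident] assms(1,3)]
    by (intro smooth_on_add assms(1))
  then show ?thesis by simp
qed

text \<open>A product rule in which \<open>g\<close> is merely continuous: since
  \<open>f x = 0\<close>, a derivative of \<open>g\<close> would not contribute. It serves to
  differentiate an inverse of which only continuity is known so far.\<close>

lemma has_derivative_mult_zero_left:
  fixes f :: "'a::real_normed_vector \<Rightarrow> real" and g :: "'a \<Rightarrow> 'b::real_normed_vector"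
  assumes f: "(f has_derivative f') (at x)" and "f x = 0" and g: "isCont g x"
  shows "((\<lambda>y. f y *\<^sub>R g y) has_derivative (\<lambda>v. f' v *\<^sub>R g x)) (at x)"
proof -
  interpret f': bounded_linear f' using f by (rule has_derivative_bounded_linear)
  obtain K where K: "\<And>h. norm (f' h) \<le> norm h * K" "K > 0" using f'.pos_bounded by blast
  let ?e = "\<lambda>y. (f y - f' (y - x)) /\<^sub>R norm (y - x)"
  have e: "(?e \<longlongrightarrow> 0) (at x)"
    using f \<open>f x = 0\<close> by (simp add: has_derivative_at_within)
  have "((\<lambda>y. ?e y *\<^sub>R g y + (f' (y - x) / norm (y - x)) *\<^sub>R (g y - g x)) \<longlongrightarrow> 0 *\<^sub>R g x + 0) (at x)"
  proof (intro tendsto_add tendsto_scaleR e)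
    show "(g \<longlongrightarrow> g x) (at x)" using g by (simp add: isCont_def)
    show "((\<lambda>y. (f' (y - x) / norm (y - x)) *\<^sub>R (g y - g x)) \<longlongrightarrow> 0) (at x)"
    proof (rule Lim_null_comparison)
      show "\<forall>\<^sub>F y in at x. norm ((f' (y - x) / norm (y - x)) *\<^sub>R (g y - g x)) \<le> K * norm (g y - g x)"
      proof (intro always_eventually allI)
        fix y
        have "\<bar>f' (y - x)\<bar> / norm (y - x) \<le> K" using K(1)[of "y - x"] K(2) by (simp add: divide_simps mult_ac)
        then show "norm ((f' (y - x) / norm (y - x)) *\<^sub>R (g y - g x)) \<le> K * norm (g y - g x)"
          using mult_right_mono[of "\<bar>f' (y - x)\<bar> / norm (y - x)" K "norm (g y - g x)"] by simp
      qed
      show "((\<lambda>y. K * norm (g y - g x)) \<longlongrightarrow> 0) (at x)"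
        using g unfolding isCont_def by (auto intro!: tendsto_mult_right_zero tendsto_norm_zero LIM_zero)
    qed
  qed
  moreover have "?e y *\<^sub>R g y + (f' (y - x) / norm (y - x)) *\<^sub>R (g y - g x) =
      (f y *\<^sub>R g y - f x *\<^sub>R g x - f' (y - x) *\<^sub>R g x) /\<^sub>R norm (y - x)" for y
    using \<open>f x = 0\<close> by (simp add: algebra_simps divide_inverse scaleR_diff_right)
  ultimately show ?thesis
    using bounded_linear_compose[OF bounded_linear_scaleR_left f'.bounded_linear_axioms]
    by (simp add: has_derivative_at_within)
qed

text \<open>Inversion of linear maps is smooth, without determinants: continuity comes from a lower
  bound for \<open>G x\<close>, differentiability from
  \<open>K x w - K x0 w = - K x (G x z - G x0 z)\<close> with \<open>z = K x0 w\<close>, and all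
  orders by induction, since the derivative of \<open>K\<close> is polynomial in \<open>K\<close>
  and first derivatives of \<open>G\<close>.\<close>

lemma Ck_on_inverse_family:
  fixes G K :: "'a::euclidean_space \<Rightarrow> 'b::euclidean_space \<Rightarrow> 'b"
  assumes S: "open S" and lin: "\<And>x. x \<in> S \<Longrightarrow> linear (G x)"
    and smooth: "\<And>w. smooth_on S (\<lambda>x. G x w)"
    and KG: "\<And>x w. x \<in> S \<Longrightarrow> K x (G x w) = w" and GK: "\<And>x w. x \<in> S \<Longrightarrow> G x (K x w) = w"
  shows "Ck_on k S (\<lambda>x. K x w)"
proof -
  have linK: "linear (K x)" if "x \<in> S" for x
  proof (rule linearI)
    fix a b :: 'b and c :: real
    show "K x (a + b) = K x a + K x b"
      using KG[OF that, of "K x a + K x b"] by (simp add: linear_add[OF lin[OF that]] GK[OF that])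
    show "K x (c *\<^sub>R a) = c *\<^sub>R K x a"
      using KG[OF that, of "c *\<^sub>R K x a"] by (simp add: linear_cmul[OF lin[OF that]] GK[OF that])
  qed
  have cont: "isCont (\<lambda>x. K x w) x0" if x0: "x0 \<in> S" for x0 w
  proof -
    have "inj (G x0)" by (metis KG[OF x0] injI)
    then obtain l where l: "l > 0" "\<And>v. l * norm v \<le> norm (G x0 v)"
      using linear_inj_bounded_below_pos[OF lin[OF x0]] by blast
    have Gc: "isCont (\<lambda>x. G x v) x0" for v
      using smooth_on_continuous[OF smooth] S x0 by (simp add: continuous_on_eq_continuous_at)
    \<comment> \<open>\<open>?s x\<close> dominates the operator norm of \<open>G x - G x0\<close>.
      Once it is below \<open>l / 2\<close>, \<open>G x\<close> keeps half of the lower bound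
      \<open>l\<close> of \<open>G x0\<close>, whence the factor \<open>2 / l\<close>.\<close>
    let ?s = "\<lambda>x. \<Sum>b\<in>Basis. norm (G x b - G x0 b)"
    have "isCont ?s x0" using Gc by (intro continuous_intros)
    then have "\<forall>\<^sub>F x in at x0. ?s x < l / 2"
      using l(1) by (intro order_tendstoD) (auto simp: isCont_def)
    moreover have "\<forall>\<^sub>F x in at x0. x \<in> S" using S x0 by (simp add: eventually_at_in_open')
    ultimately have "\<forall>\<^sub>F x in at x0. norm (K x w - K x0 w) \<le> (2 / l) * norm (G x (K x0 w) - G x0 (K x0 w))"
    proof eventually_elim
      case (elim x)
      define v where "v = K x w - K x0 w"
      have Gl: "linear (\<lambda>v. G x v - G x0 v)" using lin elim x0 by (intro linear_compose_sub) auto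
      have "norm (G x v - G x0 v) \<le> (\<Sum>b\<in>Basis. norm ((v \<bullet> b) *\<^sub>R (G x b - G x0 b)))"
        by (subst linear_basis_expansion[OF Gl]) (rule norm_sum)
      also have "\<dots> \<le> (\<Sum>b\<in>Basis. norm v * norm (G x b - G x0 b))"
        by (intro sum_mono) (auto intro!: mult_right_mono Basis_le_norm)
      also have "\<dots> \<le> norm v * (l / 2)"
        unfolding sum_distrib_left[symmetric] using elim by (intro mult_left_mono) auto
      finally have "l * norm v \<le> norm (G x v) + norm v * (l / 2)"
        using l(2)[of v] norm_triangle_sub[of "G x0 v" "G x v"] by (simp add: norm_minus_commute)
      then have "norm v \<le> (2 / l) * norm (G x v)" using l(1) by (simp add: field_simps)
      moreover have "G x v = - (G x (K x0 w) - G x0 (K x0 w))"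
        using lin[of x] elim GK x0 by (simp add: v_def linear_diff)
      ultimately show ?case by (simp add: v_def norm_minus_commute)
    qed
    moreover have "((\<lambda>x. (2 / l) * norm (G x (K x0 w) - G x0 (K x0 w))) \<longlongrightarrow> 0) (at x0)"
      using Gc unfolding isCont_def by (intro tendsto_mult_right_zero tendsto_norm_zero LIM_zero)
    ultimately have "((\<lambda>x. K x w - K x0 w) \<longlongrightarrow> 0) (at x0)" by (rule Lim_null_comparison)
    then show ?thesis by (simp add: isCont_def LIM_zero_iff)
  qed
  \<comment> \<open>The classical \<open>- K (DG) K\<close>, with the outer \<open>K x\<close>
    expanded in the basis.\<close>
  define D where "D x w v = - (\<Sum>b\<in>Basis. (frechet_derivative (\<lambda>y. G y (K x w)) (at x) v \<bullet> b) *\<^sub>R K x b)" for x w v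
  have deriv: "((\<lambda>x. K x w) has_derivative D x0 w) (at x0)" if x0: "x0 \<in> S" for x0 w
  proof -
    let ?z = "K x0 w"
    let ?f = "\<lambda>x. G x ?z - G x0 ?z" and ?f' = "frechet_derivative (\<lambda>y. G y ?z) (at x0)"
    have "(?f has_derivative ?f') (at x0)"
      using has_derivative_diff[OF smooth_on_has_derivative[OF smooth x0] has_derivative_const] by simp
    then have "((\<lambda>x. ?f x \<bullet> b) has_derivative (\<lambda>v. ?f' v \<bullet> b)) (at x0)" for b
      by (rule has_derivative_inner_left)
    then have "((\<lambda>x. (?f x \<bullet> b) *\<^sub>R K x b) has_derivative (\<lambda>v. (?f' v \<bullet> b) *\<^sub>R K x0 b)) (at x0)" for b
      by (rule has_derivative_mult_zero_left) (auto simp: cont[OF x0])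
    then have "((\<lambda>x. ?z - (\<Sum>b\<in>Basis. (?f x \<bullet> b) *\<^sub>R K x b)) has_derivative (\<lambda>v. 0 - (\<Sum>b\<in>Basis. (?f' v \<bullet> b) *\<^sub>R K x0 b))) (at x0)"
      by (intro has_derivative_diff has_derivative_const has_derivative_sum)
    moreover have "(\<lambda>v. 0 - (\<Sum>b\<in>Basis. (?f' v \<bullet> b) *\<^sub>R K x0 b)) = D x0 w" by (simp add: D_def fun_eq_iff)
    moreover have "?z - (\<Sum>b\<in>Basis. (?f x \<bullet> b) *\<^sub>R K x b) = K x w" if "x \<in> S" for x
      unfolding linear_basis_expansion[OF linK[OF that], of "?f x", symmetric]
      by (simp add: linear_diff[OF linK[OF that]] KG[OF that] GK[OF x0])
    ultimately have "((\<lambda>x. ?z - (\<Sum>b\<in>Basis. (?f x \<bullet> b) *\<^sub>R K x b)) has_derivative D x0 w) (at x0)"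
      "\<And>x. x \<in> S \<Longrightarrow> ?z - (\<Sum>b\<in>Basis. (?f x \<bullet> b) *\<^sub>R K x b) = K x w" by simp_all
    then show ?thesis by (rule has_derivative_transform_within_open[OF _ S x0])
  qed
  show ?thesis
  proof (induction k arbitrary: w)
    case 0
    then show ?case using cont by (auto intro: continuous_at_imp_continuous_on)
  next
    case (Suc k)
    \<comment> \<open>In \<open>D\<close> the derivative of \<open>G\<close> is taken at the moving
      vector \<open>K x w\<close>; expanding that vector leaves derivatives of \<open>G\<close> at
      fixed basis vectors, which are smooth in \<open>x\<close>.\<close>
    have Dx: "frechet_derivative (\<lambda>y. G y u) (at x) v \<bullet> b =
        (\<Sum>e\<in>Basis. (u \<bullet> e) * (frechet_derivative (\<lambda>y. G y e) (at x) v \<bullet> b))" if x: "x \<in> S" for u x v b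
    proof -
      have "((\<lambda>y. \<Sum>e\<in>Basis. (u \<bullet> e) *\<^sub>R G y e) has_derivative (\<lambda>v. \<Sum>e\<in>Basis. (u \<bullet> e) *\<^sub>R frechet_derivative (\<lambda>y. G y e) (at x) v)) (at x)"
        by (intro has_derivative_sum has_derivative_scaleR_right smooth_on_has_derivative[OF smooth x])
      moreover have "(\<Sum>e\<in>Basis. (u \<bullet> e) *\<^sub>R G y e) = G y u" if "y \<in> S" for y
        by (rule linear_basis_expansion[OF lin[OF that], symmetric])
      ultimately have "((\<lambda>y. G y u) has_derivative (\<lambda>v. \<Sum>e\<in>Basis. (u \<bullet> e) *\<^sub>R frechet_derivative (\<lambda>y. G y e) (at x) v)) (at x)"
        by (rule has_derivative_transform_within_open[OF _ S x])
      from frechet_derivative_at[OF this, symmetric] show ?thesis by (simp add: inner_sum_left)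
    qed
    show ?case
    proof (rule Ck_on_SucI[OF S deriv])
      fix v
      have inn: "Ck_on k S (\<lambda>x. f x \<bullet> b)" if "Ck_on k S f" for f :: "'a \<Rightarrow> 'b" and b
        using that Ck_on_bounded_linear_comp[OF S bounded_linear_inner_left, of k f b] by simp
      have "Ck_on k S (\<lambda>x. frechet_derivative (\<lambda>y. G y e) (at x) v \<bullet> b)" for e b
        by (rule inn, rule smooth_on_Ck, rule smooth_on_frechet_derivative, rule smooth)
      moreover have "Ck_on k S (\<lambda>x. K x w \<bullet> e)" for e by (rule inn, rule Suc.IH)
      ultimately have "Ck_on k S (\<lambda>x. - (\<Sum>b\<in>Basis. (\<Sum>e\<in>Basis. (K x w \<bullet> e) * (frechet_derivative (\<lambda>y. G y e) (at x) v \<bullet> b)) *\<^sub>R K x b))"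
        by (intro Ck_on_bounded_linear_comp[OF S bounded_linear_minus[OF bounded_linear_ident]] Ck_on_sum[OF S]
          Ck_on_bilinear[OF S bounded_bilinear_scaleR] Ck_on_bilinear[OF S bounded_bilinear_mult] Suc.IH)
      then show "Ck_on k S (\<lambda>x. D x w v)"
        by (subst Ck_on_cong[OF S]) (auto simp: D_def Dx)
    qed
  qed
qed

lemma smooth_on_inverse_family:
  fixes G K :: "'a::euclidean_space \<Rightarrow> 'b::euclidean_space \<Rightarrow> 'b"
  assumes "open S" "\<And>x. x \<in> S \<Longrightarrow> linear (G x)" "\<And>w. smooth_on S (\<lambda>x. G x w)"
    and "\<And>x w. x \<in> S \<Longrightarrow> K x (G x w) = w" "\<And>x w. x \<in> S \<Longrightarrow> G x (K x w) = w"
  shows "smooth_on S (\<lambda>x. K x w)"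
  using Ck_on_inverse_family[OF assms] by (simp add: smooth_on_def)

text \<open>The one-dimensional case of \<open>smooth_on_inverse_family\<close>: division inverts
  multiplication by \<open>g x\<close>.\<close>

lemma smooth_on_divide:
  fixes f g :: "'a::euclidean_space \<Rightarrow> real"
  assumes "open S" "smooth_on S f" "smooth_on S g" "\<And>x. x \<in> S \<Longrightarrow> g x \<noteq> 0"
  shows "smooth_on S (\<lambda>x. f x / g x)"
proof -
  have "smooth_on S (\<lambda>x. 1 / g x)"
    by (rule smooth_on_inverse_family[of S "\<lambda>x w. g x * w" "\<lambda>x w. w / g x"])
      (use assms in \<open>auto intro!: smooth_on_mult smooth_on_const linearI simp: algebra_simps\<close>)
  from smooth_on_mult[OF assms(1,2) this] show ?thesis by simp
qed

section \<open>Smooth bump functions on Euclidean space\<close>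

definition flat_fun :: "real poly \<Rightarrow> real \<Rightarrow> real" where
  "flat_fun p t = (if t \<le> 0 then 0 else poly p (1 / t) * exp (- (1 / t)))"

lemma flat_fun_tendsto_0: "(flat_fun p \<longlongrightarrow> 0) (at_right 0)"
proof -
  have "((\<lambda>u. coeff p i * (u ^ i / exp u)) \<longlongrightarrow> coeff p i * 0) at_top" for i
    by (intro tendsto_mult tendsto_const tendsto_power_div_exp_0)
  then have "((\<lambda>u. \<Sum>i\<le>degree p. coeff p i * (u ^ i / exp u)) \<longlongrightarrow> (\<Sum>i\<le>degree p. 0)) at_top"
    by (intro tendsto_sum) simp
  then have "((\<lambda>u. poly p u * exp (- u)) \<longlongrightarrow> 0) at_top"
    by (simp add: poly_altdef sum_distrib_right exp_minus divide_inverse mult.assoc)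
  then have "((\<lambda>t. poly p (inverse t) * exp (- inverse t)) \<longlongrightarrow> 0) (at_right 0)"
    by (rule filterlim_compose) (rule filterlim_inverse_at_top_right)
  then show ?thesis
    by (rule Lim_transform_eventually) (auto simp: flat_fun_def eventually_at_filter inverse_eq_divide)
qed

text \<open>The functions \<open>p(1/t) exp(-1/t)\<close>, extended by 0, are closed under
  differentiation: with \<open>u = 1/t\<close> the derivative belongs to the polynomial
  \<open>u^2 (p - p')\<close>. Carrying \<open>p\<close> along turns smoothness at 0 into an
  induction.\<close>

lemma flat_fun_has_derivative:
  "(flat_fun p has_real_derivative flat_fun ([:0, 0, 1:] * (p - pderiv p)) t) (at t)"
proof -
  consider "t < 0" | "t = 0" | "t > 0" by linarith
  then show ?thesis
  proof cases
    case 1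
    have "((\<lambda>t. 0 :: real) has_real_derivative 0) (at t)" by simp
    then have "(flat_fun p has_real_derivative 0) (at t)"
      by (rule has_field_derivative_transform_within_open[of _ _ _ "{..<0}"]) (use 1 in \<open>auto simp: flat_fun_def\<close>)
    then show ?thesis using 1 by (simp add: flat_fun_def)
  next
    case 2
    \<comment> \<open>On the right of 0 the difference quotient is again in the family, since
      division by \<open>y\<close> multiplies the polynomial by \<open>[:0, 1:]\<close>.\<close>
    have "((\<lambda>y. flat_fun p y / y) \<longlongrightarrow> 0) (at_right 0)"
      by (rule Lim_transform_eventually[OF flat_fun_tendsto_0[of "[:0, 1:] * p"]])
        (auto simp: flat_fun_def eventually_at_filter)
    moreover have "((\<lambda>y. flat_fun p y / y) \<longlongrightarrow> 0) (at_left 0)"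
      by (rule Lim_transform_eventually[OF tendsto_const]) (auto simp: flat_fun_def eventually_at_filter)
    ultimately show ?thesis
      using 2 by (simp add: has_field_derivative_iff flat_fun_def filterlim_at_split)
  next
    case 3
    have "((\<lambda>t. poly p (1 / t) * exp (- (1 / t))) has_real_derivative
        flat_fun ([:0, 0, 1:] * (p - pderiv p)) t) (at t)"
      using 3 by (auto intro!: derivative_eq_intros simp: flat_fun_def power2_eq_square field_simps)
    then show ?thesis
      by (rule has_field_derivative_transform_within_open[of _ _ _ "{0<..}"]) (use 3 in \<open>auto simp: flat_fun_def\<close>)
  qed
qed

lemma smooth_on_flat_fun: "smooth_on UNIV (flat_fun p)"
proof -
  \<comment> \<open>The constant \<open>c\<close> absorbs the direction: the derivative in direction
    \<open>v\<close> carries a factor \<open>v\<close>.\<close>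
  have "Ck_on k UNIV (\<lambda>x. c * flat_fun p x)" for k c
  proof (induction k arbitrary: p c)
    case 0
    show ?case
      using DERIV_isCont[OF flat_fun_has_derivative] by (auto intro!: continuous_at_imp_continuous_on continuous_intros simp del: mult_pCons_left)
  next
    case (Suc k)
    show ?case
    proof (rule Ck_on_SucI[OF open_UNIV])
      show "((\<lambda>x. c * flat_fun p x) has_derivative (\<lambda>v. (v * c) * flat_fun ([:0, 0, 1:] * (p - pderiv p)) x)) (at x)" for x
        using DERIV_cmult[OF flat_fun_has_derivative[of p x], of c]
        unfolding has_field_derivative_def by (rule has_derivative_eq_rhs) (simp add: fun_eq_iff)
    qed (rule Suc.IH)
  qed
  from this[of _ 1] show ?thesis by (simp add: smooth_on_def)
qed

lemma bump_function_exists: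
  fixes x0 :: "'a::euclidean_space"
  assumes "0 < r"
  obtains B :: "'a \<Rightarrow> real" where "smooth_on UNIV B" "\<And>x. x \<in> ball x0 r \<Longrightarrow> B x = 1" "\<And>x. x \<notin> ball x0 (2 * r) \<Longrightarrow> B x = 0"
proof
  let ?h = "flat_fun 1" and ?s = "\<lambda>x. ((x - x0) \<bullet> (x - x0)) / r\<^sup>2"
  \<comment> \<open>The squared distance makes \<open>?s\<close> smooth at \<open>x0\<close> as
    well. It is below 1 on the small ball, where the second term of the denominator vanishes, and at
    least 4 off the large one, where the numerator does. \<open>4 - ?s x\<close> and
    \<open>?s x - 1\<close> are never both nonpositive, so the denominator is positive.\<close>
  let ?B = "\<lambda>x. ?h (4 - ?s x) / (?h (4 - ?s x) + ?h (?s x - 1))"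
  have pos: "?h t > 0 \<longleftrightarrow> t > 0" "?h t \<ge> 0" "t \<le> 0 \<Longrightarrow> ?h t = 0" for t by (auto simp: flat_fun_def)
  have s: "?s x = (dist x0 x / r)\<^sup>2" for x
    by (simp add: dist_norm norm_minus_commute power_divide dot_square_norm)
  have "smooth_on UNIV ?s"
    using assms by (intro smooth_on_divide smooth_on_inner smooth_on_diff smooth_on_const smooth_on_ident open_UNIV) simp
  note s_smooth = smooth_on_diff[OF open_UNIV smooth_on_const this, of 4] smooth_on_diff[OF open_UNIV this smooth_on_const, of 1]
  have sm: "smooth_on UNIV (\<lambda>x. ?h (4 - ?s x))"
    by (rule smooth_on_compose[OF open_UNIV smooth_on_flat_fun s_smooth(1)]) simp
  have sm': "smooth_on UNIV (\<lambda>x. ?h (?s x - 1))"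
    by (rule smooth_on_compose[OF open_UNIV smooth_on_flat_fun s_smooth(2)]) simp
  have "?h (4 - ?s x) + ?h (?s x - 1) \<noteq> 0" for x
    using pos(1)[of "4 - ?s x"] pos(1)[of "?s x - 1"] pos(2)[of "4 - ?s x"] pos(2)[of "?s x - 1"] by linarith
  then show "smooth_on UNIV ?B"
    by (intro smooth_on_divide sm sm' smooth_on_add open_UNIV)
  show "?B x = 1" if "x \<in> ball x0 r" for x
  proof -
    have "?s x < 1" using that assms unfolding s by (simp add: power_less_one_iff abs_square_less_1)
    then show ?thesis using pos(1)[of "4 - ?s x"] pos(3)[of "?s x - 1"] by auto
  qed
  show "?B x = 0" if "x \<notin> ball x0 (2 * r)" for x
  proof -
    have "2 \<le> dist x0 x / r" using that assms by (simp add: field_simps)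
    then have "2\<^sup>2 \<le> ?s x" unfolding s by (intro power_mono) auto
    then show ?thesis using pos(3)[of "4 - ?s x"] by simp
  qed
qed

section \<open>Symmetry of second derivatives\<close>

lemma mixed_difference_mean_value:
  fixes f :: "'a::euclidean_space \<Rightarrow> real"
  assumes f: "smooth_on S f" and h: "0 < h"
    and S: "\<And>s t. s \<in> {0..h} \<Longrightarrow> t \<in> {0..h} \<Longrightarrow> x + s *\<^sub>R u + t *\<^sub>R v \<in> S"
  shows "\<exists>s\<in>{0..h}. \<exists>t\<in>{0..h}. f (x + h *\<^sub>R u + h *\<^sub>R v) - f (x + h *\<^sub>R u) - f (x + h *\<^sub>R v) + f x =
    h * (h * frechet_derivative (\<lambda>y. frechet_derivative f (at y) u) (at (x + s *\<^sub>R u + t *\<^sub>R v)) v)"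
proof -
  have dir: "((\<lambda>s. g (y + s *\<^sub>R w)) has_real_derivative frechet_derivative g (at (y + s *\<^sub>R w)) w) (at s)"
    if g: "smooth_on S g" and "y + s *\<^sub>R w \<in> S" for g :: "'a \<Rightarrow> real" and y w s
  proof -
    have D: "(g has_derivative frechet_derivative g (at (y + s *\<^sub>R w))) (at (y + s *\<^sub>R w))"
      by (rule smooth_on_has_derivative[OF that])
    have "((\<lambda>s. g (y + s *\<^sub>R w)) has_derivative (\<lambda>r. frechet_derivative g (at (y + s *\<^sub>R w)) (r *\<^sub>R w))) (at s)"
      by (rule has_derivative_compose[where f="\<lambda>s. y + s *\<^sub>R w" and g=g, OF _ D]) (auto intro!: derivative_eq_intros)
    then show ?thesis
      using linear_cmul[OF has_derivative_linear[OF D]] by (simp add: has_field_derivative_def mult.commute[of _ "_ w"])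
  qed
  let ?d = "\<lambda>y. frechet_derivative f (at y) u"
  \<comment> \<open>The second difference is the increment in \<open>s\<close> of a first difference
    in direction \<open>v\<close>. The mean value theorem is applied to it in \<open>s\<close>, and
    then in \<open>t\<close> to the derivative so obtained.\<close>
  have "((\<lambda>s. f (x + s *\<^sub>R u + h *\<^sub>R v) - f (x + s *\<^sub>R u)) has_real_derivative
      ?d (x + s *\<^sub>R u + h *\<^sub>R v) - ?d (x + s *\<^sub>R u)) (at s)" if "0 \<le> s" "s \<le> h" for s
    using dir[OF f, of "x + h *\<^sub>R v" s u] dir[OF f, of x s u] S[of s h] S[of s 0] that h
    by (intro DERIV_diff) (auto simp: algebra_simps)
  from MVT2[OF h this] obtain s where s: "0 < s" "s < h"
    "f (x + h *\<^sub>R u + h *\<^sub>R v) - f (x + h *\<^sub>R u) - f (x + h *\<^sub>R v) + f x = h * (?d (x + s *\<^sub>R u + h *\<^sub>R v) - ?d (x + s *\<^sub>R u))"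
    by (auto simp: algebra_simps)
  have "((\<lambda>t. ?d (x + s *\<^sub>R u + t *\<^sub>R v)) has_real_derivative frechet_derivative ?d (at (x + s *\<^sub>R u + t *\<^sub>R v)) v) (at t)"
    if "0 \<le> t" "t \<le> h" for t
    using that s S[of s t] by (intro dir smooth_on_frechet_derivative f) auto
  from MVT2[OF h this] s show ?thesis by force
qed

text \<open>Both iterated derivatives arise from one and the same second difference, which is
  symmetric in \<open>u\<close> and \<open>v\<close>; continuity of the second derivatives at
  \<open>x\<close> does the rest.\<close>

lemma frechet_derivative_commute_real:
  fixes f :: "'a::euclidean_space \<Rightarrow> real"
  assumes S: "open S" and f: "smooth_on S f" and x: "x \<in> S"
  shows "frechet_derivative (\<lambda>y. frechet_derivative f (at y) u) (at x) v =
    frechet_derivative (\<lambda>y. frechet_derivative f (at y) v) (at x) u"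
proof (rule ccontr)
  let ?D = "\<lambda>u v y. frechet_derivative (\<lambda>y. frechet_derivative f (at y) u) (at y) v"
  \<comment> \<open>Half of the supposed gap: one number within less than \<open>?e\<close> of both
    derivatives contradicts it.\<close>
  let ?e = "\<bar>?D u v x - ?D v u x\<bar> / 2"
  assume "?D u v x \<noteq> ?D v u x"
  then have e: "?e > 0" by simp
  have cont: "isCont (?D u v) x" for u v
    using smooth_on_continuous[OF smooth_on_frechet_derivative[OF smooth_on_frechet_derivative[OF f]]] S x
    by (simp add: continuous_on_eq_continuous_at)
  obtain d1 where d1: "d1 > 0" "\<And>y. dist y x < d1 \<Longrightarrow> \<bar>?D u v y - ?D u v x\<bar> < ?e"
    using cont[of u v] e unfolding continuous_at_eps_delta dist_real_def by meson
  obtain d2 where d2: "d2 > 0" "\<And>y. dist y x < d2 \<Longrightarrow> \<bar>?D v u y - ?D v u x\<bar> < ?e"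
    using cont[of v u] e unfolding continuous_at_eps_delta dist_real_def by meson
  obtain d3 where d3: "d3 > 0" "ball x d3 \<subseteq> S" using S x openE by blast
  define d where "d = min d1 (min d2 d3)"
  \<comment> \<open>Keeps the whole parallelogram within distance \<open>d\<close> of
    \<open>x\<close>; the summand 1 covers \<open>u = v = 0\<close>.\<close>
  define h where "h = d / (2 * (norm u + norm v + 1))"
  have n: "norm u + norm v + 1 > 0" using norm_ge_zero[of u] norm_ge_zero[of v] by linarith
  have h: "h > 0" using d1 d2 d3 n by (auto simp: h_def d_def intro!: divide_pos_pos)
  have near: "dist (x + s *\<^sub>R u + t *\<^sub>R v) x < d" if "s \<in> {0..h}" "t \<in> {0..h}" for s t
  proof -
    have "norm (s *\<^sub>R u + t *\<^sub>R v) \<le> s * norm u + t * norm v"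
      using norm_triangle_ineq[of "s *\<^sub>R u" "t *\<^sub>R v"] that by simp
    also have "\<dots> \<le> h * norm u + h * norm v" using that by (intro add_mono mult_right_mono) auto
    also have "\<dots> < h * (2 * (norm u + norm v + 1))"
    proof -
      have "norm u + norm v < 2 * (norm u + norm v + 1)"
      proof -
        have "a < 2 * (a + 1)" if "0 < a + 1" for a :: real using that by simp
        from this[OF n] show ?thesis .
      qed
      from mult_strict_left_mono[OF this h] show ?thesis by (simp add: distrib_left)
    qed
    also have "\<dots> = d" using n by (simp add: h_def)
    finally show ?thesis by (simp add: dist_norm add.assoc)
  qed
  have S1: "x + s *\<^sub>R u + t *\<^sub>R v \<in> S" "x + t *\<^sub>R v + s *\<^sub>R u \<in> S" if "s \<in> {0..h}" "t \<in> {0..h}" for s t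
    using near[OF that] d3(2) by (auto simp: d_def dist_commute subset_iff add_ac)
  obtain s t where st: "s \<in> {0..h}" "t \<in> {0..h}"
    "f (x + h *\<^sub>R u + h *\<^sub>R v) - f (x + h *\<^sub>R u) - f (x + h *\<^sub>R v) + f x = h * (h * ?D u v (x + s *\<^sub>R u + t *\<^sub>R v))"
    using mixed_difference_mean_value[OF f h S1(1)] by blast
  obtain s' t' where st': "s' \<in> {0..h}" "t' \<in> {0..h}"
    "f (x + h *\<^sub>R v + h *\<^sub>R u) - f (x + h *\<^sub>R v) - f (x + h *\<^sub>R u) + f x = h * (h * ?D v u (x + s' *\<^sub>R v + t' *\<^sub>R u))"
    using mixed_difference_mean_value[OF f h S1(2)] by blast
  have "h * (h * ?D u v (x + s *\<^sub>R u + t *\<^sub>R v)) = h * (h * ?D v u (x + s' *\<^sub>R v + t' *\<^sub>R u))"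
    unfolding st(3)[symmetric] st'(3)[symmetric] by (simp add: add_ac)
  then have "?D u v (x + s *\<^sub>R u + t *\<^sub>R v) = ?D v u (x + s' *\<^sub>R v + t' *\<^sub>R u)" using h by simp
  moreover have "\<bar>?D u v (x + s *\<^sub>R u + t *\<^sub>R v) - ?D u v x\<bar> < ?e"
    using near[OF st(1,2)] by (intro d1(2)) (simp add: d_def)
  moreover have "\<bar>?D v u (x + s' *\<^sub>R v + t' *\<^sub>R u) - ?D v u x\<bar> < ?e"
    using near[OF st'(2,1)] by (intro d2(2)) (simp add: d_def add_ac)
  ultimately show False by (simp add: abs_if field_simps split: if_splits)
qed

lemma frechet_derivative_bounded_linear_comp:
  assumes "bounded_linear l" "f differentiable (at x)"
  shows "frechet_derivative (\<lambda>x. l (f x)) (at x) = (\<lambda>v. l (frechet_derivative f (at x) v))"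
  by (rule frechet_derivative_at[symmetric], rule bounded_linear.has_derivative[OF assms(1)])
    (use assms(2) frechet_derivative_works in blast)

lemma smooth_on_differentiable: "smooth_on S f \<Longrightarrow> x \<in> S \<Longrightarrow> f differentiable (at x)"
  using smooth_on_has_derivative differentiable_def by blast

lemma frechet_derivative_commute:
  fixes f :: "'a::euclidean_space \<Rightarrow> 'b::euclidean_space"
  assumes S: "open S" and f: "smooth_on S f" and x: "x \<in> S"
  shows "frechet_derivative (\<lambda>y. frechet_derivative f (at y) u) (at x) v =
    frechet_derivative (\<lambda>y. frechet_derivative f (at y) v) (at x) u"
proof (rule euclidean_eqI)
  fix b :: 'b
  have fb: "smooth_on S (\<lambda>y. f y \<bullet> b)" by (rule smooth_on_bounded_linear_comp[OF bounded_linear_inner_left S f])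
  have *: "frechet_derivative (\<lambda>y. frechet_derivative (\<lambda>y. f y \<bullet> b) (at y) u) (at x) v =
    frechet_derivative (\<lambda>y. frechet_derivative f (at y) u) (at x) v \<bullet> b" for u v
  proof -
    let ?d = "\<lambda>y. frechet_derivative f (at y) u"
    have "((\<lambda>y. ?d y \<bullet> b) has_derivative (\<lambda>v. frechet_derivative ?d (at x) v \<bullet> b)) (at x)"
      by (rule has_derivative_inner_left, rule smooth_on_has_derivative[OF smooth_on_frechet_derivative[OF f] x])
    moreover have "?d y \<bullet> b = frechet_derivative (\<lambda>y. f y \<bullet> b) (at y) u" if "y \<in> S" for y
      using frechet_derivative_bounded_linear_comp[OF bounded_linear_inner_left smooth_on_differentiable[OF f that]] by simp
    ultimately have "((\<lambda>y. frechet_derivative (\<lambda>y. f y \<bullet> b) (at y) u) has_derivative (\<lambda>v. frechet_derivative ?d (at x) v \<bullet> b)) (at x)"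
      by (rule has_derivative_transform_within_open[OF _ S x])
    from frechet_derivative_at[OF this, symmetric] show ?thesis by simp
  qed
  show "frechet_derivative (\<lambda>y. frechet_derivative f (at y) u) (at x) v \<bullet> b =
    frechet_derivative (\<lambda>y. frechet_derivative f (at y) v) (at x) u \<bullet> b"
    unfolding *[symmetric] by (rule frechet_derivative_commute_real[OF S fb x])
qed

section \<open>Hadamard's lemma\<close>

lemma segment_in_ball:
  fixes x0 :: "'a::real_normed_vector"
  assumes "x \<in> ball x0 r" "t \<in> {0..1}"
  shows "x0 + t *\<^sub>R (x - x0) \<in> ball x0 r"
proof -
  have "norm (t *\<^sub>R (x - x0)) \<le> norm (x - x0)" using assms(2) by (simp add: mult_left_le_one_le)
  then show ?thesis using assms(1) by (simp add: dist_norm norm_minus_commute)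
qed

text \<open>Each differentiation under the integral sign brings down a factor \<open>t\<close>, so
  the weight \<open>t ^ m\<close> has to vary in the induction.\<close>

lemma Ck_on_segment_integral:
  fixes f :: "'a::euclidean_space \<Rightarrow> real"
  assumes "smooth_on (ball x0 r) f"
  shows "Ck_on k (ball x0 r) (\<lambda>x. integral (cbox 0 1) (\<lambda>t. t ^ m * f (x0 + t *\<^sub>R (x - x0))))"
  using assms
proof (induction k arbitrary: f m)
  case 0
  have "continuous_on (ball x0 r \<times> cbox 0 1) (\<lambda>(x, t). t ^ m * f (x0 + t *\<^sub>R (x - x0)))"
    unfolding case_prod_unfold
    by (intro continuous_on_mult continuous_on_power continuous_on_snd continuous_on_id
        continuous_on_compose2[OF smooth_on_continuous[OF 0]] continuous_intros)
      (use segment_in_ball[of _ x0 r] in auto)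
  then show ?case using integral_continuous_on_param by fastforce
next
  case (Suc k)
  note sm = smooth_on_frechet_derivative[OF Suc.prems]
  let ?d = "\<lambda>b y. frechet_derivative f (at y) b"
  let ?I = "\<lambda>b x. integral (cbox 0 1) (\<lambda>t. t ^ Suc m * ?d b (x0 + t *\<^sub>R (x - x0)))"
  \<comment> \<open>The derivative of the integrand as an element of the space of bounded linear
    functionals, the form in which \<open>leibniz_rule\<close> takes it.\<close>
  let ?F = "\<lambda>x t. \<Sum>b\<in>Basis. (t ^ Suc m * ?d b (x0 + t *\<^sub>R (x - x0))) *\<^sub>R blinfun_inner_left b"
  have cont: "continuous_on (ball x0 r \<times> cbox 0 1) (\<lambda>p. snd p ^ m' * g (x0 + snd p *\<^sub>R (fst p - x0)))"
    if "smooth_on (ball x0 r) g" for g :: "'a \<Rightarrow> real" and m'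
    by (intro continuous_on_mult continuous_on_power continuous_on_snd continuous_on_id
        continuous_on_compose2[OF smooth_on_continuous[OF that]] continuous_intros)
      (use segment_in_ball[of _ x0 r] in auto)
  have intg: "(\<lambda>t. t ^ m' * g (x0 + t *\<^sub>R (x - x0))) integrable_on cbox 0 1"
    if "smooth_on (ball x0 r) g" "x \<in> ball x0 r" for g :: "'a \<Rightarrow> real" and x m'
  proof -
    have "continuous_on (cbox 0 1) (\<lambda>t. snd (x, t) ^ m' * g (x0 + snd (x, t) *\<^sub>R (fst (x, t) - x0)))"
      by (rule continuous_on_compose2[OF cont[OF that(1)]]) (use that(2) in \<open>auto intro!: continuous_intros\<close>)
    then show ?thesis by (intro integrable_continuous) simp
  qed
  show ?case
  proof (rule Ck_on_SucI[OF open_ball])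
    fix x assume x: "x \<in> ball x0 r"
    have "((\<lambda>x. integral (cbox 0 1) (\<lambda>t. t ^ m * f (x0 + t *\<^sub>R (x - x0)))) has_derivative
        integral (cbox 0 1) (?F x)) (at x within ball x0 r)"
    proof (rule leibniz_rule[OF _ intg[OF Suc.prems] _ x convex_ball])
      fix y t assume y: "y \<in> ball x0 r" and t: "t \<in> cbox (0::real) 1"
      have D: "(f has_derivative frechet_derivative f (at (x0 + t *\<^sub>R (y - x0)))) (at (x0 + t *\<^sub>R (y - x0)))"
        using segment_in_ball[OF y] t by (intro smooth_on_has_derivative[OF Suc.prems]) simp
      have "((\<lambda>y. f (x0 + t *\<^sub>R (y - x0))) has_derivative (\<lambda>v. frechet_derivative f (at (x0 + t *\<^sub>R (y - x0))) (t *\<^sub>R v))) (at y within ball x0 r)"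
        by (rule has_derivative_compose[where f="\<lambda>y. x0 + t *\<^sub>R (y - x0)" and g=f, OF _ D]) (auto intro!: derivative_eq_intros)
      then have "((\<lambda>y. t ^ m * f (x0 + t *\<^sub>R (y - x0))) has_derivative (\<lambda>v. t ^ m * frechet_derivative f (at (x0 + t *\<^sub>R (y - x0))) (t *\<^sub>R v))) (at y within ball x0 r)"
        by (rule has_derivative_mult_right)
      also have "(\<lambda>v. t ^ m * frechet_derivative f (at (x0 + t *\<^sub>R (y - x0))) (t *\<^sub>R v)) = blinfun_apply (?F y t)"
      proof
        fix v
        have "frechet_derivative f (at (x0 + t *\<^sub>R (y - x0))) (t *\<^sub>R v) = t * (\<Sum>b\<in>Basis. (v \<bullet> b) *\<^sub>R ?d b (x0 + t *\<^sub>R (y - x0)))"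
          using linear_basis_expansion[OF has_derivative_linear[OF D], of v] linear_cmul[OF has_derivative_linear[OF D], of t v] by simp
        then show "t ^ m * frechet_derivative f (at (x0 + t *\<^sub>R (y - x0))) (t *\<^sub>R v) = blinfun_apply (?F y t) v"
          by (simp add: blinfun.sum_left blinfun.scaleR_left sum_distrib_left inner_commute mult_ac)
      qed
      finally show "((\<lambda>y. t ^ m * f (x0 + t *\<^sub>R (y - x0))) has_derivative blinfun_apply (?F y t)) (at y within ball x0 r)" .
    next
      show "continuous_on (ball x0 r \<times> cbox 0 1) (\<lambda>(y, t). ?F y t)"
        unfolding case_prod_unfold by (intro continuous_on_sum continuous_on_scaleR cont[OF sm] continuous_on_const)
    qed
    moreover have "blinfun_apply (integral (cbox 0 1) (?F x)) = (\<lambda>v. \<Sum>b\<in>Basis. (v \<bullet> b) *\<^sub>R ?I b x)"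
    proof
      fix v
      have "(\<lambda>t. (t ^ Suc m * ?d b (x0 + t *\<^sub>R (x - x0))) *\<^sub>R blinfun_inner_left b) integrable_on cbox 0 1" for b
        using integrable_linear[OF intg[OF sm x, where m'="Suc m"] bounded_linear_scaleR_left] by (simp add: o_def)
      moreover have "integral (cbox 0 1) (\<lambda>t. (t ^ Suc m * ?d b (x0 + t *\<^sub>R (x - x0))) *\<^sub>R blinfun_inner_left b) = ?I b x *\<^sub>R blinfun_inner_left b" for b
        using integral_linear[OF intg[OF sm x, where m'="Suc m"] bounded_linear_scaleR_left] by (simp add: o_def)
      ultimately have "integral (cbox 0 1) (?F x) = (\<Sum>b\<in>Basis. ?I b x *\<^sub>R blinfun_inner_left b)"
        by (subst integral_sum) auto
      then show "blinfun_apply (integral (cbox 0 1) (?F x)) v = (\<Sum>b\<in>Basis. (v \<bullet> b) *\<^sub>R ?I b x)"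
        by (simp add: blinfun.sum_left blinfun.scaleR_left inner_commute mult_ac)
    qed
    ultimately show "((\<lambda>x. integral (cbox 0 1) (\<lambda>t. t ^ m * f (x0 + t *\<^sub>R (x - x0)))) has_derivative
        (\<lambda>v. \<Sum>b\<in>Basis. (v \<bullet> b) *\<^sub>R ?I b x)) (at x)"
      by (simp only: at_within_open[OF x open_ball])
  next
    fix v
    show "Ck_on k (ball x0 r) (\<lambda>x. \<Sum>b\<in>Basis. (v \<bullet> b) *\<^sub>R ?I b x)"
      by (intro Ck_on_sum[OF open_ball] Ck_on_bilinear[OF open_ball bounded_bilinear_scaleR] Ck_on_const Suc.IH sm)
  qed
qed

text \<open>\<open>f x - f x0\<close> is the integral of the derivative of \<open>f\<close> along
  the segment from \<open>x0\<close> to \<open>x\<close>, and \<open>g b\<close> is the mean of the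
  \<open>b\<close>-th partial derivative on it. This is what shows that a derivation at a point sees
  first derivatives only.\<close>

lemma hadamard:
  fixes f :: "'a::euclidean_space \<Rightarrow> real"
  assumes f: "smooth_on (ball x0 r) f" and r: "0 < r"
  obtains g where "\<And>b. smooth_on (ball x0 r) (g b)"
    and "\<And>x. x \<in> ball x0 r \<Longrightarrow> f x = f x0 + (\<Sum>b\<in>Basis. ((x - x0) \<bullet> b) * g b x)"
    and "\<And>b. g b x0 = frechet_derivative f (at x0) b"
proof
  note sm = smooth_on_frechet_derivative[OF f]
  define g where "g b x = integral (cbox 0 1) (\<lambda>t. t ^ 0 * frechet_derivative f (at (x0 + t *\<^sub>R (x - x0))) b)" for b x
  show "smooth_on (ball x0 r) (g b)" for b
    using Ck_on_segment_integral[OF sm, where m=0] unfolding g_def smooth_on_def by blast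
  show "g b x0 = frechet_derivative f (at x0) b" for b by (simp add: g_def)
  fix x assume x: "x \<in> ball x0 r"
  let ?p = "\<lambda>t. x0 + t *\<^sub>R (x - x0)"
  have D: "(f has_derivative frechet_derivative f (at (?p t))) (at (?p t))" if "t \<in> {0..1}" for t
    using segment_in_ball[OF x that] by (rule smooth_on_has_derivative[OF f])
  have "((\<lambda>t. f (?p t)) has_vector_derivative frechet_derivative f (at (?p t)) (x - x0)) (at t within {0..1})"
    if "t \<in> {0..1}" for t
  proof -
    have "((\<lambda>t. f (?p t)) has_derivative (\<lambda>s. frechet_derivative f (at (?p t)) (s *\<^sub>R (x - x0)))) (at t within {0..1})"
      by (rule has_derivative_compose[where f="?p" and g=f, OF _ D[OF that]]) (auto intro!: derivative_eq_intros)
    then show ?thesis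
      using linear_cmul[OF has_derivative_linear[OF D[OF that]]] by (simp add: has_vector_derivative_def)
  qed
  then have "((\<lambda>t. frechet_derivative f (at (?p t)) (x - x0)) has_integral (f (?p 1) - f (?p 0))) {0..1}"
    by (intro fundamental_theorem_of_calculus) auto
  then have "f x = f x0 + integral {0..1} (\<lambda>t. frechet_derivative f (at (?p t)) (x - x0))"
    by (simp add: integral_unique)
  also have "integral {0..1} (\<lambda>t. frechet_derivative f (at (?p t)) (x - x0)) =
      integral {0..1} (\<lambda>t. \<Sum>b\<in>Basis. ((x - x0) \<bullet> b) * frechet_derivative f (at (?p t)) b)"
    by (intro Henstock_Kurzweil_Integration.integral_cong)
      (subst linear_basis_expansion[OF has_derivative_linear[OF D]], auto)
  also have "\<dots> = (\<Sum>b\<in>Basis. ((x - x0) \<bullet> b) * g b x)"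
  proof -
    have "(\<lambda>t. ((x - x0) \<bullet> b) * frechet_derivative f (at (?p t)) b) integrable_on {0..1}" for b
      by (intro integrable_continuous_real continuous_on_mult continuous_on_const
          continuous_on_compose2[OF smooth_on_continuous[OF sm], where f = ?p])
        (use segment_in_ball[OF x] in \<open>auto intro!: continuous_intros\<close>)
    then show ?thesis by (subst integral_sum) (auto simp: g_def)
  qed
  finally show "f x = f x0 + (\<Sum>b\<in>Basis. ((x - x0) \<bullet> b) * g b x)" .
qed

section \<open>Smooth functions on manifolds\<close>

text \<open>\<open>smooth_funs\<close> tests every chart on a whole set. Here one chart around one
  point suffices, which makes gluing and extension by zero pointwise arguments.\<close>

definition smooth_at :: "('a, 'b::euclidean_space) atlas \<Rightarrow> ('a \<Rightarrow> real) \<Rightarrow> 'a \<Rightarrow> bool" where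
  "smooth_at A f q \<longleftrightarrow> (\<exists>c\<in>A. q \<in> fst c \<and>
     (\<exists>T. open T \<and> snd c q \<in> T \<and> T \<subseteq> snd c ` fst c \<and> smooth_on T (f \<circ> chart_inv c)))"

text \<open>Kept apart from \<open>smooth_mfd\<close> so that it can be interpreted for
  \<open>cotangent_bundle A\<close> while the Hausdorff property of the latter is still being
  proved.\<close>

locale smooth_atl =
  fixes A :: "('a, 'b::euclidean_space) atlas"
  assumes atlas: "smooth_atlas A"
begin

abbreviation "P \<equiv> points A"
abbreviation "C \<equiv> smooth_funs A (points A)"

lemma chart_inj: "c \<in> A \<Longrightarrow> inj_on (snd c) (fst c)"
  using atlas by (auto simp: smooth_atlas_def)

lemma chart_inv_chart [simp]: "c \<in> A \<Longrightarrow> q \<in> fst c \<Longrightarrow> chart_inv c (snd c q) = q"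
  by (simp add: chart_inv_def chart_inj)

lemma chart_inv_in: "x \<in> snd c ` fst c \<Longrightarrow> chart_inv c x \<in> fst c"
  by (simp add: chart_inv_def inv_into_into)

lemma transition_open: "c \<in> A \<Longrightarrow> d \<in> A \<Longrightarrow> open (snd c ` (fst c \<inter> fst d))"
  and transition_smooth: "c \<in> A \<Longrightarrow> d \<in> A \<Longrightarrow> smooth_on (snd c ` (fst c \<inter> fst d)) (snd d \<circ> chart_inv c)"
  using atlas by (auto simp: smooth_atlas_def)

lemma open_chart_range: "c \<in> A \<Longrightarrow> open (snd c ` fst c)"
  using transition_open[of c c] by simp

lemma chart_dom_subset: "c \<in> A \<Longrightarrow> fst c \<subseteq> P"
  by (auto simp: points_def)

lemma topspace_mtop: "topspace (mtop A) = P"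
proof -
  have "q \<in> \<Union>{{q \<in> fst c. snd c q \<in> S} | c S. c \<in> A \<and> open S}" if "c \<in> A" "q \<in> fst c" for c q
    using that by (intro UnionI[of "{q \<in> fst c. snd c q \<in> UNIV}"]) blast+
  then show ?thesis by (auto simp: mtop_def topology_generated_by_topspace points_def)
qed

lemma openin_mtop_basic: "c \<in> A \<Longrightarrow> open S \<Longrightarrow> openin (mtop A) {q \<in> fst c. snd c q \<in> S}"
  unfolding mtop_def by (rule topology_generated_by_Basis) blast

lemma openin_chart_dom: "c \<in> A \<Longrightarrow> openin (mtop A) (fst c)"
  using openin_mtop_basic[of c UNIV] by simp

text \<open>Induction over the generated topology. Injectivity of the chart makes images commute
  with intersections; the image of a generator is the preimage of an open set under a transition
  map, which is continuous on its open domain.\<close>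

lemma openin_mtop_imp_open_image:
  assumes "openin (mtop A) W" "c \<in> A"
  shows "open (snd c ` (fst c \<inter> W))"
proof -
  have "generate_topology_on {{q \<in> fst c. snd c q \<in> S} | c S. c \<in> A \<and> open S} W"
    using assms(1) by (simp add: mtop_def openin_topology_generated_by_iff)
  then show ?thesis
  proof induction
    case (Int a b)
    have "snd c ` (fst c \<inter> (a \<inter> b)) = snd c ` (fst c \<inter> a) \<inter> snd c ` (fst c \<inter> b)"
      using chart_inj[OF assms(2)] by (auto simp: inj_on_def)
    with Int.IH show ?case by (simp add: open_Int)
  next
    case (UN K)
    have "snd c ` (fst c \<inter> \<Union>K) = (\<Union>k\<in>K. snd c ` (fst c \<inter> k))" by auto
    with UN.IH show ?case by (simp add: open_UN)
  next
    case (Basis s)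
    then obtain d S where d: "d \<in> A" "open S" "s = {q \<in> fst d. snd d q \<in> S}" by blast
    have "snd c ` (fst c \<inter> s) = snd c ` (fst c \<inter> fst d) \<inter> (snd d \<circ> chart_inv c) -` S"
      unfolding d(3)
    proof (intro set_eqI iffI)
      fix x assume "x \<in> snd c ` (fst c \<inter> {q \<in> fst d. snd d q \<in> S})"
      then obtain q where "q \<in> fst c" "q \<in> fst d" "snd d q \<in> S" "x = snd c q" by blast
      then show "x \<in> snd c ` (fst c \<inter> fst d) \<inter> (snd d \<circ> chart_inv c) -` S" using assms(2) by simp
    next
      fix x assume "x \<in> snd c ` (fst c \<inter> fst d) \<inter> (snd d \<circ> chart_inv c) -` S"
      then obtain q where "q \<in> fst c" "q \<in> fst d" "snd d (chart_inv c x) \<in> S" "x = snd c q" by auto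
      then show "x \<in> snd c ` (fst c \<inter> {q \<in> fst d. snd d q \<in> S})" using assms(2) by simp
    qed
    moreover have "open (snd c ` (fst c \<inter> fst d) \<inter> (snd d \<circ> chart_inv c) -` S)"
      by (rule continuous_open_preimage[OF smooth_on_continuous[OF transition_smooth[OF assms(2) d(1)]]
            transition_open[OF assms(2) d(1)] d(2)])
    ultimately show ?case by simp
  qed simp
qed

lemma openin_mtop_iff: "openin (mtop A) W \<longleftrightarrow> W \<subseteq> P \<and> (\<forall>c\<in>A. open (snd c ` (fst c \<inter> W)))"
proof (intro iffI conjI)
  assume W: "W \<subseteq> P \<and> (\<forall>c\<in>A. open (snd c ` (fst c \<inter> W)))"
  have "openin (mtop A) (\<Union>c\<in>A. {q \<in> fst c. snd c q \<in> snd c ` (fst c \<inter> W)})"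
    using W by (intro openin_Union) (auto intro!: openin_mtop_basic)
  moreover have "(\<Union>c\<in>A. {q \<in> fst c. snd c q \<in> snd c ` (fst c \<inter> W)}) = W"
  proof -
    have "{q \<in> fst c. snd c q \<in> snd c ` (fst c \<inter> W)} = fst c \<inter> W" if "c \<in> A" for c
      using chart_inj[OF that] by (auto simp: inj_on_def)
    then show ?thesis using W by (auto simp: points_def)
  qed
  ultimately show "openin (mtop A) W" by simp
qed (use openin_mtop_imp_open_image openin_subset[of "mtop A" W] topspace_mtop in auto)

lemma smooth_at_in_chart:
  assumes "smooth_at A f q" "c \<in> A" "q \<in> fst c"
  obtains T where "open T" "snd c q \<in> T" "T \<subseteq> snd c ` fst c" "smooth_on T (f \<circ> chart_inv c)"
proof -
  obtain d T where d: "d \<in> A" "q \<in> fst d" and T: "open T" "snd d q \<in> T" "T \<subseteq> snd d ` fst d" "smooth_on T (f \<circ> chart_inv d)"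
    using assms(1) by (auto simp: smooth_at_def)
  let ?t = "snd d \<circ> chart_inv c"
  define T' where "T' = snd c ` (fst c \<inter> {r \<in> fst d. snd d r \<in> T})"
  have "open T'" unfolding T'_def
    by (intro openin_mtop_imp_open_image openin_mtop_basic d T assms)
  moreover have "snd c q \<in> T'" using assms d T by (auto simp: T'_def)
  moreover have "T' \<subseteq> snd c ` fst c" by (auto simp: T'_def)
  moreover have "smooth_on T' (f \<circ> chart_inv c)"
  proof -
    have "smooth_on T' (\<lambda>x. (f \<circ> chart_inv d) (?t x))"
      by (rule smooth_on_compose[OF \<open>open T'\<close> T(4) smooth_on_subset[OF transition_smooth[OF assms(2) d(1)]]])
        (use assms in \<open>auto simp: T'_def\<close>)
    then show ?thesis
      by (subst smooth_on_cong[OF \<open>open T'\<close>]) (use assms d in \<open>auto simp: T'_def\<close>)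
  qed
  ultimately show ?thesis using that by blast
qed

lemma smooth_at_chartI:
  assumes "c \<in> A" "q \<in> fst c" "open T" "snd c q \<in> T" "smooth_on T F"
    and "\<And>r. r \<in> fst c \<Longrightarrow> snd c r \<in> T \<Longrightarrow> f r = F (snd c r)"
  shows "smooth_at A f q"
proof -
  let ?T = "T \<inter> snd c ` fst c"
  have o: "open ?T" using assms open_chart_range by blast
  have "smooth_on ?T (f \<circ> chart_inv c)"
    using smooth_on_subset[OF assms(5), of ?T]
    by (subst smooth_on_cong[OF o]) (use assms in auto)
  then show ?thesis unfolding smooth_at_def using o assms(1,2,4) by blast
qed

lemma smooth_at_cong:
  assumes "smooth_at A f q" "openin (mtop A) W" "q \<in> W" "\<And>r. r \<in> W \<Longrightarrow> f r = g r"
  shows "smooth_at A g q"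
proof -
  obtain c where c: "c \<in> A" "q \<in> fst c" using assms(1) by (auto simp: smooth_at_def)
  obtain T where T: "open T" "snd c q \<in> T" "T \<subseteq> snd c ` fst c" "smooth_on T (f \<circ> chart_inv c)"
    using smooth_at_in_chart[OF assms(1) c] .
  show ?thesis
  proof (rule smooth_at_chartI[OF c])
    show "open (T \<inter> snd c ` (fst c \<inter> W))" using T assms(2) c openin_mtop_imp_open_image by blast
    show "snd c q \<in> T \<inter> snd c ` (fst c \<inter> W)" using T c assms by blast
    show "smooth_on (T \<inter> snd c ` (fst c \<inter> W)) (f \<circ> chart_inv c)" using T smooth_on_subset by blast
    fix r assume r: "r \<in> fst c" "snd c r \<in> T \<inter> snd c ` (fst c \<inter> W)"
    then have "r \<in> W" using chart_inj[OF c(1)] by (auto simp: inj_on_def)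
    then show "g r = (f \<circ> chart_inv c) (snd c r)" using assms(4) c r by simp
  qed
qed

lemma smooth_at_const: "q \<in> P \<Longrightarrow> smooth_at A (\<lambda>_. a) q"
  by (auto simp: points_def intro!: smooth_at_chartI[of _ _ UNIV "\<lambda>_. a"] smooth_on_const)

lemma smooth_at_op2:
  assumes "smooth_at A f q" "smooth_at A g q"
    and op: "\<And>T (u :: 'b \<Rightarrow> real) v. open T \<Longrightarrow> smooth_on T u \<Longrightarrow> smooth_on T v \<Longrightarrow> smooth_on T (\<lambda>x. op (u x) (v x))"
  shows "smooth_at A (\<lambda>r. op (f r) (g r)) q"
proof -
  obtain c where c: "c \<in> A" "q \<in> fst c" using assms(1) by (auto simp: smooth_at_def)
  obtain T where T: "open T" "snd c q \<in> T" "T \<subseteq> snd c ` fst c" "smooth_on T (f \<circ> chart_inv c)"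
    using smooth_at_in_chart[OF assms(1) c] .
  obtain T' where T': "open T'" "snd c q \<in> T'" "T' \<subseteq> snd c ` fst c" "smooth_on T' (g \<circ> chart_inv c)"
    using smooth_at_in_chart[OF assms(2) c] .
  have "smooth_on (T \<inter> T') (\<lambda>x. op ((f \<circ> chart_inv c) x) ((g \<circ> chart_inv c) x))"
    using T T' smooth_on_subset by (intro op open_Int; blast)
  then show ?thesis
    by (rule smooth_at_chartI[OF c open_Int[OF T(1) T'(1)], rotated]) (use T T' c in auto)
qed

lemma smooth_at_add: "smooth_at A f q \<Longrightarrow> smooth_at A g q \<Longrightarrow> smooth_at A (\<lambda>r. f r + g r) q"
  and smooth_at_mult: "smooth_at A f q \<Longrightarrow> smooth_at A g q \<Longrightarrow> smooth_at A (\<lambda>r. f r * g r) q"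
  by (erule (1) smooth_at_op2, rule smooth_on_add smooth_on_mult; assumption)+

lemma smooth_at_sum:
  assumes "q \<in> P" "\<And>i. i \<in> I \<Longrightarrow> smooth_at A (f i) q"
  shows "smooth_at A (\<lambda>r. \<Sum>i\<in>I. f i r) q"
  using assms(2) by (induction I rule: infinite_finite_induct) (auto intro: smooth_at_const assms(1) smooth_at_add)

lemma smooth_funs_iff:
  assumes U: "openin (mtop A) U"
  shows "f \<in> smooth_funs A U \<longleftrightarrow> (\<forall>q\<in>U. smooth_at A f q) \<and> (\<forall>q. q \<notin> U \<longrightarrow> f q = 0)"
proof (intro iffI conjI ballI)
  fix q assume f: "f \<in> smooth_funs A U" and q: "q \<in> U"
  then obtain c where c: "c \<in> A" "q \<in> fst c" using openin_subset[OF U] by (auto simp: topspace_mtop points_def)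
  show "smooth_at A f q"
    by (rule smooth_at_chartI[OF c openin_mtop_imp_open_image[OF U c(1)], of "f \<circ> chart_inv c"])
      (use f c q in \<open>auto simp: smooth_funs_def\<close>)
next
  assume f: "(\<forall>q\<in>U. smooth_at A f q) \<and> (\<forall>q. q \<notin> U \<longrightarrow> f q = 0)"
  have "smooth_on (snd c ` (fst c \<inter> U)) (f \<circ> chart_inv c)" if c: "c \<in> A" for c
  proof (rule smooth_on_local)
    fix x assume "x \<in> snd c ` (fst c \<inter> U)"
    then obtain q where q: "q \<in> fst c" "q \<in> U" "x = snd c q" by blast
    have "smooth_at A f q" using f q(2) by blast
    from smooth_at_in_chart[OF this c q(1)]
    obtain T where "open T" "snd c q \<in> T" "T \<subseteq> snd c ` fst c" "smooth_on T (f \<circ> chart_inv c)" .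
    then show "\<exists>T. open T \<and> x \<in> T \<and> smooth_on T (f \<circ> chart_inv c)" using q by blast
  qed
  then show "f \<in> smooth_funs A U" using f by (auto simp: smooth_funs_def)
qed (auto simp: smooth_funs_def)

lemma openin_points [simp]: "openin (mtop A) P"
  using openin_topspace[of "mtop A"] by (simp only: topspace_mtop)

lemma C_iff: "f \<in> C \<longleftrightarrow> (\<forall>q\<in>P. smooth_at A f q) \<and> (\<forall>q. q \<notin> P \<longrightarrow> f q = 0)"
  by (rule smooth_funs_iff) simp

lemma C_smooth_at: "f \<in> C \<Longrightarrow> q \<in> P \<Longrightarrow> smooth_at A f q"
  and C_outside: "f \<in> C \<Longrightarrow> q \<notin> P \<Longrightarrow> f q = 0"
  by (auto simp: C_iff)

lemma C_add: "f \<in> C \<Longrightarrow> h \<in> C \<Longrightarrow> (\<lambda>r. f r + h r) \<in> C"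
  and C_mult: "f \<in> C \<Longrightarrow> h \<in> C \<Longrightarrow> (\<lambda>r. f r * h r) \<in> C"
  by (simp_all add: C_iff smooth_at_add smooth_at_mult)

text \<open>Members of \<open>C\<close> vanish off the manifold, so constants have to be cut off
  there before a tangent vector can act on them.\<close>

lemma C_const: "(\<lambda>r. if r \<in> P then a else 0) \<in> C"
  unfolding C_iff
proof (intro conjI ballI)
  fix q assume q: "q \<in> P"
  show "smooth_at A (\<lambda>r. if r \<in> P then a else 0) q"
    by (rule smooth_at_cong[OF smooth_at_const[OF q] openin_points q]) simp
qed simp

lemma C_scale: "f \<in> C \<Longrightarrow> (\<lambda>r. a * f r) \<in> C"
  by (simp add: C_iff smooth_at_mult smooth_at_const)

lemma C_sum: "(\<And>i. i \<in> I \<Longrightarrow> f i \<in> C) \<Longrightarrow> (\<lambda>r. \<Sum>i\<in>I. f i r) \<in> C"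
  by (simp add: C_iff smooth_at_sum)

lemma closedin_supp: "closedin (mtop A) (supp A f)"
  by (simp add: supp_def)

lemma supp_zero:
  assumes "q \<in> P" "q \<notin> supp A f"
  shows "f q = 0"
  using assms closure_of_subset[of "{q \<in> P. f q \<noteq> 0}" "mtop A"] by (auto simp: supp_def topspace_mtop)

lemma supp_minimal: "closedin (mtop A) K \<Longrightarrow> (\<And>q. q \<in> P \<Longrightarrow> q \<notin> K \<Longrightarrow> f q = 0) \<Longrightarrow> supp A f \<subseteq> K"
  unfolding supp_def by (rule closure_of_minimal) auto

lemma smooth_funs_cI:
  assumes "f \<in> C" "compactin (mtop A) K" "K \<subseteq> U" "closedin (mtop A) K" "\<And>q. q \<in> P \<Longrightarrow> q \<notin> K \<Longrightarrow> f q = 0"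
  shows "f \<in> smooth_funs_c A U"
proof -
  have "supp A f \<subseteq> K" by (rule supp_minimal[OF assms(4,5)])
  with closed_compactin[OF assms(2) this closedin_supp] assms(1,3) show ?thesis
    by (auto simp: smooth_funs_c_def)
qed

lemma smooth_funs_cD:
  assumes "f \<in> smooth_funs_c A U"
  shows "f \<in> C" "compactin (mtop A) (supp A f)" "supp A f \<subseteq> U"
  using assms by (auto simp: smooth_funs_c_def)

lemma smooth_funs_c_supp_subset:
  assumes "f \<in> smooth_funs_c A U" "h \<in> C" "\<And>q. q \<in> P \<Longrightarrow> q \<notin> supp A f \<Longrightarrow> h q = 0"
  shows "h \<in> smooth_funs_c A U"
  using smooth_funs_cI[OF assms(2) smooth_funs_cD(2,3)[OF assms(1)] closedin_supp assms(3)] by blast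

lemma smooth_funs_c_mult:
  assumes "f \<in> smooth_funs_c A W" "k \<in> C"
  shows "(\<lambda>x. k x * f x) \<in> smooth_funs_c A W"
  by (rule smooth_funs_c_supp_subset[OF assms(1) C_mult[OF assms(2) smooth_funs_cD(1)[OF assms(1)]]])
    (simp add: supp_zero)

lemma smooth_funs_c_scale:
  assumes "f \<in> smooth_funs_c A W"
  shows "(\<lambda>x. a * f x) \<in> smooth_funs_c A W"
  by (rule smooth_funs_c_supp_subset[OF assms C_scale[OF smooth_funs_cD(1)[OF assms]]]) (simp add: supp_zero)

lemma smooth_funs_c_add:
  assumes "f \<in> smooth_funs_c A W" "h \<in> smooth_funs_c A W"
  shows "(\<lambda>x. f x + h x) \<in> smooth_funs_c A W"
proof (rule smooth_funs_cI)
  show "compactin (mtop A) (supp A f \<union> supp A h)" by (intro compactin_Un smooth_funs_cD(2)[OF assms(1)] smooth_funs_cD(2)[OF assms(2)])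
  show "closedin (mtop A) (supp A f \<union> supp A h)" by (intro closedin_Un closedin_supp)
  show "supp A f \<union> supp A h \<subseteq> W" using smooth_funs_cD(3)[OF assms(1)] smooth_funs_cD(3)[OF assms(2)] by blast
  show "f q + h q = 0" if "q \<in> P" "q \<notin> supp A f \<union> supp A h" for q using that by (simp add: supp_zero)
qed (intro C_add smooth_funs_cD(1)[OF assms(1)] smooth_funs_cD(1)[OF assms(2)])

lemma smooth_at_vanish:
  assumes "closedin (mtop A) K" "q \<in> P" "q \<notin> K" "\<And>r. r \<in> P \<Longrightarrow> r \<notin> K \<Longrightarrow> f r = 0"
  shows "smooth_at A f q"
  by (rule smooth_at_cong[OF smooth_at_const[of q 0], of "P - K"])
    (use assms topspace_mtop openin_diff[OF openin_points assms(1)] in auto)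

text \<open>At points of the support of \<open>\<eta>\<close> both factors are smooth; off that
  closed set the product is zero. This turns functions known on \<open>W\<close> only into global
  ones.\<close>

lemma cutoff_smooth_funs_c:
  assumes "\<eta> \<in> smooth_funs_c A W" "\<And>r. r \<in> W \<Longrightarrow> smooth_at A f r" "W \<subseteq> P"
  shows "(\<lambda>r. if r \<in> W then \<eta> r * f r else 0) \<in> smooth_funs_c A W" (is "?f \<in> _")
proof (rule smooth_funs_c_supp_subset[OF assms(1)])
  note \<eta> = smooth_funs_cD[OF assms(1)]
  have z: "?f r = \<eta> r * f r" if "r \<in> P" for r using supp_zero[of r \<eta>] \<eta>(3) that by auto
  show "?f q = 0" if "q \<in> P" "q \<notin> supp A \<eta>" for q
    using that supp_zero by simp
  show "?f \<in> C"
    unfolding C_iff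
  proof (intro conjI ballI allI impI)
    fix q assume q: "q \<in> P"
    show "smooth_at A ?f q"
    proof (cases "q \<in> supp A \<eta>")
      case True
      then have "smooth_at A (\<lambda>r. \<eta> r * f r) q" using \<eta> q by (intro smooth_at_mult C_smooth_at[OF \<eta>(1)] assms(2)) auto
      then show ?thesis by (rule smooth_at_cong[OF _ openin_points q]) (simp only: z)
    next
      case False
      then show ?thesis by (intro smooth_at_vanish[OF closedin_supp q]) (use supp_zero in auto)
    qed
  qed (use assms(3) in auto)
qed

text \<open>Carries closed Euclidean balls to compact subsets of the manifold, the supports of bump
  functions.\<close>

lemma continuous_chart_inv:
  assumes "c \<in> A"
  shows "continuous_map (top_of_set (snd c ` fst c)) (mtop A) (chart_inv c)"
proof (unfold continuous_map, intro conjI allI impI)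
  show "chart_inv c ` topspace (top_of_set (snd c ` fst c)) \<subseteq> topspace (mtop A)"
  proof (intro image_subsetI)
    fix x assume "x \<in> topspace (top_of_set (snd c ` fst c))"
    then have "chart_inv c x \<in> fst c" by (intro chart_inv_in) simp
    then show "chart_inv c x \<in> topspace (mtop A)" using chart_dom_subset[OF assms] unfolding topspace_mtop by (rule set_mp[rotated])
  qed
  fix W assume W: "openin (mtop A) W"
  have "{x \<in> topspace (top_of_set (snd c ` fst c)). chart_inv c x \<in> W} = snd c ` (fst c \<inter> W)"
  proof (intro set_eqI iffI)
    fix x assume "x \<in> {x \<in> topspace (top_of_set (snd c ` fst c)). chart_inv c x \<in> W}"
    then obtain q where "q \<in> fst c" "x = snd c q" "chart_inv c x \<in> W" by auto
    then show "x \<in> snd c ` (fst c \<inter> W)" using assms by simp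
  next
    fix x assume "x \<in> snd c ` (fst c \<inter> W)"
    then obtain q where "q \<in> fst c" "x = snd c q" "q \<in> W" by auto
    then show "x \<in> {x \<in> topspace (top_of_set (snd c ` fst c)). chart_inv c x \<in> W}" using assms by simp
  qed
  then show "openin (top_of_set (snd c ` fst c)) {x \<in> topspace (top_of_set (snd c ` fst c)). chart_inv c x \<in> W}"
    using openin_mtop_imp_open_image[OF W assms] by (simp only:) (rule open_subset, auto)
qed

end

locale smooth_mfd = smooth_atl +
  assumes hausdorff: "Hausdorff_space (mtop A)"
begin

text \<open>A Euclidean bump is transplanted through a chart and extended by zero. The image
  \<open>K\<close> of a closed ball is compact, and the Hausdorff property makes it closed in the
  whole manifold; this gives smoothness of the extension off the chart domain.\<close>

lemma bump_exists:
  assumes W: "openin (mtop A) W" and q: "q \<in> W"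
  obtains \<eta> V where "\<eta> \<in> smooth_funs_c A W" "openin (mtop A) V" "q \<in> V" "V \<subseteq> W" "\<And>r. r \<in> V \<Longrightarrow> \<eta> r = 1"
proof -
  obtain c where c: "c \<in> A" "q \<in> fst c" using openin_subset[OF W] q by (auto simp: topspace_mtop points_def)
  have "open (snd c ` (fst c \<inter> W))" by (rule openin_mtop_imp_open_image[OF W c(1)])
  then obtain e where e: "e > 0" "cball (snd c q) e \<subseteq> snd c ` (fst c \<inter> W)"
    using q c open_contains_cball by blast
  obtain B where B: "smooth_on UNIV B" "\<And>x. x \<in> ball (snd c q) (e / 2) \<Longrightarrow> B x = (1::real)"
    "\<And>x. x \<notin> ball (snd c q) (2 * (e / 2)) \<Longrightarrow> B x = 0"
    using bump_function_exists[of "e / 2" "snd c q"] e(1) by auto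
  define \<eta> where "\<eta> r = (if r \<in> fst c then B (snd c r) else 0)" for r
  define K where "K = chart_inv c ` cball (snd c q) e"
  have sub: "cball (snd c q) e \<subseteq> snd c ` fst c" using e(2) by blast
  have "compactin (mtop A) K" unfolding K_def
    using sub by (intro image_compactin[OF _ continuous_chart_inv[OF c(1)]])
      (auto simp: compactin_subtopology)
  then have K: "compactin (mtop A) K" "closedin (mtop A) K"
    using compactin_imp_closedin[OF hausdorff] by auto
  have KW: "K \<subseteq> W" using e(2) c(1) by (auto simp: K_def)
  have zero: "\<eta> r = 0" if "r \<notin> K" for r
  proof (cases "r \<in> fst c")
    case True
    then have "snd c r \<notin> cball (snd c q) e" using that chart_inv_chart[OF c(1) True] unfolding K_def by (metis imageI)
    then show ?thesis using B(3)[of "snd c r"] by (simp add: \<eta>_def)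
  qed (simp add: \<eta>_def)
  have "\<eta> \<in> C" unfolding C_iff
  proof (intro conjI ballI allI impI)
    fix r assume r: "r \<in> P"
    show "smooth_at A \<eta> r"
    proof (cases "r \<in> fst c")
      case True
      show ?thesis by (rule smooth_at_chartI[OF c(1) True open_UNIV _ B(1)]) (auto simp: \<eta>_def)
    next
      case False
      moreover have "K \<subseteq> fst c" using sub by (auto simp: K_def intro: chart_inv_in)
      ultimately show ?thesis by (intro smooth_at_vanish[OF K(2) r]) (use zero in auto)
    qed
  next
    fix r assume "r \<notin> P" then show "\<eta> r = 0" using chart_dom_subset[OF c(1)] by (auto simp: \<eta>_def)
  qed
  then have 1: "\<eta> \<in> smooth_funs_c A W" using smooth_funs_cI[OF _ K(1) KW K(2)] zero by blast
  let ?V = "{r \<in> fst c. snd c r \<in> ball (snd c q) (e / 2)}"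
  have "?V \<subseteq> W"
  proof
    fix r assume r: "r \<in> ?V"
    then have "snd c r \<in> snd c ` (fst c \<inter> W)" using e by (intro set_mp[OF e(2)]) auto
    then show "r \<in> W" using r chart_inj[OF c(1)] by (auto simp: inj_on_def)
  qed
  then show ?thesis
    using openin_mtop_basic[OF c(1) open_ball, of "snd c q" "e / 2"] c(2) e(1) B(2)
    by (intro that[OF 1, of ?V]) (simp_all add: \<eta>_def)
qed

section \<open>Tangent and cotangent vectors in coordinates\<close>

lemma tangent_space_iff: "v \<in> tangent_space A q \<longleftrightarrow>
     (\<forall>f. f \<notin> C \<longrightarrow> v f = 0) \<and>
     (\<forall>f\<in>C. \<forall>h\<in>C. v (\<lambda>r. f r + h r) = v f + v h) \<and>
     (\<forall>f\<in>C. \<forall>a. v (\<lambda>r. a * f r) = a * v f) \<and>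
     (\<forall>f\<in>C. \<forall>h\<in>C. v (\<lambda>r. f r * h r) = f q * v h + h q * v f)"
  by (simp add: tangent_space_def Let_def)

lemma tangent_outside: "v \<in> tangent_space A q \<Longrightarrow> f \<notin> C \<Longrightarrow> v f = 0"
  and tangent_add: "v \<in> tangent_space A q \<Longrightarrow> f \<in> C \<Longrightarrow> h \<in> C \<Longrightarrow> v (\<lambda>r. f r + h r) = v f + v h"
  and tangent_scale: "v \<in> tangent_space A q \<Longrightarrow> f \<in> C \<Longrightarrow> v (\<lambda>r. a * f r) = a * v f"
  and tangent_mult: "v \<in> tangent_space A q \<Longrightarrow> f \<in> C \<Longrightarrow> h \<in> C \<Longrightarrow> v (\<lambda>r. f r * h r) = f q * v h + h q * v f"
  by (simp_all add: tangent_space_iff)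

lemma tangent_zero: "v \<in> tangent_space A q \<Longrightarrow> v (\<lambda>_. 0) = 0"
  using tangent_scale[of v q "\<lambda>r. 0" 0] tangent_outside[of v q "\<lambda>r. 0"] by (cases "(\<lambda>r. 0) \<in> C") auto

lemma tangent_sum:
  assumes v: "v \<in> tangent_space A q" and f: "\<And>i. i \<in> I \<Longrightarrow> f i \<in> C"
  shows "v (\<lambda>r. \<Sum>i\<in>I. f i r) = (\<Sum>i\<in>I. v (f i))"
  using f
proof (induction I rule: infinite_finite_induct)
  case (insert i I)
  then have "v (\<lambda>r. f i r + (\<Sum>i\<in>I. f i r)) = v (f i) + v (\<lambda>r. \<Sum>i\<in>I. f i r)"
    by (intro tangent_add[OF v] C_sum) auto
  then show ?case using insert by simp
qed (simp_all add: tangent_zero[OF v])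

text \<open>The constant 1 is its own square, so the Leibniz rule gives
  \<open>v ?k = 2 * v ?k\<close>; other constants follow by linearity.\<close>

lemma tangent_const:
  assumes v: "v \<in> tangent_space A q" and q: "q \<in> P"
  shows "v (\<lambda>r. if r \<in> P then a else 0) = 0"
proof -
  let ?k = "\<lambda>r. if r \<in> P then 1 else 0 :: real"
  have "v (\<lambda>r. ?k r * ?k r) = 2 * v ?k"
    using tangent_mult[OF v C_const C_const, of 1 1] q by simp
  moreover have "(\<lambda>r. ?k r * ?k r) = ?k" by auto
  ultimately have "v ?k = 0" by simp
  moreover have "(\<lambda>r. if r \<in> P then a else 0) = (\<lambda>r. a * ?k r)" by auto
  ultimately show ?thesis using tangent_scale[OF v C_const, of a 1] by simp
qed

text \<open>For a bump \<open>\<eta>\<close> supported in \<open>W\<close> the product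
  \<open>\<eta> (f - h)\<close> is identically zero. In its Leibniz expansion at \<open>q\<close>
  one has \<open>\<eta> q = 1\<close> and \<open>f q - h q = 0\<close>, so
  \<open>v (f - h) = 0\<close>.\<close>

lemma tangent_local:
  assumes v: "v \<in> tangent_space A q" and f: "f \<in> C" "h \<in> C"
    and W: "openin (mtop A) W" "q \<in> W" "\<And>r. r \<in> W \<Longrightarrow> f r = h r"
  shows "v f = v h"
proof -
  obtain \<eta> V where \<eta>: "\<eta> \<in> smooth_funs_c A W" "openin (mtop A) V" "q \<in> V" "V \<subseteq> W" "\<And>r. r \<in> V \<Longrightarrow> \<eta> r = 1"
    by (rule bump_exists[OF W(1,2)]) blast
  let ?d = "\<lambda>r. f r + (- 1) * h r"
  have d: "?d \<in> C" using f by (intro C_add C_scale)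
  have "\<eta> r * ?d r = 0" for r
    using W(3) supp_zero[of r \<eta>] smooth_funs_cD(1,3)[OF \<eta>(1)] C_outside[of \<eta> r] by (cases "r \<in> W") auto
  then have "v (\<lambda>r. \<eta> r * ?d r) = 0" using tangent_zero[OF v] by presburger
  moreover have "v (\<lambda>r. \<eta> r * ?d r) = \<eta> q * v ?d + ?d q * v \<eta>"
    by (rule tangent_mult[OF v smooth_funs_cD(1)[OF \<eta>(1)] d])
  ultimately have "v ?d = 0" using \<eta>(3,5) W(2,3) by simp
  then show ?thesis
    using tangent_add[OF v f(1) C_scale[OF f(2)], of "- 1"] tangent_scale[OF v f(2), of "- 1"] by simp
qed

lemma C_smooth_in_chart: "f \<in> C \<Longrightarrow> c \<in> A \<Longrightarrow> smooth_on (snd c ` fst c) (f \<circ> chart_inv c)"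
proof -
  assume f: "f \<in> C" and c: "c \<in> A"
  have "fst c \<inter> P = fst c" using chart_dom_subset[OF c] by blast
  then show ?thesis using f c unfolding smooth_funs_def by fastforce
qed

lemma C_has_derivative:
  assumes "f \<in> C" "c \<in> A" "q \<in> fst c"
  shows "((f \<circ> chart_inv c) has_derivative frechet_derivative (f \<circ> chart_inv c) (at (snd c q))) (at (snd c q))"
  using assms by (intro smooth_on_has_derivative[OF C_smooth_in_chart]) auto

lemma coord_vec_eq: "f \<in> C \<Longrightarrow> coord_vec A c q b f = frechet_derivative (f \<circ> chart_inv c) (at (snd c q)) b"
  by (simp add: coord_vec_def)

lemma coord_vec_eqI:
  "f \<in> C \<Longrightarrow> ((f \<circ> chart_inv c) has_derivative D) (at (snd c q)) \<Longrightarrow> coord_vec A c q b f = D b"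
  using frechet_derivative_at[of "f \<circ> chart_inv c" D "snd c q"] by (simp add: coord_vec_eq)

lemma coord_vec_tangent:
  assumes c: "c \<in> A" "q \<in> fst c"
  shows "coord_vec A c q b \<in> tangent_space A q"
  unfolding tangent_space_iff
proof (intro conjI ballI allI impI)
  fix f h a assume f: "f \<in> C" and h: "h \<in> C"
  note D = C_has_derivative[OF f c] C_has_derivative[OF h c]
  show "coord_vec A c q b (\<lambda>r. f r + h r) = coord_vec A c q b f + coord_vec A c q b h"
    using has_derivative_add[OF D] by (subst coord_vec_eqI[OF C_add[OF f h]]) (auto simp: o_def coord_vec_eq f h)
  show "coord_vec A c q b (\<lambda>r. a * f r) = a * coord_vec A c q b f"
    using has_derivative_mult_right[OF D(1), of a] by (subst coord_vec_eqI[OF C_scale[OF f]]) (auto simp: o_def coord_vec_eq f)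
  show "coord_vec A c q b (\<lambda>r. f r * h r) = f q * coord_vec A c q b h + h q * coord_vec A c q b f"
    using has_derivative_mult[OF D] c by (subst coord_vec_eqI[OF C_mult[OF f h]]) (auto simp: o_def coord_vec_eq f h mult.commute)
qed (simp add: coord_vec_def)

lemma coord_vec_linear:
  assumes c: "c \<in> A" "q \<in> fst c"
  shows "linear (\<lambda>b. coord_vec A c q b f)"
proof (cases "f \<in> C")
  case True
  then show ?thesis using has_derivative_linear[OF C_has_derivative[OF True c]] by (simp add: coord_vec_def)
next
  case False
  then show ?thesis by (simp add: coord_vec_def linear_iff)
qed

lemma smooth_at_coordinate: "c \<in> A \<Longrightarrow> q \<in> fst c \<Longrightarrow> smooth_at A (\<lambda>r. snd c r \<bullet> b) q"
  by (rule smooth_at_chartI[OF _ _ open_UNIV, of c q "\<lambda>x. x \<bullet> b"])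
    (auto intro: smooth_on_inner smooth_on_ident smooth_on_const)

text \<open>Coordinate functions are extended from a neighbourhood of a point to the manifold, because
  tangent vectors act on global functions only.\<close>

lemma global_coordinates:
  assumes c: "c \<in> A" "q \<in> fst c"
  obtains u V where "\<And>b. u b \<in> C" "openin (mtop A) V" "q \<in> V" "V \<subseteq> fst c" "\<And>b r. r \<in> V \<Longrightarrow> u b r = snd c r \<bullet> b"
proof -
  obtain \<eta> V where \<eta>: "\<eta> \<in> smooth_funs_c A (fst c)" "openin (mtop A) V" "q \<in> V" "V \<subseteq> fst c" "\<And>r. r \<in> V \<Longrightarrow> \<eta> r = 1"
    by (rule bump_exists[OF openin_chart_dom[OF c(1)] c(2)]) blast
  have "(\<lambda>r. if r \<in> fst c then \<eta> r * (snd c r \<bullet> b) else 0) \<in> C" for b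
    by (rule smooth_funs_cD(1)[OF cutoff_smooth_funs_c[OF \<eta>(1) _ chart_dom_subset[OF c(1)]]])
      (rule smooth_at_coordinate[OF c(1)])
  then show ?thesis
    by (rule that[OF _ \<eta>(2-4)]) (use \<eta>(4,5) in auto)
qed

lemma local_chart_derivative:
  assumes c: "c \<in> A" "q \<in> fst c" and V: "openin (mtop A) V" "q \<in> V" "\<And>r. r \<in> V \<Longrightarrow> f r = F (snd c r)"
    and F: "(F has_derivative D) (at (snd c q))"
  shows "((f \<circ> chart_inv c) has_derivative D) (at (snd c q))"
proof (rule has_derivative_transform_within_open[OF F openin_mtop_imp_open_image[OF V(1) c(1)]])
  show "snd c q \<in> snd c ` (fst c \<inter> V)" using c V by blast
  fix x assume "x \<in> snd c ` (fst c \<inter> V)"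
  then obtain r where "r \<in> fst c" "r \<in> V" "x = snd c r" by blast
  then show "F x = (f \<circ> chart_inv c) x" using V(3) c(1) by simp
qed

lemma coord_vec_coordinate:
  assumes c: "c \<in> A" "q \<in> fst c" and V: "openin (mtop A) V" "q \<in> V" "\<And>r. r \<in> V \<Longrightarrow> f r = snd c r \<bullet> b"
    and f: "f \<in> C"
  shows "coord_vec A c q w f = w \<bullet> b"
  by (rule coord_vec_eqI[OF f, of c "\<lambda>w. w \<bullet> b"], rule local_chart_derivative[where F="\<lambda>x. x \<bullet> b" and f=f, OF c V])
    (auto intro!: derivative_eq_intros)

lemma coord_vec_inj:
  assumes c: "c \<in> A" "q \<in> fst c"
  shows "coord_vec A c q w = coord_vec A c q w' \<Longrightarrow> w = w'"
proof (rule euclidean_eqI)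
  fix b :: 'b assume eq: "coord_vec A c q w = coord_vec A c q w'"
  obtain u V where u: "\<And>b. u b \<in> C" "openin (mtop A) V" "q \<in> V" "V \<subseteq> fst c" "\<And>b r. r \<in> V \<Longrightarrow> u b r = snd c r \<bullet> b"
    by (rule global_coordinates[OF c]) blast
  show "w \<bullet> b = w' \<bullet> b"
    using coord_vec_coordinate[OF c u(2,3), of "u b" b] u(1,5) eq by metis
qed

text \<open>Derivations at a point are coordinate vectors: \<open>v\<close> is applied to Hadamard's
  expansion of \<open>f\<close> around \<open>q\<close>. Since \<open>v\<close> accepts global
  functions only, every ingredient of the expansion is first extended to the manifold.\<close>

lemma tangent_eq_coord_vec:
  assumes c: "c \<in> A" "q \<in> fst c" and v: "v \<in> tangent_space A q"
    and u: "\<And>b. u b \<in> C" "openin (mtop A) V" "q \<in> V" "\<And>b r. r \<in> V \<Longrightarrow> u b r = snd c r \<bullet> b"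
  shows "v = coord_vec A c q (\<Sum>b\<in>Basis. v (u b) *\<^sub>R b)"
proof
  fix f
  let ?w = "\<Sum>b\<in>Basis. v (u b) *\<^sub>R b"
  show "v f = coord_vec A c q ?w f"
  proof (cases "f \<in> C")
    case False
    then show ?thesis using tangent_outside[OF v] by (simp add: coord_vec_def)
  next
    case f: True
    have qP: "q \<in> P" using chart_dom_subset[OF c(1)] c(2) by blast
    let ?x0 = "snd c q"
    obtain e where e: "e > 0" "ball ?x0 e \<subseteq> snd c ` fst c"
      using open_chart_range[OF c(1)] c(2) openE by blast
    have "smooth_on (ball ?x0 e) (f \<circ> chart_inv c)"
      by (rule smooth_on_subset[OF C_smooth_in_chart[OF f c(1)] e(2)])
    from hadamard[OF this e(1)] obtain g where g: "\<And>b. smooth_on (ball ?x0 e) (g b)"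
      "\<And>x. x \<in> ball ?x0 e \<Longrightarrow> (f \<circ> chart_inv c) x = (f \<circ> chart_inv c) ?x0 + (\<Sum>b\<in>Basis. ((x - ?x0) \<bullet> b) * g b x)"
      "\<And>b. g b ?x0 = frechet_derivative (f \<circ> chart_inv c) (at ?x0) b" by blast
    let ?W = "{r \<in> fst c. snd c r \<in> ball ?x0 e}"
    have W: "openin (mtop A) ?W" "q \<in> ?W" "?W \<subseteq> P"
      using openin_mtop_basic[OF c(1) open_ball] c(2) e(1) chart_dom_subset[OF c(1)] by auto
    obtain \<eta> V' where \<eta>: "\<eta> \<in> smooth_funs_c A ?W" "openin (mtop A) V'" "q \<in> V'" "V' \<subseteq> ?W" "\<And>r. r \<in> V' \<Longrightarrow> \<eta> r = 1"
      by (rule bump_exists[OF W(1,2)]) blast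
    \<comment> \<open>Hadamard's coefficients live on a ball in the chart; the bump makes them
      members of \<open>C\<close>.\<close>
    define G where "G b r = (if r \<in> ?W then \<eta> r * g b (snd c r) else 0)" for b r
    have G: "G b \<in> C" for b
      unfolding G_def
    proof (rule smooth_funs_cD(1)[OF cutoff_smooth_funs_c[OF \<eta>(1) _ W(3)]])
      fix r assume "r \<in> ?W"
      then show "smooth_at A (\<lambda>r. g b (snd c r)) r"
        by (intro smooth_at_chartI[OF c(1) _ open_ball _ g(1)]) auto
    qed
    let ?k = "\<lambda>a r. if r \<in> P then a else 0 :: real"
    \<comment> \<open>Hadamard's formula in global functions; it agrees with \<open>f\<close> near
      \<open>q\<close>. The factors \<open>u b - ?x0 \<bullet> b\<close> vanish at \<open>q\<close>,
      so the Leibniz rule leaves only \<open>v (u b) * G b q\<close>.\<close>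
    let ?R = "\<lambda>r. ?k (f q) r + (\<Sum>b\<in>Basis. (u b r + ?k (- (?x0 \<bullet> b)) r) * G b r)"
    have u': "(\<lambda>r. u b r + ?k (- (?x0 \<bullet> b)) r) \<in> C" for b by (intro C_add u C_const)
    have "v f = v ?R"
    proof (rule tangent_local[OF v f _ openin_Int[OF u(2) \<eta>(2)]])
      show "?R \<in> C" by (intro C_add C_const C_sum C_mult u' G)
      show "q \<in> V \<inter> V'" using u \<eta> by blast
      fix r assume "r \<in> V \<inter> V'"
      then have r: "r \<in> V" "r \<in> V'" "r \<in> ?W" "r \<in> P" using \<eta>(4) W(3) by auto
      then have "G b r = g b (snd c r)" for b using \<eta>(5) by (simp add: G_def)
      then show "f r = ?R r"
        using g(2)[of "snd c r"] r c by (simp add: u(4) inner_diff_left)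
    qed
    also have "\<dots> = v (?k (f q)) + (\<Sum>b\<in>Basis. v (\<lambda>r. (u b r + ?k (- (?x0 \<bullet> b)) r) * G b r))"
      by (subst tangent_add[OF v], intro C_const, intro C_sum C_mult u' G, subst tangent_sum[OF v], intro C_mult u' G, rule refl)
    also have "\<dots> = (\<Sum>b\<in>Basis. v (u b) * frechet_derivative (f \<circ> chart_inv c) (at ?x0) b)"
    proof -
      have "v (\<lambda>r. (u b r + ?k (- (?x0 \<bullet> b)) r) * G b r) = v (u b) * frechet_derivative (f \<circ> chart_inv c) (at ?x0) b" for b
      proof -
        have "v (\<lambda>r. u b r + ?k (- (?x0 \<bullet> b)) r) = v (u b)"
          by (simp add: tangent_add[OF v u(1) C_const] tangent_const[OF v qP])
        moreover have "G b q = frechet_derivative (f \<circ> chart_inv c) (at ?x0) b"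
          using \<eta>(3,5) W(2) by (simp add: G_def g(3))
        moreover have "u b q + ?k (- (?x0 \<bullet> b)) q = 0" using u(3,4) qP by simp
        ultimately show ?thesis by (subst tangent_mult[OF v u' G]) (simp add: mult.commute)
      qed
      then show ?thesis using tangent_const[OF v qP] by simp
    qed
    also have "\<dots> = coord_vec A c q ?w f"
      by (subst linear_sum[OF coord_vec_linear[OF c, of f]], subst linear_cmul[OF coord_vec_linear[OF c, of f]])
        (simp add: coord_vec_eq[OF f])
    finally show ?thesis .
  qed
qed

definition comps :: "('a, 'b) chart \<Rightarrow> 'a \<Rightarrow> 'a tvec \<Rightarrow> 'b" where
  "comps c q v = (THE w. coord_vec A c q w = v)"

lemma comps_coord_vec:
  assumes "c \<in> A" "q \<in> fst c"
  shows "comps c q (coord_vec A c q w) = w"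
  unfolding comps_def using coord_vec_inj[OF assms] by blast

lemma coord_vec_comps:
  assumes c: "c \<in> A" "q \<in> fst c" and v: "v \<in> tangent_space A q"
  shows "coord_vec A c q (comps c q v) = v"
proof -
  obtain u V where u: "\<And>b. u b \<in> C" "openin (mtop A) V" "q \<in> V" "V \<subseteq> fst c" "\<And>b r. r \<in> V \<Longrightarrow> u b r = snd c r \<bullet> b"
    by (rule global_coordinates[OF c]) blast
  have "v = coord_vec A c q (\<Sum>b\<in>Basis. v (u b) *\<^sub>R b)"
    by (rule tangent_eq_coord_vec[OF c v u(1,2,3,5)])
  then show ?thesis using comps_coord_vec[OF c] by metis
qed

lemma coord_vec_add:
  assumes "c \<in> A" "q \<in> fst c"
  shows "coord_vec A c q (w + w') = (\<lambda>f. coord_vec A c q w f + coord_vec A c q w' f)"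
  using linear_add[OF coord_vec_linear[OF assms]] by blast

lemma coord_vec_scale:
  assumes "c \<in> A" "q \<in> fst c"
  shows "coord_vec A c q (a *\<^sub>R w) = (\<lambda>f. a * coord_vec A c q w f)"
  using linear_cmul[OF coord_vec_linear[OF assms]] by auto

lemma coord_vec_zero:
  assumes "c \<in> A" "q \<in> fst c"
  shows "coord_vec A c q 0 = (\<lambda>f. 0)"
  using linear_0[OF coord_vec_linear[OF assms]] by auto

lemma cotangent_space_iff: "p \<in> cotangent_space A q \<longleftrightarrow>
     (\<forall>v. v \<notin> tangent_space A q \<longrightarrow> p v = 0) \<and>
     (\<forall>v\<in>tangent_space A q. \<forall>w\<in>tangent_space A q. p (\<lambda>f. v f + w f) = p v + p w) \<and>
     (\<forall>v\<in>tangent_space A q. \<forall>a. p (\<lambda>f. a * v f) = a * p v)"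
  by (simp add: cotangent_space_def Let_def)

definition cocomps :: "('a, 'b) chart \<Rightarrow> 'a \<Rightarrow> 'a covec \<Rightarrow> 'b" where
  "cocomps c q p = (\<Sum>b\<in>Basis. p (coord_vec A c q b) *\<^sub>R b)"

lemma cotangent_linear:
  assumes c: "c \<in> A" "q \<in> fst c" and p: "p \<in> cotangent_space A q"
  shows "linear (\<lambda>w. p (coord_vec A c q w))"
  using p coord_vec_tangent[OF c]
  by (intro linearI) (simp_all add: coord_vec_add[OF c] coord_vec_scale[OF c] cotangent_space_iff)

lemma cotangent_coord_vec:
  assumes c: "c \<in> A" "q \<in> fst c" and p: "p \<in> cotangent_space A q"
  shows "p (coord_vec A c q w) = cocomps c q p \<bullet> w"
  by (subst linear_basis_expansion[OF cotangent_linear[OF c p], of w])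
    (simp add: cocomps_def inner_sum_left inner_sum_right mult.commute inner_commute)

lemma cotangent_eval:
  assumes "c \<in> A" "q \<in> fst c" "p \<in> cotangent_space A q" "v \<in> tangent_space A q"
  shows "p v = cocomps c q p \<bullet> comps c q v"
  using cotangent_coord_vec[OF assms(1-3), of "comps c q v"] coord_vec_comps[OF assms(1,2,4)] by simp

text \<open>The inverse of \<open>cocomps\<close>, extended by zero as
  \<open>cotangent_space\<close> demands; it makes the inverse of a cotangent chart
  explicit.\<close>

definition covec :: "('a, 'b) chart \<Rightarrow> 'a \<Rightarrow> 'b \<Rightarrow> 'a covec" where
  "covec c q y = (\<lambda>v. if v \<in> tangent_space A q then y \<bullet> comps c q v else 0)"

lemma comps_add:
  assumes c: "c \<in> A" "q \<in> fst c" and v: "v \<in> tangent_space A q" "w \<in> tangent_space A q"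
  shows "comps c q (\<lambda>f. v f + w f) = comps c q v + comps c q w" "(\<lambda>f. v f + w f) \<in> tangent_space A q"
proof -
  have "coord_vec A c q (comps c q v + comps c q w) = (\<lambda>f. v f + w f)"
    by (simp add: coord_vec_add[OF c] coord_vec_comps[OF c] v)
  then show "comps c q (\<lambda>f. v f + w f) = comps c q v + comps c q w" "(\<lambda>f. v f + w f) \<in> tangent_space A q"
    using comps_coord_vec[OF c] coord_vec_tangent[OF c] by metis+
qed

lemma comps_scale:
  assumes c: "c \<in> A" "q \<in> fst c" and v: "v \<in> tangent_space A q"
  shows "comps c q (\<lambda>f. a * v f) = a *\<^sub>R comps c q v" "(\<lambda>f. a * v f) \<in> tangent_space A q"
proof -
  have "coord_vec A c q (a *\<^sub>R comps c q v) = (\<lambda>f. a * v f)"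
    by (simp add: coord_vec_scale[OF c] coord_vec_comps[OF c] v)
  then show "comps c q (\<lambda>f. a * v f) = a *\<^sub>R comps c q v" "(\<lambda>f. a * v f) \<in> tangent_space A q"
    using comps_coord_vec[OF c] coord_vec_tangent[OF c] by metis+
qed

lemma covec_cotangent:
  assumes c: "c \<in> A" "q \<in> fst c"
  shows "covec c q y \<in> cotangent_space A q"
  unfolding cotangent_space_iff covec_def
  using comps_add[OF c] comps_scale[OF c] by (simp add: inner_add_right)

lemma cocomps_covec:
  assumes c: "c \<in> A" "q \<in> fst c"
  shows "cocomps c q (covec c q y) = y"
proof -
  have "covec c q y (coord_vec A c q b) = y \<bullet> b" for b
    by (simp add: covec_def coord_vec_tangent[OF c] comps_coord_vec[OF c])
  then show ?thesis by (simp add: cocomps_def euclidean_representation)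
qed

lemma covec_cocomps:
  assumes c: "c \<in> A" "q \<in> fst c" and p: "p \<in> cotangent_space A q"
  shows "covec c q (cocomps c q p) = p"
proof
  fix v
  show "covec c q (cocomps c q p) v = p v"
  proof (cases "v \<in> tangent_space A q")
    case True
    then show ?thesis by (simp add: covec_def cotangent_eval[OF c p True])
  next
    case False
    then have "p v = 0" using p unfolding cotangent_space_iff by blast
    then show ?thesis using False by (simp add: covec_def)
  qed
qed

lemma smooth_at_differentiable:
  assumes "smooth_at A f q" "c \<in> A" "q \<in> fst c"
  shows "(f \<circ> chart_inv c) differentiable (at (snd c q))"
proof -
  obtain T where "open T" "snd c q \<in> T" "T \<subseteq> snd c ` fst c" "smooth_on T (f \<circ> chart_inv c)"
    by (rule smooth_at_in_chart[OF assms])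
  then show ?thesis by (intro smooth_on_differentiable)
qed

lemma frechet_derivative_chart_cong:
  fixes f f' :: "'a \<Rightarrow> real"
  assumes c: "c \<in> A" "q \<in> fst c" and W: "openin (mtop A) W" "q \<in> W" "\<And>r. r \<in> W \<Longrightarrow> f r = f' r"
  shows "frechet_derivative (f \<circ> chart_inv c) (at (snd c q)) = frechet_derivative (f' \<circ> chart_inv c) (at (snd c q))"
proof -
  have *: "((f' \<circ> chart_inv c) has_derivative D) (at (snd c q))"
    if "((f \<circ> chart_inv c) has_derivative D) (at (snd c q))" "\<And>r. r \<in> W \<Longrightarrow> f r = f' r" for D and f f' :: "'a \<Rightarrow> real"
    by (rule local_chart_derivative[OF c openin_Int[OF W(1) openin_chart_dom[OF c(1)]] _ _ that(1)])
      (use that(2) c W(2) in simp_all)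
  have "((f \<circ> chart_inv c) has_derivative D) (at (snd c q)) \<longleftrightarrow> ((f' \<circ> chart_inv c) has_derivative D) (at (snd c q))" for D
    using *[of f D f'] *[of f' D f] W(3) by metis
  then show ?thesis by (simp add: frechet_derivative_def)
qed

section \<open>The cotangent bundle as a manifold\<close>

abbreviation "transition c d \<equiv> snd d \<circ> chart_inv c"
abbreviation "jac c d q \<equiv> frechet_derivative (transition c d) (at (snd c q))"

lemma transition_has_derivative:
  assumes "c \<in> A" "d \<in> A" "q \<in> fst c" "q \<in> fst d"
  shows "(transition c d has_derivative jac c d q) (at (snd c q))"
  using assms by (intro smooth_on_has_derivative[OF transition_smooth]) auto

lemma coord_vec_change:
  assumes "c \<in> A" "d \<in> A" "q \<in> fst c" "q \<in> fst d"
  shows "coord_vec A c q w = coord_vec A d q (jac c d q w)"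
proof
  fix f
  show "coord_vec A c q w f = coord_vec A d q (jac c d q w) f"
  proof (cases "f \<in> C")
    case True
    have D: "((f \<circ> chart_inv d) has_derivative frechet_derivative (f \<circ> chart_inv d) (at (snd d q))) (at (transition c d (snd c q)))"
      using C_has_derivative[OF True assms(2,4)] assms by simp
    have "((\<lambda>x. (f \<circ> chart_inv d) (transition c d x)) has_derivative
        (\<lambda>w. frechet_derivative (f \<circ> chart_inv d) (at (snd d q)) (jac c d q w))) (at (snd c q))"
      by (rule has_derivative_compose[OF transition_has_derivative[OF assms] D])
    then have "((f \<circ> chart_inv c) has_derivative (\<lambda>w. frechet_derivative (f \<circ> chart_inv d) (at (snd d q)) (jac c d q w))) (at (snd c q))"
    proof (rule has_derivative_transform_within_open[OF _ transition_open[OF assms(1,2)]])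
      show "snd c q \<in> snd c ` (fst c \<inter> fst d)" using assms by blast
      fix x assume "x \<in> snd c ` (fst c \<inter> fst d)"
      then obtain r where "r \<in> fst c" "r \<in> fst d" "x = snd c r" by blast
      then show "(f \<circ> chart_inv d) (transition c d x) = (f \<circ> chart_inv c) x" using assms by simp
    qed
    from coord_vec_eqI[OF True this] show ?thesis by (simp add: coord_vec_eq[OF True])
  qed (simp add: coord_vec_def)
qed

lemma jac_inverse:
  assumes "c \<in> A" "d \<in> A" "q \<in> fst c" "q \<in> fst d"
  shows "jac d c q (jac c d q w) = w"
proof -
  have "coord_vec A c q (jac d c q (jac c d q w)) = coord_vec A c q w"
    using coord_vec_change[OF assms, of w] coord_vec_change[OF assms(2,1,4,3), of "jac c d q w"] by simp
  then show ?thesis by (rule coord_vec_inj[OF assms(1,3)])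
qed

text \<open>Momenta transform contragrediently: by the transpose of the Jacobian of the inverse
  change, hence \<open>jac d c\<close> rather than \<open>jac c d\<close>.\<close>

lemma cocomps_change:
  assumes "c \<in> A" "d \<in> A" "q \<in> fst c" "q \<in> fst d" and p: "p \<in> cotangent_space A q"
  shows "cocomps d q p = (\<Sum>b\<in>Basis. (cocomps c q p \<bullet> jac d c q b) *\<^sub>R b)"
  unfolding cocomps_def[of d] coord_vec_change[OF assms(2,1,4,3)] cotangent_coord_vec[OF assms(1,3,5)] ..

abbreviation "TA \<equiv> cotangent_bundle A"
abbreviation "tc \<equiv> cotangent_chart A"

lemma fst_tc: "fst (tc c) = Sigma (fst c) (cotangent_space A)"
  by (simp add: cotangent_chart_def)

lemma snd_tc: "snd (tc c) (q, p) = (snd c q, cocomps c q p)"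
  by (simp add: cotangent_chart_def cocomps_def)

lemma tc_in: "c \<in> A \<Longrightarrow> tc c \<in> TA"
  by (simp add: cotangent_bundle_def)

lemma points_TA: "points TA = Sigma P (cotangent_space A)"
  by (auto simp: points_def cotangent_bundle_def fst_tc)

lemma tc_image:
  assumes c: "c \<in> A" and B: "B \<subseteq> fst c"
  shows "snd (tc c) ` Sigma B (cotangent_space A) = (snd c ` B) \<times> UNIV"
proof (intro set_eqI iffI)
  fix z assume "z \<in> snd (tc c) ` Sigma B (cotangent_space A)"
  then show "z \<in> (snd c ` B) \<times> UNIV" by (auto simp: snd_tc)
next
  fix z :: "'b \<times> 'b" assume "z \<in> (snd c ` B) \<times> UNIV"
  then obtain q y where q: "q \<in> B" "z = (snd c q, y)" by auto
  then have "snd (tc c) (q, covec c q y) = z" using c B by (auto simp: snd_tc cocomps_covec)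
  moreover have "(q, covec c q y) \<in> Sigma B (cotangent_space A)" using q(1) B covec_cotangent[OF c] by blast
  ultimately show "z \<in> snd (tc c) ` Sigma B (cotangent_space A)" by (metis imageI)
qed

lemma tc_inj:
  assumes c: "c \<in> A"
  shows "inj_on (snd (tc c)) (fst (tc c))"
proof (rule inj_onI)
  fix x x' assume x: "x \<in> fst (tc c)" "x' \<in> fst (tc c)" "snd (tc c) x = snd (tc c) x'"
  obtain q p q' p' where xx: "x = (q, p)" "x' = (q', p')" by fastforce
  have "snd c q = snd c q'" "cocomps c q p = cocomps c q' p'" using x(3) by (simp_all add: xx snd_tc)
  moreover have q: "q \<in> fst c" "q' \<in> fst c" "p \<in> cotangent_space A q" "p' \<in> cotangent_space A q'"
    using x by (simp_all add: xx fst_tc)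
  ultimately show "x = x'"
    using inj_onD[OF chart_inj[OF c]] covec_cocomps[OF c] unfolding xx by metis
qed

lemma chart_inv_tc:
  assumes c: "c \<in> A" and q: "q \<in> fst c"
  shows "chart_inv (tc c) (snd c q, y) = (q, covec c q y)"
proof -
  have "(snd c q, y) = snd (tc c) (q, covec c q y)" by (simp add: snd_tc cocomps_covec[OF c q])
  then show ?thesis
    using tc_inj[OF c] covec_cotangent[OF c q] q by (simp add: chart_inv_def fst_tc)
qed

lemma tc_transition:
  assumes cd: "c \<in> A" "d \<in> A" and q: "q \<in> fst c" "q \<in> fst d"
  shows "(snd (tc d) \<circ> chart_inv (tc c)) (snd c q, y) = (snd d q, \<Sum>b\<in>Basis. (y \<bullet> jac d c q b) *\<^sub>R b)"
  using cocomps_change[OF cd q covec_cotangent[OF cd(1) q(1)]]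
  by (simp add: chart_inv_tc[OF cd(1) q(1)] snd_tc cocomps_covec[OF cd(1) q(1)])

lemma fst_tc_Int: "fst (tc c) \<inter> fst (tc d) = Sigma (fst c \<inter> fst d) (cotangent_space A)"
  by (auto simp: fst_tc)

lemma tc_transition_smooth:
  assumes cd: "c \<in> A" "d \<in> A"
  shows "smooth_on (snd c ` (fst c \<inter> fst d) \<times> UNIV) (snd (tc d) \<circ> chart_inv (tc c))"
proof -
  let ?S = "snd c ` (fst c \<inter> fst d)"
  \<comment> \<open>The Jacobian of the inverse change is taken at the image point, hence the inner
    \<open>transition c d x\<close>.\<close>
  let ?J = "\<lambda>b x. frechet_derivative (transition d c) (at (transition c d x)) b"
  have o: "open (?S \<times> (UNIV :: 'b set))" by (intro open_Times transition_open cd open_UNIV)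
  have fs: "smooth_on (?S \<times> (UNIV :: 'b set)) fst" "smooth_on (?S \<times> (UNIV :: 'b set)) snd"
    by (rule smooth_on_linear, rule bounded_linear_fst bounded_linear_snd)+
  have "smooth_on ?S (?J b)" for b
    by (rule smooth_on_compose[OF transition_open[OF cd] smooth_on_frechet_derivative[OF transition_smooth[OF cd(2,1)]]
          transition_smooth[OF cd]]) (use cd in auto)
  then have J: "smooth_on (?S \<times> UNIV) (\<lambda>z :: 'b \<times> 'b. ?J b (fst z))" for b
    by (rule smooth_on_compose[OF o _ fs(1)]) auto
  have tr: "smooth_on (?S \<times> UNIV) (\<lambda>z :: 'b \<times> 'b. transition c d (fst z))"
    by (rule smooth_on_compose[OF o transition_smooth[OF cd] fs(1)]) auto
  have "smooth_on (?S \<times> UNIV) (\<lambda>z. (transition c d (fst z), \<Sum>b\<in>Basis. (snd z \<bullet> ?J b (fst z)) *\<^sub>R b))"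
    by (intro smooth_on_Pair o tr smooth_on_sum smooth_on_scaleR smooth_on_inner fs(2) J smooth_on_const)
  then show ?thesis
  proof (subst smooth_on_cong[OF o])
    fix z :: "'b \<times> 'b" assume "z \<in> ?S \<times> UNIV"
    then obtain q y where q: "q \<in> fst c" "q \<in> fst d" and z: "z = (snd c q, y)" by (cases z) auto
    show "(snd (tc d) \<circ> chart_inv (tc c)) z = (transition c d (fst z), \<Sum>b\<in>Basis. (snd z \<bullet> ?J b (fst z)) *\<^sub>R b)"
      unfolding z tc_transition[OF cd q] using cd q by simp
  qed
qed

lemma smooth_atlas_TA: "smooth_atlas TA"
  unfolding smooth_atlas_def
proof (intro conjI ballI)
  fix c' assume "c' \<in> TA" then show "inj_on (snd c') (fst c')" by (auto simp: cotangent_bundle_def tc_inj)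
next
  fix c' d' assume "c' \<in> TA" "d' \<in> TA"
  then obtain c d where cd: "c \<in> A" "d \<in> A" "c' = tc c" "d' = tc d" by (auto simp: cotangent_bundle_def)
  have im: "snd c' ` (fst c' \<inter> fst d') = snd c ` (fst c \<inter> fst d) \<times> UNIV"
    unfolding cd(3,4) fst_tc_Int by (rule tc_image[OF cd(1)]) simp
  show "open (snd c' ` (fst c' \<inter> fst d'))"
    unfolding im by (intro open_Times transition_open cd open_UNIV)
  show "smooth_on (snd c' ` (fst c' \<inter> fst d')) (snd d' \<circ> chart_inv c')"
    unfolding im unfolding cd(3,4) by (rule tc_transition_smooth[OF cd(1,2)])
qed

text \<open>Continuity of the bundle projection; in charts the set is a product with the whole
  fibre.\<close>

lemma openin_TA_preimage:
  assumes "openin (mtop A) U"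
  shows "openin (mtop TA) (Sigma U (cotangent_space A))"
proof -
  interpret T: smooth_atl TA by unfold_locales (rule smooth_atlas_TA)
  have "open (snd (tc c) ` (fst (tc c) \<inter> Sigma U (cotangent_space A)))" if c: "c \<in> A" for c
  proof -
    have "fst (tc c) \<inter> Sigma U (cotangent_space A) = Sigma (fst c \<inter> U) (cotangent_space A)" by (auto simp: fst_tc)
    then show ?thesis
      using tc_image[OF c, of "fst c \<inter> U"] openin_mtop_imp_open_image[OF assms c] by (simp add: open_Times)
  qed
  moreover have "U \<subseteq> P" using openin_subset[OF assms] by (simp add: topspace_mtop)
  ultimately show ?thesis unfolding T.openin_mtop_iff points_TA by (auto simp: cotangent_bundle_def)
qed

text \<open>Covectors over different points are separated by preimages of open sets of the base;
  covectors over the same point lie in a common bundle chart and are separated in Euclidean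
  space.\<close>

lemma hausdorff_TA: "Hausdorff_space (mtop TA)"
proof -
  interpret T: smooth_atl TA by unfold_locales (rule smooth_atlas_TA)
  show ?thesis
    unfolding Hausdorff_space_def
  proof (intro allI impI)
    fix x x' assume xx: "x \<in> topspace (mtop TA) \<and> x' \<in> topspace (mtop TA) \<and> x \<noteq> x'"
    obtain q p q' p' where x: "x = (q, p)" "x' = (q', p')" by fastforce
    have q: "q \<in> P" "p \<in> cotangent_space A q" "q' \<in> P" "p' \<in> cotangent_space A q'"
      using xx unfolding T.topspace_mtop points_TA x by auto
    show "\<exists>U V. openin (mtop TA) U \<and> openin (mtop TA) V \<and> x \<in> U \<and> x' \<in> V \<and> disjnt U V"
    proof (cases "q = q'")
      case False
      then obtain U V where UV: "openin (mtop A) U" "openin (mtop A) V" "q \<in> U" "q' \<in> V" "disjnt U V"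
        using hausdorff q unfolding Hausdorff_space_def topspace_mtop by blast
      show ?thesis
        by (rule exI[of _ "Sigma U (cotangent_space A)"], rule exI[of _ "Sigma V (cotangent_space A)"])
          (use UV openin_TA_preimage q in \<open>auto simp: x disjnt_def\<close>)
    next
      case True
      obtain c where c: "c \<in> A" "q \<in> fst c" using q(1) by (auto simp: points_def)
      have "snd (tc c) x \<noteq> snd (tc c) x'"
        using inj_onD[OF tc_inj[OF c(1)], of x x'] xx q c True by (auto simp: x fst_tc)
      then obtain S S' where S: "open S" "open S'" "snd (tc c) x \<in> S" "snd (tc c) x' \<in> S'" "S \<inter> S' = {}"
        using separation_t2 by metis
      show ?thesis
        by (rule exI[of _ "{r \<in> fst (tc c). snd (tc c) r \<in> S}"], rule exI[of _ "{r \<in> fst (tc c). snd (tc c) r \<in> S'}"])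
          (use S q c True T.openin_mtop_basic[OF tc_in[OF c(1)] S(1)] T.openin_mtop_basic[OF tc_in[OF c(1)] S(2)]
            in \<open>auto simp: disjnt_def x fst_tc\<close>)
    qed
  qed
qed

lemma smooth_mfd_TA: "smooth_mfd TA"
  by unfold_locales (rule smooth_atlas_TA hausdorff_TA)+

end

section \<open>The canonical bracket\<close>

text \<open>Invariance of the canonical bivector under the cotangent lift of a coordinate change: \<open>t\<close> and
  \<open>s\<close> are the Jacobians of the change and of its inverse, \<open>S\<close> is the adjoint of \<open>s\<close>, and
  \<open>q t + p N\<close>, \<open>p S\<close> are the partial derivatives of the pulled back function. The form \<open>H\<close> comes from the
  second derivative of the inverse, paired with the momentum.\<close>

lemma canonical_bivector_invariant:
  fixes qf pf qh ph :: "'b::euclidean_space \<Rightarrow> real" and t s S N :: "'b \<Rightarrow> 'b"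
  assumes lin: "linear qf" "linear pf" "linear qh" "linear ph" "linear t" "linear N"
    and inv: "\<And>w. t (s w) = w"
    and S: "\<And>w. S w = (\<Sum>b\<in>Basis. (w \<bullet> s b) *\<^sub>R b)"
    and N: "\<And>w. N (s w) = (\<Sum>b\<in>Basis. H b w *\<^sub>R b)" and H: "\<And>b w. H b w = H w b"
  shows "(\<Sum>b\<in>Basis. pf (S b) * (qh (t b) + ph (N b)) - (qf (t b) + pf (N b)) * ph (S b)) =
    (\<Sum>b\<in>Basis. pf b * qh b - qf b * ph b)"
proof -
  \<comment> \<open>Moves the adjoint \<open>S\<close> in one factor over to \<open>s\<close> in the
    other, where it can cancel against \<open>t\<close>.\<close>
  have push: "(\<Sum>b\<in>Basis. l (S b) * m (k b)) = (\<Sum>e\<in>Basis. l e * m (k (s e)))"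
    if "linear l" "linear m" "linear k" for l m :: "'b \<Rightarrow> real" and k :: "'b \<Rightarrow> 'b"
  proof -
    have "l (S b) = (\<Sum>e\<in>Basis. (b \<bullet> s e) * l e)" for b
      by (simp add: S linear_sum[OF that(1)] linear_cmul[OF that(1)])
    then have "(\<Sum>b\<in>Basis. l (S b) * m (k b)) = (\<Sum>b\<in>Basis. \<Sum>e\<in>Basis. l e * ((s e \<bullet> b) * m (k b)))"
      by (simp add: sum_distrib_left sum_distrib_right inner_commute mult_ac)
    also have "\<dots> = (\<Sum>e\<in>Basis. \<Sum>b\<in>Basis. l e * ((s e \<bullet> b) * m (k b)))" by (rule sum.swap)
    also have "\<dots> = (\<Sum>e\<in>Basis. l e * m (k (s e)))"
    proof (rule sum.cong[OF refl])
      fix e :: 'b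
      have "linear (\<lambda>x. m (k x))" using linear_compose[OF that(3,2)] by (simp add: o_def)
      from linear_basis_expansion[OF this, of "s e"]
      show "(\<Sum>b\<in>Basis. l e * ((s e \<bullet> b) * m (k b))) = l e * m (k (s e))" by (simp add: sum_distrib_left)
    qed
    finally show ?thesis .
  qed
  have NH: "m (N (s e)) = (\<Sum>b\<in>Basis. H b e * m b)" if "linear m" for m :: "'b \<Rightarrow> real" and e
    by (simp add: N linear_sum[OF that] linear_cmul[OF that])
  have "(\<Sum>b\<in>Basis. pf (S b) * (qh (t b) + ph (N b)) - (qf (t b) + pf (N b)) * ph (S b)) =
      (\<Sum>b\<in>Basis. pf (S b) * qh (t b)) + (\<Sum>b\<in>Basis. pf (S b) * ph (N b))
      - (\<Sum>b\<in>Basis. ph (S b) * qf (t b)) - (\<Sum>b\<in>Basis. ph (S b) * pf (N b))"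
    by (simp add: sum.distrib sum_subtractf algebra_simps)
  also have "\<dots> = (\<Sum>b\<in>Basis. pf b * qh b) + (\<Sum>b\<in>Basis. pf b * ph (N (s b)))
      - (\<Sum>b\<in>Basis. ph b * qf b) - (\<Sum>b\<in>Basis. ph b * pf (N (s b)))"
    by (simp add: push lin inv)
  \<comment> \<open>The terms with two fibre derivatives cancel, because \<open>H\<close> is
    symmetric.\<close>
  also have "(\<Sum>b\<in>Basis. pf b * ph (N (s b))) = (\<Sum>b\<in>Basis. ph b * pf (N (s b)))"
  proof -
    have "(\<Sum>b\<in>Basis. pf b * ph (N (s b))) = (\<Sum>b\<in>Basis. \<Sum>e\<in>Basis. pf b * (H e b * ph e))"
      by (simp add: NH lin sum_distrib_left)
    also have "\<dots> = (\<Sum>e\<in>Basis. \<Sum>b\<in>Basis. pf b * (H e b * ph e))" by (rule sum.swap)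
    also have "\<dots> = (\<Sum>b\<in>Basis. ph b * pf (N (s b)))"
      by (simp add: NH lin sum_distrib_left H[of _ "_ :: 'b"] mult_ac)
    finally show ?thesis .
  qed
  finally show ?thesis by (simp add: sum_subtractf mult.commute)
qed

text \<open>\<open>poisson\<close> in a prescribed chart. The chart inside \<open>poisson\<close> is
  a choice made separately at each point, so calculus is done with this version.\<close>

definition chart_bracket :: "('x, 'b \<times> 'b::euclidean_space) chart \<Rightarrow> ('x \<Rightarrow> real) \<Rightarrow> ('x \<Rightarrow> real) \<Rightarrow> 'x \<Rightarrow> real" where
  "chart_bracket c f h x = (\<Sum>b\<in>Basis. partial_p c f b x * partial_q c h b x - partial_q c f b x * partial_p c h b x)"

context smooth_mfd
begin

interpretation T: smooth_mfd TA by (rule smooth_mfd_TA)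

text \<open>The fibre part of the lifted change contains the Jacobian of the inverse change.
  Differentiating it in base directions yields second derivatives paired with \<open>y\<close>; in
  fibre directions the lift is linear and only the transposed Jacobian appears.\<close>

lemma tc_transition_derivative:
  assumes cd: "c \<in> A" "d \<in> A" and q: "q \<in> fst c" "q \<in> fst d"
  shows "((snd (tc d) \<circ> chart_inv (tc c)) has_derivative
     (\<lambda>z. (jac c d q (fst z),
       (\<Sum>b\<in>Basis. (y \<bullet> frechet_derivative (\<lambda>x. frechet_derivative (transition d c) (at x) b) (at (snd d q)) (jac c d q (fst z)) + snd z \<bullet> jac d c q b) *\<^sub>R b))))
     (at (snd c q, y))"
proof -
  let ?S = "snd c ` (fst c \<inter> fst d)"
  let ?J = "\<lambda>b x. frechet_derivative (transition d c) (at x) b"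
  have fst: "(fst has_derivative fst) (at (snd c q, y))" and snd: "(snd has_derivative snd) (at (snd c q, y))"
    by (rule bounded_linear_imp_has_derivative, rule bounded_linear_fst bounded_linear_snd)+
  have tr: "((\<lambda>z. transition c d (fst z)) has_derivative (\<lambda>z. jac c d q (fst z))) (at (snd c q, y))"
    by (rule has_derivative_compose[OF fst]) (simp only: fst_conv transition_has_derivative[OF cd q])
  have J: "((\<lambda>z. ?J b (transition c d (fst z))) has_derivative
      (\<lambda>z. frechet_derivative (?J b) (at (snd d q)) (jac c d q (fst z)))) (at (snd c q, y))" for b
  proof (rule has_derivative_compose[OF tr, of "?J b"])
    have "snd d q \<in> snd d ` (fst d \<inter> fst c)" using q by blast
    from smooth_on_has_derivative[OF smooth_on_frechet_derivative[OF transition_smooth[OF cd(2,1)]] this, of b]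
    show "(?J b has_derivative frechet_derivative (?J b) (at (snd d q))) (at (transition c d (fst (snd c q, y))))"
      using cd q by simp
  qed
  have "((\<lambda>z. (transition c d (fst z), \<Sum>b\<in>Basis. (snd z \<bullet> ?J b (transition c d (fst z))) *\<^sub>R b)) has_derivative
     (\<lambda>z. (jac c d q (fst z),
       (\<Sum>b\<in>Basis. (y \<bullet> frechet_derivative (?J b) (at (snd d q)) (jac c d q (fst z)) + snd z \<bullet> jac d c q b) *\<^sub>R b))))
     (at (snd c q, y))"
  proof (intro has_derivative_Pair tr has_derivative_sum has_derivative_scaleR_left)
    fix b :: 'b
    show "((\<lambda>z. snd z \<bullet> ?J b (transition c d (fst z))) has_derivative
      (\<lambda>z. y \<bullet> frechet_derivative (?J b) (at (snd d q)) (jac c d q (fst z)) + snd z \<bullet> jac d c q b)) (at (snd c q, y))"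
      using has_derivative_inner[OF snd J[of b]] cd q by simp
  qed
  then show ?thesis
  proof (rule has_derivative_transform_within_open)
    show "open (?S \<times> (UNIV :: 'b set))" by (intro open_Times transition_open cd open_UNIV)
    show "(snd c q, y) \<in> ?S \<times> UNIV" using q by blast
    fix z :: "'b \<times> 'b" assume "z \<in> ?S \<times> UNIV"
    then obtain r y where r: "r \<in> fst c" "r \<in> fst d" and z: "z = (snd c r, y)" by (cases z) auto
    show "(transition c d (fst z), \<Sum>b\<in>Basis. (snd z \<bullet> ?J b (transition c d (fst z))) *\<^sub>R b) = (snd (tc d) \<circ> chart_inv (tc c)) z"
      unfolding z tc_transition[OF cd r] using cd r by simp
  qed
qed

lemma chart_bracket_change:
  assumes cd: "c \<in> A" "d \<in> A" and x: "x \<in> fst (tc c)" "x \<in> fst (tc d)"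
    and f: "(f \<circ> chart_inv (tc d)) differentiable (at (snd (tc d) x))"
    and h: "(h \<circ> chart_inv (tc d)) differentiable (at (snd (tc d) x))"
  shows "chart_bracket (tc c) f h x = chart_bracket (tc d) f h x"
proof -
  obtain q p where xq: "x = (q, p)" by fastforce
  have q: "q \<in> fst c" "q \<in> fst d" "p \<in> cotangent_space A q" using x by (auto simp: xq fst_tc)
  define y where "y = cocomps c q p"
  let ?T = "snd (tc d) \<circ> chart_inv (tc c)"
  let ?J2 = "\<lambda>b. frechet_derivative (\<lambda>x. frechet_derivative (transition d c) (at x) b) (at (snd d q))"
  define N where "N u = (\<Sum>b\<in>Basis. (y \<bullet> ?J2 b (jac c d q u)) *\<^sub>R b)" for u
  define S where "S w = (\<Sum>b\<in>Basis. (w \<bullet> jac d c q b) *\<^sub>R b)" for w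
  have sx: "snd (tc c) x = (snd c q, y)" by (simp add: xq snd_tc y_def)
  have T: "(?T has_derivative (\<lambda>z. (jac c d q (fst z), N (fst z) + S (snd z)))) (at (snd (tc c) x))"
    using tc_transition_derivative[OF cd q(1,2), of y] by (simp add: sx N_def S_def sum.distrib[symmetric] scaleR_left_distrib)
  have Tx: "?T (snd (tc c) x) = snd (tc d) x" using x tc_in[OF cd(1)] by simp
  have pull: "linear (frechet_derivative (k \<circ> chart_inv (tc d)) (at (snd (tc d) x)))"
    "frechet_derivative (k \<circ> chart_inv (tc c)) (at (snd (tc c) x)) z =
      frechet_derivative (k \<circ> chart_inv (tc d)) (at (snd (tc d) x)) (jac c d q (fst z), N (fst z) + S (snd z))"
    if k: "(k \<circ> chart_inv (tc d)) differentiable (at (snd (tc d) x))" for k z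
  proof -
    let ?K = "frechet_derivative (k \<circ> chart_inv (tc d)) (at (snd (tc d) x))"
    have K: "((k \<circ> chart_inv (tc d)) has_derivative ?K) (at (?T (snd (tc c) x)))"
      using k unfolding Tx by (simp add: frechet_derivative_works)
    then show "linear ?K" by (rule has_derivative_linear)
    have "((\<lambda>z. (k \<circ> chart_inv (tc d)) (?T z)) has_derivative (\<lambda>z. ?K (jac c d q (fst z), N (fst z) + S (snd z)))) (at (snd (tc c) x))"
      by (rule has_derivative_compose[OF T K])
    then have "((k \<circ> chart_inv (tc c)) has_derivative (\<lambda>z. ?K (jac c d q (fst z), N (fst z) + S (snd z)))) (at (snd (tc c) x))"
    proof (rule has_derivative_transform_within_open[OF _ T.transition_open[OF tc_in[OF cd(1)] tc_in[OF cd(2)]]])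
      show "snd (tc c) x \<in> snd (tc c) ` (fst (tc c) \<inter> fst (tc d))" using x by blast
      fix z assume "z \<in> snd (tc c) ` (fst (tc c) \<inter> fst (tc d))"
      then obtain r where r: "r \<in> fst (tc c)" "r \<in> fst (tc d)" "z = snd (tc c) r" by blast
      then show "(k \<circ> chart_inv (tc d)) (?T z) = (k \<circ> chart_inv (tc c)) z"
        using T.chart_inv_chart[OF tc_in[OF cd(1)] r(1)] T.chart_inv_chart[OF tc_in[OF cd(2)] r(2)] by simp
    qed
    from frechet_derivative_at[OF this] show "frechet_derivative (k \<circ> chart_inv (tc c)) (at (snd (tc c) x)) z = ?K (jac c d q (fst z), N (fst z) + S (snd z))"
      by (rule fun_cong[OF sym])
  qed
  let ?f = "frechet_derivative (f \<circ> chart_inv (tc d)) (at (snd (tc d) x))"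
  let ?h = "frechet_derivative (h \<circ> chart_inv (tc d)) (at (snd (tc d) x))"
  have lin: "linear (\<lambda>u. k (u, 0))" "linear (\<lambda>u. k (0, u))" "k (u, w) = k (u, 0) + k (0, w)"
    if k: "linear k" for k :: "'b \<times> 'b \<Rightarrow> real" and u w
  proof -
    show "linear (\<lambda>u. k (u, 0))"
      using linear_compose[OF linearI[of "\<lambda>u. (u, 0)"] k] by (simp add: o_def)
    show "linear (\<lambda>u. k (0, u))"
      using linear_compose[OF linearI[of "\<lambda>u. (0, u)"] k] by (simp add: o_def)
    show "k (u, w) = k (u, 0) + k (0, w)"
      using linear_add[OF k, of "(u, 0)" "(0, w)"] by simp
  qed
  have linJ: "linear (jac c d q)" by (rule has_derivative_linear[OF transition_has_derivative[OF cd q(1,2)]])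
  have dq: "snd d q \<in> snd d ` (fst d \<inter> fst c)" using q by blast
  have linJ2: "linear (?J2 b)" for b
    by (rule has_derivative_linear[OF smooth_on_has_derivative[OF smooth_on_frechet_derivative[OF transition_smooth[OF cd(2,1)]] dq]])
  have linN: "linear N"
    unfolding N_def
    by (intro linear_compose_sum ballI linearI)
      (simp_all add: linear_add[OF linJ] linear_cmul[OF linJ] linear_add[OF linJ2] linear_cmul[OF linJ2] inner_add_right scaleR_add_left)
  have N0: "N 0 = 0" "S 0 = 0" "jac c d q 0 = 0" using linear_0[OF linN] linear_0[OF linJ] by (simp_all add: S_def)
  have "chart_bracket (tc c) f h x = (\<Sum>b\<in>Basis. ?f (0, S b) * (?h (jac c d q b, 0) + ?h (0, N b)) -
      (?f (jac c d q b, 0) + ?f (0, N b)) * ?h (0, S b))"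
    unfolding chart_bracket_def partial_p_def partial_q_def pull(2)[OF f] pull(2)[OF h]
    by (simp add: N0 lin(3)[OF pull(1)[OF f], of "jac c d q _" "N _"] lin(3)[OF pull(1)[OF h], of "jac c d q _" "N _"])
  also have "\<dots> = (\<Sum>b\<in>Basis. ?f (0, b) * ?h (b, 0) - ?f (b, 0) * ?h (0, b))"
  proof (rule canonical_bivector_invariant[where s = "jac d c q" and H = "\<lambda>b w. y \<bullet> ?J2 b w"])
    show "jac c d q (jac d c q w) = w" for w by (rule jac_inverse[OF cd(2,1) q(2,1)])
    then show "N (jac d c q w) = (\<Sum>b\<in>Basis. (y \<bullet> ?J2 b w) *\<^sub>R b)" for w by (simp add: N_def)
    \<comment> \<open>Equality of the mixed second derivatives of the inverse change enters
      here.\<close>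
    show "y \<bullet> ?J2 b w = y \<bullet> ?J2 w b" for b w
      using frechet_derivative_commute[OF transition_open[OF cd(2,1)] transition_smooth[OF cd(2,1)] dq, of b w] by simp
  qed (rule lin(1,2) pull(1) f h linJ linN S_def)+
  also have "\<dots> = chart_bracket (tc d) f h x"
    by (simp add: chart_bracket_def partial_p_def partial_q_def)
  finally show ?thesis .
qed

lemma in_tc: "x \<in> T.P \<Longrightarrow> \<exists>c\<in>A. x \<in> fst (tc c)"
  by (auto simp: points_def cotangent_bundle_def)

lemma poisson_eq_chart_bracket:
  assumes "x \<in> U" and c: "c \<in> A" "x \<in> fst (tc c)" and f: "smooth_at TA f x" and h: "smooth_at TA h x"
  shows "poisson A U f h x = chart_bracket (tc c) f h x"
proof -
  define d' where "d' = (SOME c. c \<in> TA \<and> x \<in> fst c)"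
  have "d' \<in> TA \<and> x \<in> fst d'"
    unfolding d'_def by (rule someI_ex) (use c tc_in in blast)
  then obtain d where d: "d \<in> A" "x \<in> fst (tc d)" "d' = tc d" by (auto simp: cotangent_bundle_def)
  have "poisson A U f h x = chart_bracket (tc d) f h x"
    using assms(1) d(3) by (simp add: poisson_def chart_bracket_def d'_def Let_def)
  also have "\<dots> = chart_bracket (tc c) f h x"
    by (rule chart_bracket_change[OF d(1) c(1) d(2) c(2) T.smooth_at_differentiable[OF f tc_in[OF c(1)] c(2)]
          T.smooth_at_differentiable[OF h tc_in[OF c(1)] c(2)]])
  finally show ?thesis .
qed

text \<open>The chart chosen by \<open>poisson\<close> may jump from point to point. One fixed chart
  computes the bracket on a whole neighbourhood, and there it is a polynomial in partial
  derivatives.\<close>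

lemma poisson_smooth:
  assumes U: "openin (mtop TA) U" and f: "\<And>x. x \<in> U \<Longrightarrow> smooth_at TA f x" and h: "\<And>x. x \<in> U \<Longrightarrow> smooth_at TA h x"
  shows "poisson A U f h \<in> smooth_funs TA U"
  unfolding T.smooth_funs_iff[OF U]
proof (intro conjI ballI allI impI)
  fix x assume x: "x \<in> U"
  then have "x \<in> T.P" using openin_subset[OF U] T.topspace_mtop by blast
  then obtain c where c: "c \<in> A" "x \<in> fst (tc c)" using in_tc by blast
  obtain T1 where T1: "open T1" "snd (tc c) x \<in> T1" "T1 \<subseteq> snd (tc c) ` fst (tc c)" "smooth_on T1 (f \<circ> chart_inv (tc c))"
    by (rule T.smooth_at_in_chart[OF f[OF x] tc_in[OF c(1)] c(2)])
  obtain T2 where T2: "open T2" "snd (tc c) x \<in> T2" "T2 \<subseteq> snd (tc c) ` fst (tc c)" "smooth_on T2 (h \<circ> chart_inv (tc c))"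
    by (rule T.smooth_at_in_chart[OF h[OF x] tc_in[OF c(1)] c(2)])
  let ?T = "T1 \<inter> T2 \<inter> snd (tc c) ` (fst (tc c) \<inter> U)"
  have o: "open ?T" using T1 T2 T.openin_mtop_imp_open_image[OF U tc_in[OF c(1)]] by blast
  let ?D = "\<lambda>f v z. frechet_derivative (f \<circ> chart_inv (tc c)) (at z) v"
  have sm: "smooth_on ?T (?D f v)" "smooth_on ?T (?D h v)" for v
    using smooth_on_subset[OF smooth_on_frechet_derivative[OF T1(4), of v], of ?T]
      smooth_on_subset[OF smooth_on_frechet_derivative[OF T2(4), of v], of ?T] by blast+
  have F: "smooth_on ?T (\<lambda>z. \<Sum>b\<in>Basis. ?D f (0, b) z * ?D h (b, 0) z - ?D f (b, 0) z * ?D h (0, b) z)"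
    by (intro smooth_on_sum smooth_on_diff smooth_on_mult o sm)
  show "smooth_at TA (poisson A U f h) x"
  proof (rule T.smooth_at_chartI[OF tc_in[OF c(1)] c(2) o _ F])
    show "snd (tc c) x \<in> ?T" using T1 T2 c x by blast
    fix r assume r: "r \<in> fst (tc c)" "snd (tc c) r \<in> ?T"
    then obtain r' where "r' \<in> fst (tc c)" "r' \<in> U" "snd (tc c) r = snd (tc c) r'" by blast
    then have "r \<in> U" using inj_onD[OF tc_inj[OF c(1)], of r r'] r(1) by simp
    then show "poisson A U f h r = (\<Sum>b\<in>Basis. ?D f (0, b) (snd (tc c) r) * ?D h (b, 0) (snd (tc c) r) - ?D f (b, 0) (snd (tc c) r) * ?D h (0, b) (snd (tc c) r))"
      using poisson_eq_chart_bracket[OF _ c(1) r(1) f h] by (simp add: chart_bracket_def partial_p_def partial_q_def)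
  qed
qed (simp add: poisson_def)

lemma chart_bracket_cong:
  assumes c: "c \<in> A" "x \<in> fst (tc c)" and W: "openin (mtop TA) W" "x \<in> W" "\<And>r. r \<in> W \<Longrightarrow> f r = f' r" "\<And>r. r \<in> W \<Longrightarrow> h r = h' r"
  shows "chart_bracket (tc c) f h x = chart_bracket (tc c) f' h' x"
  using T.frechet_derivative_chart_cong[where f=f and f'=f', OF tc_in[OF c(1)] c(2) W(1,2,3)]
    T.frechet_derivative_chart_cong[where f=h and f'=h', OF tc_in[OF c(1)] c(2) W(1,2,4)]
  by (simp add: chart_bracket_def partial_p_def partial_q_def)

lemma chart_bracket_mult:
  assumes c: "c \<in> A" "x \<in> fst (tc c)" and h: "smooth_at TA h x" and k: "smooth_at TA k x"
  shows "chart_bracket (tc c) f (\<lambda>r. h r * k r) x = h x * chart_bracket (tc c) f k x + k x * chart_bracket (tc c) f h x"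
proof -
  let ?i = "chart_inv (tc c)" and ?z = "snd (tc c) x"
  have D: "((h \<circ> ?i) has_derivative frechet_derivative (h \<circ> ?i) (at ?z)) (at ?z)" "((k \<circ> ?i) has_derivative frechet_derivative (k \<circ> ?i) (at ?z)) (at ?z)"
    using T.smooth_at_differentiable[OF h tc_in[OF c(1)] c(2)] T.smooth_at_differentiable[OF k tc_in[OF c(1)] c(2)]
    by (simp_all add: frechet_derivative_works)
  have "((\<lambda>r. h r * k r) \<circ> ?i has_derivative (\<lambda>v. h x * frechet_derivative (k \<circ> ?i) (at ?z) v + frechet_derivative (h \<circ> ?i) (at ?z) v * k x)) (at ?z)"
    using has_derivative_mult[OF D] T.chart_inv_chart[OF tc_in[OF c(1)] c(2)] by (simp add: o_def)
  from frechet_derivative_at[OF this, symmetric] show ?thesis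
    by (simp add: chart_bracket_def partial_p_def partial_q_def sum_distrib_left sum.distrib[symmetric] algebra_simps)
qed

lemma chart_bracket_sum:
  assumes c: "c \<in> A" "x \<in> fst (tc c)" and h: "\<And>i. i \<in> I \<Longrightarrow> smooth_at TA (h i) x"
  shows "chart_bracket (tc c) f (\<lambda>r. \<Sum>i\<in>I. h i r) x = (\<Sum>i\<in>I. chart_bracket (tc c) f (h i) x)"
proof -
  let ?i = "chart_inv (tc c)" and ?z = "snd (tc c) x"
  have D: "((h i \<circ> ?i) has_derivative frechet_derivative (h i \<circ> ?i) (at ?z)) (at ?z)" if "i \<in> I" for i
    using T.smooth_at_differentiable[OF h[OF that] tc_in[OF c(1)] c(2)] by (simp add: frechet_derivative_works)
  have "((\<lambda>r. \<Sum>i\<in>I. h i r) \<circ> ?i has_derivative (\<lambda>v. \<Sum>i\<in>I. frechet_derivative (h i \<circ> ?i) (at ?z) v)) (at ?z)"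
    using has_derivative_sum[OF D] by (simp add: o_def)
  from frechet_derivative_at[OF this, symmetric] show ?thesis
    by (simp add: chart_bracket_def partial_p_def partial_q_def sum_distrib_left sum_distrib_right sum_subtractf[symmetric])
      (rule sum.swap)
qed

section \<open>Coordinate coefficients of vector fields and one-forms\<close>

definition vcoef :: "('a, 'b) chart \<Rightarrow> ('a \<Rightarrow> 'a tvec) \<Rightarrow> 'b \<Rightarrow> 'b" where
  "vcoef c X x = comps c (chart_inv c x) (X (chart_inv c x))"

abbreviation "VF \<equiv> vector_fields A (points A)"

lemma VF_tangent: "X \<in> VF \<Longrightarrow> q \<in> P \<Longrightarrow> X q \<in> tangent_space A q"
  and VF_outside: "X \<in> VF \<Longrightarrow> q \<notin> P \<Longrightarrow> X q = (\<lambda>f. 0)"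
  and VF_smooth: "X \<in> VF \<Longrightarrow> f \<in> C \<Longrightarrow> (\<lambda>q. X q f) \<in> C"
  by (simp_all add: vector_fields_def)

lemma vcoef_chart: "c \<in> A \<Longrightarrow> q \<in> fst c \<Longrightarrow> vcoef c X (snd c q) = comps c q (X q)"
  by (simp add: vcoef_def)

lemma coord_vec_vcoef:
  assumes "X \<in> VF" "c \<in> A" "q \<in> fst c"
  shows "coord_vec A c q (vcoef c X (snd c q)) = X q"
  using VF_tangent[OF assms(1)] chart_dom_subset[OF assms(2)] assms
  by (simp add: vcoef_chart coord_vec_comps subset_iff)

lemma vcoef_coordinate:
  assumes X: "X \<in> VF" and c: "c \<in> A" "q \<in> fst c" and u: "u \<in> C" "openin (mtop A) V" "q \<in> V" "\<And>r. r \<in> V \<Longrightarrow> u r = snd c r \<bullet> b"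
  shows "X q u = vcoef c X (snd c q) \<bullet> b"
  using coord_vec_coordinate[OF c u(2-4) u(1), of "vcoef c X (snd c q)"] by (simp add: coord_vec_vcoef[OF X c])

text \<open>Near each point the components are \<open>X\<close> applied to globally extended
  coordinate functions, for which \<open>vector_fields\<close> provides smoothness.\<close>

lemma vcoef_smooth:
  assumes X: "X \<in> VF" and c: "c \<in> A"
  shows "smooth_on (snd c ` fst c) (vcoef c X)"
proof (rule smooth_on_local)
  fix x assume "x \<in> snd c ` fst c"
  then obtain q where q: "q \<in> fst c" "x = snd c q" by blast
  obtain u V where u: "\<And>b. u b \<in> C" "openin (mtop A) V" "q \<in> V" "V \<subseteq> fst c" "\<And>b r. r \<in> V \<Longrightarrow> u b r = snd c r \<bullet> b"
    by (rule global_coordinates[OF c q(1)]) blast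
  let ?T = "snd c ` (fst c \<inter> V)"
  have T: "open ?T" by (rule openin_mtop_imp_open_image[OF u(2) c])
  have "smooth_on ?T (\<lambda>x. \<Sum>b\<in>Basis. ((\<lambda>r. X r (u b)) \<circ> chart_inv c) x *\<^sub>R b)"
    by (intro smooth_on_sum smooth_on_scaleR smooth_on_const T smooth_on_subset[OF C_smooth_in_chart[OF VF_smooth[OF X u(1)] c]]) auto
  then have "smooth_on ?T (vcoef c X)"
  proof (subst smooth_on_cong[OF T])
    fix x assume "x \<in> ?T"
    then obtain r where r: "r \<in> fst c" "r \<in> V" "x = snd c r" by blast
    have "X r (u b) = vcoef c X (snd c r) \<bullet> b" for b
      by (rule vcoef_coordinate[OF X c r(1) u(1,2) r(2) u(5)])
    then show "vcoef c X x = (\<Sum>b\<in>Basis. ((\<lambda>r. X r (u b)) \<circ> chart_inv c) x *\<^sub>R b)"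
      using c r by (simp add: euclidean_representation)
  qed
  then show "\<exists>T. open T \<and> x \<in> T \<and> smooth_on T (vcoef c X)" using T q u(3) by blast
qed

lemma zero_tangent: "(\<lambda>f. 0) \<in> tangent_space A q"
  by (simp add: tangent_space_iff)

text \<open>Smoothness of forms and metrics is tested on global fields only. Coordinate fields,
  extended by a bump, make this test yield smooth components; they also extend a single tangent
  vector to a field.\<close>

lemma VF_local_constant:
  assumes c: "c \<in> A" "q \<in> fst c"
  obtains X N where "X \<in> VF" "openin (mtop A) N" "q \<in> N" "N \<subseteq> fst c" "\<And>r. r \<in> N \<Longrightarrow> X r = coord_vec A c r w"
proof -
  obtain \<eta> V where \<eta>: "\<eta> \<in> smooth_funs_c A (fst c)" "openin (mtop A) V" "q \<in> V" "V \<subseteq> fst c" "\<And>r. r \<in> V \<Longrightarrow> \<eta> r = 1"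
    by (rule bump_exists[OF openin_chart_dom[OF c(1)] c(2)]) blast
  define X where "X r = (if r \<in> fst c then (\<lambda>f. \<eta> r * coord_vec A c r w f) else (\<lambda>f. 0))" for r
  have "X \<in> VF"
    unfolding vector_fields_def
  proof (intro CollectI conjI ballI allI impI)
    show "X r \<in> tangent_space A r" for r
      using comps_scale(2)[OF c(1) _ coord_vec_tangent[OF c(1)]] zero_tangent by (simp add: X_def)
    show "X r = (\<lambda>f. 0)" if "r \<notin> P" for r
      using that chart_dom_subset[OF c(1)] by (auto simp: X_def)
    fix f assume f: "f \<in> C"
    have "smooth_at A (\<lambda>r. coord_vec A c r w f) r" if "r \<in> fst c" for r
      using that by (intro smooth_at_chartI[OF c(1) that open_chart_range[OF c(1)] _ smooth_on_frechet_derivative[OF C_smooth_in_chart[OF f c(1)], of w]])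
        (simp_all add: coord_vec_eq[OF f])
    from smooth_funs_cD(1)[OF cutoff_smooth_funs_c[OF \<eta>(1) this chart_dom_subset[OF c(1)]]]
    show "(\<lambda>r. X r f) \<in> C" by (simp add: X_def if_distribR cong: if_cong)
  qed
  then show ?thesis by (rule that[OF _ \<eta>(2-4)]) (use \<eta>(4,5) in \<open>auto simp: X_def\<close>)
qed

lemma smooth_at_coord_components:
  assumes c: "c \<in> A" and sm: "\<And>q. q \<in> fst c \<Longrightarrow> smooth_at A f q"
  shows "smooth_on (snd c ` fst c) (f \<circ> chart_inv c)"
proof (rule smooth_on_local)
  fix x assume "x \<in> snd c ` fst c"
  then obtain q where q: "q \<in> fst c" "x = snd c q" by blast
  obtain T where "open T" "snd c q \<in> T" "T \<subseteq> snd c ` fst c" "smooth_on T (f \<circ> chart_inv c)"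
    by (rule smooth_at_in_chart[OF sm[OF q(1)] c q(1)])
  then show "\<exists>T. open T \<and> x \<in> T \<and> smooth_on T (f \<circ> chart_inv c)" using q by blast
qed

lemma one_form_coefficients_smooth:
  assumes \<omega>: "\<omega> \<in> one_forms A" and c: "c \<in> A"
  shows "smooth_on (snd c ` fst c) (\<lambda>x. cocomps c (chart_inv c x) (\<omega> (chart_inv c x)))"
proof -
  have "smooth_at A (\<lambda>q. \<omega> q (coord_vec A c q b)) q" if q: "q \<in> fst c" for q b
  proof -
    obtain X N where X: "X \<in> VF" "openin (mtop A) N" "q \<in> N" "N \<subseteq> fst c" "\<And>r. r \<in> N \<Longrightarrow> X r = coord_vec A c r b"
      by (rule VF_local_constant[OF c q, of b]) blast
    have "(\<lambda>q. \<omega> q (X q)) \<in> C" using \<omega> X(1) unfolding one_forms_def by blast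
    from C_smooth_at[OF this] have "smooth_at A (\<lambda>q. \<omega> q (X q)) q" using q chart_dom_subset[OF c] by blast
    then show ?thesis by (rule smooth_at_cong[OF _ X(2,3)]) (simp add: X(5))
  qed
  from smooth_at_coord_components[OF c this]
  have "smooth_on (snd c ` fst c) (\<lambda>x. \<Sum>b\<in>Basis. ((\<lambda>q. \<omega> q (coord_vec A c q b)) \<circ> chart_inv c) x *\<^sub>R b)"
    by (intro smooth_on_sum smooth_on_scaleR smooth_on_const open_chart_range[OF c])
  then show ?thesis by (simp add: cocomps_def o_def)
qed

lemma fibre_linear_eq:
  assumes X: "X \<in> VF" and c: "c \<in> A" and x: "(q, p) \<in> fst (tc c)"
  shows "fibre_linear A X (q, p) = cocomps c q p \<bullet> vcoef c X (snd c q)"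
proof -
  have q: "q \<in> fst c" "p \<in> cotangent_space A q" "q \<in> P" using x chart_dom_subset[OF c] by (auto simp: fst_tc)
  then show ?thesis
    by (simp add: fibre_linear_def points_TA cotangent_eval[OF c q(1,2) VF_tangent[OF X q(3)]] vcoef_chart[OF c q(1)])
qed

lemma smooth_on_tc_range:
  assumes c: "c \<in> A"
  shows "open (snd c ` fst c \<times> (UNIV :: 'b set))" "snd (tc c) ` fst (tc c) = snd c ` fst c \<times> UNIV"
  using open_Times[OF open_chart_range[OF c] open_UNIV] tc_image[OF c, of "fst c"] by (simp_all add: fst_tc)

lemma smooth_on_base:
  assumes c: "c \<in> A" and f: "smooth_on (snd c ` fst c) f"
  shows "smooth_on (snd c ` fst c \<times> (UNIV :: 'b set)) (\<lambda>z. f (fst z))"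
  by (rule smooth_on_compose[OF smooth_on_tc_range(1)[OF c] f smooth_on_fst[OF smooth_on_tc_range(1)[OF c] smooth_on_ident]]) auto

lemma smooth_on_fibre: "c \<in> A \<Longrightarrow> smooth_on (snd c ` fst c \<times> (UNIV :: 'b set)) snd"
  using smooth_on_linear[OF bounded_linear_snd] .

lemma smooth_funs_TA_I:
  assumes "\<And>c. c \<in> A \<Longrightarrow> smooth_on (snd c ` fst c \<times> UNIV) (F c)"
    and "\<And>c q p. c \<in> A \<Longrightarrow> (q, p) \<in> fst (tc c) \<Longrightarrow> f (q, p) = F c (snd c q, cocomps c q p)"
    and "\<And>x. x \<notin> T.P \<Longrightarrow> f x = 0"
  shows "f \<in> T.C"
  unfolding T.C_iff
proof (intro conjI ballI allI impI)
  fix x assume x: "x \<in> T.P"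
  then obtain c where c: "c \<in> A" "x \<in> fst (tc c)" using in_tc by blast
  show "smooth_at TA f x"
  proof (rule T.smooth_at_chartI[OF tc_in[OF c(1)] c(2) _ _ assms(1)[OF c(1)]])
    show "open (snd c ` fst c \<times> (UNIV :: 'b set))" by (rule smooth_on_tc_range[OF c(1)])
    show "snd (tc c) x \<in> snd c ` fst c \<times> UNIV" using smooth_on_tc_range(2)[OF c(1)] c(2) by blast
    fix r assume "r \<in> fst (tc c)"
    then show "f r = F c (snd (tc c) r)" using assms(2)[OF c(1), of "fst r" "snd r"] snd_tc[of c "fst r" "snd r"] by simp
  qed
qed (rule assms(3))

lemma fibre_linear_smooth:
  assumes X: "X \<in> VF"
  shows "fibre_linear A X \<in> T.C"
proof (rule smooth_funs_TA_I)
  show "smooth_on (snd c ` fst c \<times> UNIV) (\<lambda>z. snd z \<bullet> vcoef c X (fst z))" if c: "c \<in> A" for c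
    by (intro smooth_on_inner smooth_on_tc_range[OF c] smooth_on_fibre[OF c] smooth_on_base[OF c vcoef_smooth[OF X c]])
  show "fibre_linear A X (q, p) = snd (snd c q, cocomps c q p) \<bullet> vcoef c X (fst (snd c q, cocomps c q p))"
    if "c \<in> A" "(q, p) \<in> fst (tc c)" for c q p
    using fibre_linear_eq[OF X that] by simp
qed (auto simp: fibre_linear_def)

end

section \<open>Riemannian metrics in coordinates\<close>

text \<open>The Leibniz rule for a linear map and a vector that both vary with the point. The second
  summand is the derivative with the vector frozen at \<open>f x\<close>.\<close>

lemma has_derivative_family_apply:
  fixes G :: "'a::euclidean_space \<Rightarrow> 'b::euclidean_space \<Rightarrow> 'c::real_normed_vector"
  assumes S: "open S" "x \<in> S" and lin: "\<And>x. x \<in> S \<Longrightarrow> linear (G x)"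
    and smooth: "\<And>w. smooth_on S (\<lambda>x. G x w)" and f: "(f has_derivative f') (at x)"
  shows "((\<lambda>x. G x (f x)) has_derivative (\<lambda>u. G x (f' u) + frechet_derivative (\<lambda>y. G y (f x)) (at x) u)) (at x)"
proof -
  let ?D = "\<lambda>b u. frechet_derivative (\<lambda>y. G y b) (at x) u"
  have main: "((\<lambda>y. G y (h y)) has_derivative (\<lambda>u. G x (h' u) + (\<Sum>b\<in>Basis. (h x \<bullet> b) *\<^sub>R ?D b u))) (at x)"
    if h: "(h has_derivative h') (at x)" for h h'
  proof -
    have "((\<lambda>y. (h y \<bullet> b) *\<^sub>R G y b) has_derivative (\<lambda>u. (h x \<bullet> b) *\<^sub>R ?D b u + (h' u \<bullet> b) *\<^sub>R G x b)) (at x)" for b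
      by (rule has_derivative_scaleR[OF has_derivative_inner_left[OF h] smooth_on_has_derivative[OF smooth S(2)]])
    then have "((\<lambda>y. \<Sum>b\<in>Basis. (h y \<bullet> b) *\<^sub>R G y b) has_derivative
        (\<lambda>u. \<Sum>b\<in>Basis. (h x \<bullet> b) *\<^sub>R ?D b u + (h' u \<bullet> b) *\<^sub>R G x b)) (at x)"
      by (rule has_derivative_sum)
    then have "((\<lambda>y. G y (h y)) has_derivative (\<lambda>u. \<Sum>b\<in>Basis. (h x \<bullet> b) *\<^sub>R ?D b u + (h' u \<bullet> b) *\<^sub>R G x b)) (at x)"
      by (rule has_derivative_transform_within_open[OF _ S]) (rule linear_basis_expansion[OF lin, symmetric])
    moreover have "(\<Sum>b\<in>Basis. (h x \<bullet> b) *\<^sub>R ?D b u + (h' u \<bullet> b) *\<^sub>R G x b) = G x (h' u) + (\<Sum>b\<in>Basis. (h x \<bullet> b) *\<^sub>R ?D b u)" for u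
      unfolding linear_basis_expansion[OF lin[OF S(2)], of "h' u"] by (simp add: sum.distrib)
    ultimately show ?thesis by simp
  qed
  from frechet_derivative_at[OF main[OF has_derivative_const[of "f x"]]]
  have "?D (f x) u = (\<Sum>b\<in>Basis. (f x \<bullet> b) *\<^sub>R ?D b u)" for u
    using linear_0[OF lin[OF S(2)]] by (auto dest: fun_cong[of _ _ u])
  with main[OF f] show ?thesis by simp
qed

locale riemannian_mfd = smooth_mfd +
  fixes g :: "'a \<Rightarrow> 'a tvec \<Rightarrow> 'a tvec \<Rightarrow> real"
  assumes metric: "riemannian_metric A g"
begin

interpretation T: smooth_mfd TA by (rule smooth_mfd_TA)

lemma g_outside: "q \<notin> P \<or> v \<notin> tangent_space A q \<Longrightarrow> g q v w = 0"
  using metric unfolding riemannian_metric_def by blast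

lemma g_sym: "g q v w = g q w v"
  using metric unfolding riemannian_metric_def by blast

lemma g_cotangent: "q \<in> P \<Longrightarrow> v \<in> tangent_space A q \<Longrightarrow> g q v \<in> cotangent_space A q"
  using metric unfolding riemannian_metric_def by blast

lemma g_pos: "q \<in> P \<Longrightarrow> v \<in> tangent_space A q \<Longrightarrow> v \<noteq> (\<lambda>f. 0) \<Longrightarrow> g q v v > 0"
  using metric unfolding riemannian_metric_def by blast

lemma g_smooth: "X \<in> VF \<Longrightarrow> Y \<in> VF \<Longrightarrow> (\<lambda>q. g q (X q) (Y q)) \<in> C"
  using metric unfolding riemannian_metric_def by blast

definition gram :: "('a, 'b) chart \<Rightarrow> 'b \<Rightarrow> 'b \<Rightarrow> 'b" where
  "gram c x w = cocomps c (chart_inv c x) (g (chart_inv c x) (coord_vec A c (chart_inv c x) w))"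

lemma gram_chart: "c \<in> A \<Longrightarrow> q \<in> fst c \<Longrightarrow> gram c (snd c q) w = cocomps c q (g q (coord_vec A c q w))"
  by (simp add: gram_def)

lemma cocomps_g:
  assumes "c \<in> A" "q \<in> fst c" "v \<in> tangent_space A q"
  shows "cocomps c q (g q v) = gram c (snd c q) (comps c q v)"
  using assms by (simp add: gram_chart coord_vec_comps)

lemma g_coord_vec:
  assumes c: "c \<in> A" "q \<in> fst c"
  shows "g q (coord_vec A c q u) (coord_vec A c q w) = gram c (snd c q) u \<bullet> w"
  using cotangent_coord_vec[OF c g_cotangent[OF _ coord_vec_tangent[OF c]]] chart_dom_subset[OF c(1)] c
  by (auto simp: gram_chart)

lemma g_comps:
  assumes c: "c \<in> A" "q \<in> fst c" and v: "v \<in> tangent_space A q" "w \<in> tangent_space A q"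
  shows "g q v w = gram c (snd c q) (comps c q v) \<bullet> comps c q w"
  using g_coord_vec[OF c, of "comps c q v" "comps c q w"] by (simp add: coord_vec_comps[OF c] v)

lemma gram_sym:
  assumes c: "c \<in> A" and x: "x \<in> snd c ` fst c"
  shows "gram c x u \<bullet> w = gram c x w \<bullet> u"
proof -
  obtain q where q: "q \<in> fst c" "x = snd c q" using x by blast
  show ?thesis unfolding q(2) g_coord_vec[OF c q(1), symmetric] by (rule g_sym)
qed

text \<open>A map that is symmetric with respect to the inner product is linear:
  \<open>u + v\<close> is moved to the other slot, where the inner product is additive.\<close>

lemma gram_linear:
  assumes c: "c \<in> A" and x: "x \<in> snd c ` fst c"
  shows "linear (gram c x)"
proof (rule linearI)
  fix u v :: 'b and a :: real
  have *: "gram c x w \<bullet> z = gram c x z \<bullet> w" for w z by (rule gram_sym[OF c x])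
  have "gram c x (u + v) \<bullet> z = (gram c x u + gram c x v) \<bullet> z" for z
    unfolding inner_add_left *[of _ z] inner_add_right ..
  then show "gram c x (u + v) = gram c x u + gram c x v" using vector_eq_rdot by blast
  have "gram c x (a *\<^sub>R u) \<bullet> z = (a *\<^sub>R gram c x u) \<bullet> z" for z
    unfolding inner_scaleR_left *[of _ z] inner_scaleR_right ..
  then show "gram c x (a *\<^sub>R u) = a *\<^sub>R gram c x u" using vector_eq_rdot by blast
qed

lemma gram_smooth:
  assumes c: "c \<in> A"
  shows "smooth_on (snd c ` fst c) (\<lambda>x. gram c x w)"
proof -
  have "smooth_at A (\<lambda>q. g q (coord_vec A c q w) (coord_vec A c q b)) q" if q: "q \<in> fst c" for q b
  proof -
    obtain X N where X: "X \<in> VF" "openin (mtop A) N" "q \<in> N" "N \<subseteq> fst c" "\<And>r. r \<in> N \<Longrightarrow> X r = coord_vec A c r w"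
      by (rule VF_local_constant[OF c q, of w]) blast
    obtain Y M where Y: "Y \<in> VF" "openin (mtop A) M" "q \<in> M" "M \<subseteq> fst c" "\<And>r. r \<in> M \<Longrightarrow> Y r = coord_vec A c r b"
      by (rule VF_local_constant[OF c q, of b]) blast
    have "smooth_at A (\<lambda>q. g q (X q) (Y q)) q"
      using C_smooth_at[OF g_smooth[OF X(1) Y(1)]] q chart_dom_subset[OF c] by blast
    then show ?thesis
      by (rule smooth_at_cong[OF _ openin_Int[OF X(2) Y(2)]]) (use X Y in auto)
  qed
  from smooth_at_coord_components[OF c this]
  have "smooth_on (snd c ` fst c) (\<lambda>x. \<Sum>b\<in>Basis. ((\<lambda>q. g q (coord_vec A c q w) (coord_vec A c q b)) \<circ> chart_inv c) x *\<^sub>R b)"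
    by (intro smooth_on_sum smooth_on_scaleR smooth_on_const open_chart_range[OF c])
  then show ?thesis by (simp add: cocomps_def gram_def o_def)
qed

text \<open>Positive definiteness gives injectivity, and finite dimension then gives
  surjectivity.\<close>

lemma gram_inverse:
  assumes c: "c \<in> A" and x: "x \<in> snd c ` fst c"
  shows "inv (gram c x) (gram c x w) = w" "gram c x (inv (gram c x) w) = w"
proof -
  obtain q where q: "q \<in> fst c" "x = snd c q" using x by blast
  have "inj (gram c x)"
    unfolding linear_injective_0[OF gram_linear[OF c x]]
  proof (intro allI impI, rule ccontr)
    fix w assume w: "gram c x w = 0" "w \<noteq> 0"
    have "coord_vec A c q w \<noteq> (\<lambda>f. 0)"
      using coord_vec_inj[OF c q(1), of w 0] w(2) coord_vec_zero[OF c q(1)] by metis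
    then have "g q (coord_vec A c q w) (coord_vec A c q w) > 0"
      using g_pos[OF _ coord_vec_tangent[OF c q(1)]] chart_dom_subset[OF c] q(1) by blast
    then show False using g_coord_vec[OF c q(1), of w w] w(1) q(2) by simp
  qed
  moreover from this have "surj (gram c x)" by (rule linear_injective_imp_surjective[OF gram_linear[OF c x]]) simp
  ultimately show "inv (gram c x) (gram c x w) = w" "gram c x (inv (gram c x) w) = w"
    by (simp_all add: surj_f_inv_f)
qed

lemma gram_inverse_linear:
  assumes c: "c \<in> A" and x: "x \<in> snd c ` fst c"
  shows "linear (inv (gram c x))"
proof (rule linearI)
  note G = gram_inverse[OF c x] and lin = gram_linear[OF c x]
  fix a b :: 'b and r :: real
  show "inv (gram c x) (a + b) = inv (gram c x) a + inv (gram c x) b"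
    using G(1)[of "inv (gram c x) a + inv (gram c x) b"] by (simp add: linear_add[OF lin] G(2))
  show "inv (gram c x) (r *\<^sub>R a) = r *\<^sub>R inv (gram c x) a"
    using G(1)[of "r *\<^sub>R inv (gram c x) a"] by (simp add: linear_cmul[OF lin] G(2))
qed

lemma gram_inverse_smooth: "c \<in> A \<Longrightarrow> smooth_on (snd c ` fst c) (\<lambda>x. inv (gram c x) w)"
  by (rule smooth_on_inverse_family[OF open_chart_range gram_linear gram_smooth]) (simp_all add: gram_inverse)

definition sharp :: "'a \<Rightarrow> 'a covec \<Rightarrow> 'a tvec" where
  "sharp q p = inv_into (tangent_space A q) (g q) p"

lemma g_sharp:
  assumes c: "c \<in> A" "q \<in> fst c" and p: "p \<in> cotangent_space A q"
  shows "sharp q p \<in> tangent_space A q" "g q (sharp q p) = p" "comps c q (sharp q p) = inv (gram c (snd c q)) (cocomps c q p)"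
proof -
  have x: "snd c q \<in> snd c ` fst c" and qP: "q \<in> P" using c chart_dom_subset[OF c(1)] by auto
  \<comment> \<open>An explicit preimage of \<open>p\<close>. It shows that \<open>p\<close> is in
    the range of \<open>g q\<close> on the tangent space, so that \<open>inv_into\<close> in
    \<open>sharp\<close> returns a genuine preimage.\<close>
  let ?w = "inv (gram c (snd c q)) (cocomps c q p)"
  have "cocomps c q (g q (coord_vec A c q ?w)) = cocomps c q p"
    by (simp add: gram_chart[OF c, symmetric] gram_inverse[OF c(1) x])
  then have "g q (coord_vec A c q ?w) = p"
    using covec_cocomps[OF c g_cotangent[OF qP coord_vec_tangent[OF c]]] covec_cocomps[OF c p] by metis
  then have "p \<in> g q ` tangent_space A q" by (rule image_eqI[OF sym coord_vec_tangent[OF c]])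
  then show 1: "sharp q p \<in> tangent_space A q" "g q (sharp q p) = p"
    unfolding sharp_def by (rule inv_into_into, rule f_inv_into_f)
  show "comps c q (sharp q p) = ?w"
    using cocomps_g[OF c 1(1)] gram_inverse(1)[OF c(1) x, of "comps c q (sharp q p)"] by (simp add: 1(2))
qed

lemma hamiltonian_eq:
  assumes c: "c \<in> A" and x: "(q, p) \<in> fst (tc c)"
  shows "hamiltonian A g (q, p) = (cocomps c q p \<bullet> inv (gram c (snd c q)) (cocomps c q p)) / 2"
proof -
  have q: "q \<in> fst c" "p \<in> cotangent_space A q" "q \<in> P" using x chart_dom_subset[OF c] by (auto simp: fst_tc)
  show ?thesis
    using cotangent_eval[OF c q(1,2) g_sharp(1)[OF c q(1,2)]] g_sharp(3)[OF c q(1,2)] q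
    by (simp add: hamiltonian_def points_TA sharp_def)
qed

lemma smooth_on_gram_inverse_fibre:
  assumes c: "c \<in> A"
  shows "smooth_on (snd c ` fst c \<times> UNIV) (\<lambda>z. inv (gram c (fst z)) (snd z))"
proof -
  note o = smooth_on_tc_range(1)[OF c]
  have "smooth_on (snd c ` fst c \<times> UNIV) (\<lambda>z. \<Sum>b\<in>Basis. (snd z \<bullet> b) *\<^sub>R inv (gram c (fst z)) b)"
    by (intro smooth_on_sum smooth_on_scaleR smooth_on_inner o smooth_on_fibre[OF c] smooth_on_const smooth_on_base[OF c gram_inverse_smooth[OF c]])
  then show ?thesis
    by (subst smooth_on_cong[OF o]) (use linear_basis_expansion[OF gram_inverse_linear[OF c]] in auto)
qed

lemma hamiltonian_smooth: "hamiltonian A g \<in> T.C"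
proof (rule smooth_funs_TA_I)
  show "smooth_on (snd c ` fst c \<times> UNIV) (\<lambda>z. (snd z \<bullet> inv (gram c (fst z)) (snd z)) / 2)" if c: "c \<in> A" for c
    by (intro smooth_on_divide smooth_on_inner smooth_on_tc_range[OF c] smooth_on_fibre[OF c] smooth_on_gram_inverse_fibre[OF c] smooth_on_const) simp
next
  show "hamiltonian A g (q, p) = (snd (snd c q, cocomps c q p) \<bullet> inv (gram c (fst (snd c q, cocomps c q p))) (snd (snd c q, cocomps c q p))) / 2"
    if "c \<in> A" "(q, p) \<in> fst (tc c)" for c q p
    using hamiltonian_eq[OF that] by simp
qed (auto simp: hamiltonian_def)

text \<open>The coordinate formula \<open>X^k \<partial>_k g_ij + g_kj \<partial>_i X^k + g_ik
  \<partial>_j X^k\<close> for \<open>L_X g\<close>. Unlike \<open>lie_deriv_metric\<close> it takes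
  vectors rather than fields, so it exhibits the tensor.\<close>

definition lie_form :: "('a, 'b) chart \<Rightarrow> ('a \<Rightarrow> 'a tvec) \<Rightarrow> 'b \<Rightarrow> 'b \<Rightarrow> 'b \<Rightarrow> real" where
  "lie_form c X x v w = frechet_derivative (\<lambda>y. gram c y v) (at x) (vcoef c X x) \<bullet> w
     + gram c x w \<bullet> frechet_derivative (vcoef c X) (at x) v
     + gram c x v \<bullet> frechet_derivative (vcoef c X) (at x) w"

text \<open>At the covector of \<open>v\<close> the fibre derivative of \<open>H_g\<close> is the
  velocity \<open>w\<close> and its base derivative is minus half that of \<open>g(w, w)\<close>
  with \<open>w\<close> fixed. Paired with the derivatives of \<open>p \<bullet> X\<close>, these
  give the terms of \<open>lie_form\<close> on the diagonal.\<close>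

lemma chart_bracket_hamiltonian:
  assumes X: "X \<in> VF" and c: "c \<in> A" "q \<in> fst c" and v: "v \<in> tangent_space A q"
  shows "chart_bracket (tc c) (hamiltonian A g) (fibre_linear A X) (q, g q v) =
    lie_form c X (snd c q) (comps c q v) (comps c q v) / 2"
proof -
  define x w y where "x = snd c q" and "w = comps c q v" and "y = gram c x w"
  let ?S = "snd c ` fst c"
  have xS: "x \<in> ?S" and qP: "q \<in> P" using c chart_dom_subset[OF c(1)] by (auto simp: x_def)
  note S = open_chart_range[OF c(1)]
  note o = smooth_on_tc_range(1)[OF c(1)]
  have tc: "(q, g q v) \<in> fst (tc c)" using c g_cotangent[OF qP v] by (simp add: fst_tc)
  have z: "snd (tc c) (q, g q v) = (x, y)" by (simp add: snd_tc cocomps_g[OF c v] x_def w_def y_def)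
  let ?K = "\<lambda>z. (snd z \<bullet> inv (gram c (fst z)) (snd z)) / 2"
  let ?L = "\<lambda>z. snd z \<bullet> vcoef c X (fst z)"
  have ext: "((f \<circ> chart_inv (tc c)) has_derivative D) (at (x, y))"
    if F: "(F has_derivative D) (at (x, y))" and eq: "\<And>q p. (q, p) \<in> fst (tc c) \<Longrightarrow> f (q, p) = F (snd c q, cocomps c q p)"
    for f :: "'a \<times> 'a covec \<Rightarrow> real" and F D
  proof (rule T.local_chart_derivative[where f=f and F=F and D=D, OF tc_in[OF c(1)] tc T.openin_chart_dom[OF tc_in[OF c(1)]] tc, unfolded z, OF _ F])
    show "f r = F (snd (tc c) r)" if "r \<in> fst (tc c)" for r
      using that eq[of "fst r" "snd r"] snd_tc[of c "fst r" "snd r"] by simp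
  qed
  have Ksm: "smooth_on (?S \<times> UNIV) ?K"
    by (intro smooth_on_divide smooth_on_inner o smooth_on_fibre[OF c(1)] smooth_on_gram_inverse_fibre[OF c(1)] smooth_on_const) simp
  have xy: "(x, y) \<in> ?S \<times> UNIV" using xS by simp
  let ?K' = "frechet_derivative ?K (at (x, y))"
  have K': "(?K has_derivative ?K') (at (x, y))" by (rule smooth_on_has_derivative[OF Ksm xy])
  have Hd: "frechet_derivative (hamiltonian A g \<circ> chart_inv (tc c)) (at (snd (tc c) (q, g q v))) = ?K'"
    unfolding z by (rule frechet_derivative_at[symmetric], rule ext[OF K']) (simp add: hamiltonian_eq[OF c(1)])
  let ?\<xi> = "vcoef c X"
  let ?\<xi>' = "frechet_derivative ?\<xi> (at x)"
  have \<xi>': "(?\<xi> has_derivative ?\<xi>') (at x)" by (rule smooth_on_has_derivative[OF vcoef_smooth[OF X c(1)] xS])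
  have \<xi>fst: "((\<lambda>z. ?\<xi> (fst z)) has_derivative (\<lambda>z. ?\<xi>' (fst z))) (at (x, y))"
    by (rule has_derivative_compose[where f = fst and g = "?\<xi>"]) (use \<xi>' in \<open>auto intro!: bounded_linear_imp_has_derivative bounded_linear_fst\<close>)
  have snd': "(snd has_derivative snd) (at (x, y))" by (rule bounded_linear_imp_has_derivative[OF bounded_linear_snd])
  have L': "(?L has_derivative (\<lambda>z. y \<bullet> ?\<xi>' (fst z) + snd z \<bullet> ?\<xi> x)) (at (x, y))"
    using has_derivative_inner[OF snd' \<xi>fst] by simp
  have Ld: "frechet_derivative (fibre_linear A X \<circ> chart_inv (tc c)) (at (snd (tc c) (q, g q v))) = (\<lambda>z. y \<bullet> ?\<xi>' (fst z) + snd z \<bullet> ?\<xi> x)"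
    unfolding z by (rule frechet_derivative_at[symmetric], rule ext[OF L']) (simp add: fibre_linear_eq[OF X c(1)])
  note lin\<xi> = has_derivative_linear[OF \<xi>'] and linK = has_derivative_linear[OF K']
  let ?G' = "frechet_derivative (\<lambda>x. gram c x w) (at x)"
  have G': "((\<lambda>x. gram c x w) has_derivative ?G') (at x)" by (rule smooth_on_has_derivative[OF gram_smooth[OF c(1)] xS])
  have Kw: "inv (gram c x) y = w" by (simp add: y_def gram_inverse[OF c(1) xS])
  \<comment> \<open>A quadratic form in the momentum: its derivative has two halves, equal because
    the inverse Gram map is symmetric.\<close>
  have Kp: "?K' (0, b) = b \<bullet> w" for b
  proof -
    have "((\<lambda>t. (x, t)) has_derivative (\<lambda>t. (0, t))) (at y)"
      by (auto intro!: derivative_eq_intros)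
    from has_derivative_compose[where f = "\<lambda>t. (x, t)" and g = ?K, OF this K']
    have 1: "((\<lambda>t. (t \<bullet> inv (gram c x) t) / 2) has_derivative (\<lambda>t. ?K' (0, t))) (at y)" by simp
    have "bounded_linear (inv (gram c x))"
      using gram_inverse_linear[OF c(1) xS] by (simp add: linear_conv_bounded_linear)
    then have "(inv (gram c x) has_derivative inv (gram c x)) (at y)" by (rule bounded_linear_imp_has_derivative)
    from bounded_linear.has_derivative[OF bounded_linear_divide has_derivative_inner[OF has_derivative_ident this], of 2]
    have "((\<lambda>t. (t \<bullet> inv (gram c x) t) / 2) has_derivative (\<lambda>t. (y \<bullet> inv (gram c x) t + t \<bullet> inv (gram c x) y) / 2)) (at y)" .
    from has_derivative_unique[OF 1 this] have "?K' (0, b) = (y \<bullet> inv (gram c x) b + b \<bullet> w) / 2"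
      by (simp add: Kw fun_eq_iff)
    moreover have "y \<bullet> inv (gram c x) b = b \<bullet> w"
      using gram_sym[OF c(1) xS, of w "inv (gram c x) b"] by (simp add: y_def gram_inverse[OF c(1) xS])
    ultimately show ?thesis by simp
  qed
  \<comment> \<open>This avoids differentiating the inverse Gram map: along
    \<open>s \<mapsto> (s, gram c s w)\<close> the Hamiltonian is simply
    \<open>gram c s w \<bullet> w / 2\<close>. The known fibre part \<open>Kp\<close> is then
    subtracted.\<close>
  have Kq: "?K' (u, 0) = - (?G' u \<bullet> w) / 2" for u
  proof -
    have "((\<lambda>s. (s, gram c s w)) has_derivative (\<lambda>u. (u, ?G' u))) (at x)"
      by (rule has_derivative_Pair[OF has_derivative_ident G'])
    from has_derivative_compose[where f = "\<lambda>s. (s, gram c s w)" and g = ?K, OF this] K'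
    have "((\<lambda>s. (gram c s w \<bullet> inv (gram c s) (gram c s w)) / 2) has_derivative (\<lambda>u. ?K' (u, ?G' u))) (at x)" by (simp add: y_def)
    then have 1: "((\<lambda>s. (gram c s w \<bullet> w) / 2) has_derivative (\<lambda>u. ?K' (u, ?G' u))) (at x)"
      by (rule has_derivative_transform_within_open[OF _ S xS]) (simp add: gram_inverse[OF c(1)])
    have "((\<lambda>s. (gram c s w \<bullet> w) / 2) has_derivative (\<lambda>u. (?G' u \<bullet> w) / 2)) (at x)"
      using bounded_linear.has_derivative[OF bounded_linear_divide has_derivative_inner_left[OF G']] .
    from has_derivative_unique[OF 1 this] have "?K' (u, ?G' u) = (?G' u \<bullet> w) / 2" by (simp add: fun_eq_iff)
    moreover have "?K' (u, ?G' u) = ?K' (u, 0) + ?K' (0, ?G' u)"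
      using linear_add[OF linK, of "(u, 0)" "(0, ?G' u)"] by simp
    ultimately show ?thesis by (simp add: Kp)
  qed
  have "chart_bracket (tc c) (hamiltonian A g) (fibre_linear A X) (q, g q v) =
      (\<Sum>b\<in>Basis. (b \<bullet> w) * (y \<bullet> ?\<xi>' b)) - (\<Sum>b\<in>Basis. ?K' (b, 0) * (b \<bullet> ?\<xi> x))"
    by (simp add: chart_bracket_def partial_p_def partial_q_def Hd Ld Kp linear_0[OF lin\<xi>] sum_subtractf)
  also have "(\<Sum>b\<in>Basis. (b \<bullet> w) * (y \<bullet> ?\<xi>' b)) = y \<bullet> ?\<xi>' w"
    by (subst (2) linear_basis_expansion[OF lin\<xi>]) (simp add: inner_sum_right inner_commute)
  also have "(\<Sum>b\<in>Basis. ?K' (b, 0) * (b \<bullet> ?\<xi> x)) = ?K' (?\<xi> x, 0)"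
  proof -
    have "linear (\<lambda>u. ?K' (u, 0))" using linear_compose[OF linearI[of "\<lambda>u. (u, 0)"] linK] by (simp add: o_def)
    from linear_basis_expansion[OF this, of "?\<xi> x"] show ?thesis by (simp add: inner_commute mult.commute)
  qed
  also have "y \<bullet> ?\<xi>' w - ?K' (?\<xi> x, 0) = lie_form c X x w w / 2"
    using Kq[of "?\<xi> x"] by (simp add: lie_form_def y_def)
  finally show ?thesis by (simp add: x_def w_def)
qed

section \<open>The Lie derivative of the metric in coordinates\<close>

lemma VF_apply:
  assumes X: "X \<in> VF" and c: "c \<in> A" "q \<in> fst c" and f: "f \<in> C"
    and V: "openin (mtop A) V" "q \<in> V" "\<And>r. r \<in> V \<Longrightarrow> f r = F (snd c r)" and F: "(F has_derivative D) (at (snd c q))"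
  shows "X q f = D (vcoef c X (snd c q))"
  using coord_vec_eqI[OF f local_chart_derivative[where f=f and F=F and D=D, OF c V F], of "vcoef c X (snd c q)"]
  by (simp add: coord_vec_vcoef[OF X c])

text \<open>In the Leibniz rule the mixed products of first derivatives are symmetric in
  \<open>X\<close> and \<open>V\<close> and cancel in the commutator.\<close>

lemma lie_bracket_tangent:
  assumes X: "X \<in> VF" and V: "V \<in> VF" and q: "q \<in> P"
  shows "lie_bracket X V q \<in> tangent_space A q"
proof -
  note Xq = VF_tangent[OF X q] and Vq = VF_tangent[OF V q]
  have zero: "Y r f = 0" if "Y \<in> VF" "f \<notin> C" for Y r f
    using that VF_tangent[OF that(1), of r] VF_outside[OF that(1), of r] tangent_outside[of "Y r" r f] by (cases "r \<in> P") auto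
  \<comment> \<open>A tangent vector acts on a function as a whole, so these identities are needed
    at every \<open>r\<close>, also off the manifold, where fields are zero.\<close>
  have add: "(\<lambda>r. Y r (\<lambda>s. f s + h s)) = (\<lambda>r. Y r f + Y r h)" if "Y \<in> VF" "f \<in> C" "h \<in> C" for Y f h
  proof
    fix r show "Y r (\<lambda>s. f s + h s) = Y r f + Y r h"
      using tangent_add[OF VF_tangent[OF that(1)] that(2,3)] VF_outside[OF that(1)] by (cases "r \<in> P") auto
  qed
  have scale: "(\<lambda>r. Y r (\<lambda>s. a * f s)) = (\<lambda>r. a * Y r f)" if "Y \<in> VF" "f \<in> C" for Y f a
  proof
    fix r show "Y r (\<lambda>s. a * f s) = a * Y r f"
      using tangent_scale[OF VF_tangent[OF that(1)] that(2)] VF_outside[OF that(1)] by (cases "r \<in> P") auto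
  qed
  have mult: "(\<lambda>r. Y r (\<lambda>s. f s * h s)) = (\<lambda>r. f r * Y r h + h r * Y r f)" if "Y \<in> VF" "f \<in> C" "h \<in> C" for Y f h
  proof
    fix r show "Y r (\<lambda>s. f s * h s) = f r * Y r h + h r * Y r f"
      using tangent_mult[OF VF_tangent[OF that(1)] that(2,3)] VF_outside[OF that(1)] by (cases "r \<in> P") auto
  qed
  show ?thesis
    unfolding tangent_space_iff lie_bracket_def
  proof (intro conjI ballI allI impI)
    fix f assume "f \<notin> C"
    then show "X q (\<lambda>r. V r f) - V q (\<lambda>r. X r f) = 0"
      using zero[OF X] zero[OF V] tangent_zero[OF Xq] tangent_zero[OF Vq] by simp
  next
    fix f h a assume f: "f \<in> C" and h: "h \<in> C"
    note s = VF_smooth[OF X f] VF_smooth[OF X h] VF_smooth[OF V f] VF_smooth[OF V h]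
    show "X q (\<lambda>r. V r (\<lambda>r. f r + h r)) - V q (\<lambda>r. X r (\<lambda>r. f r + h r)) =
        X q (\<lambda>r. V r f) - V q (\<lambda>r. X r f) + (X q (\<lambda>r. V r h) - V q (\<lambda>r. X r h))"
      unfolding add[OF X f h] add[OF V f h] by (simp add: tangent_add[OF Xq s(3,4)] tangent_add[OF Vq s(1,2)])
    show "X q (\<lambda>r. V r (\<lambda>r. a * f r)) - V q (\<lambda>r. X r (\<lambda>r. a * f r)) = a * (X q (\<lambda>r. V r f) - V q (\<lambda>r. X r f))"
      unfolding scale[OF X f] scale[OF V f] by (simp add: tangent_scale[OF Xq s(3)] tangent_scale[OF Vq s(1)] right_diff_distrib)
    show "X q (\<lambda>r. V r (\<lambda>r. f r * h r)) - V q (\<lambda>r. X r (\<lambda>r. f r * h r)) =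
        f q * (X q (\<lambda>r. V r h) - V q (\<lambda>r. X r h)) + h q * (X q (\<lambda>r. V r f) - V q (\<lambda>r. X r f))"
      unfolding mult[OF X f h] mult[OF V f h]
        tangent_add[OF Xq C_mult[OF f s(4)] C_mult[OF h s(3)]] tangent_add[OF Vq C_mult[OF f s(2)] C_mult[OF h s(1)]]
        tangent_mult[OF Xq f s(4)] tangent_mult[OF Xq h s(3)] tangent_mult[OF Vq f s(2)] tangent_mult[OF Vq h s(1)]
      by (simp add: algebra_simps)
  qed
qed

lemma vcoef_has_derivative:
  assumes X: "X \<in> VF" and c: "c \<in> A" "q \<in> fst c"
  shows "(vcoef c X has_derivative frechet_derivative (vcoef c X) (at (snd c q))) (at (snd c q))"
  using c by (intro smooth_on_has_derivative[OF vcoef_smooth[OF X c(1)]]) auto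

text \<open>Both sides are tested on globally extended coordinates: a field applied to one of them
  gives a component of the field, and a second field differentiates that component.\<close>

lemma comps_lie_bracket:
  assumes X: "X \<in> VF" and V: "V \<in> VF" and c: "c \<in> A" "q \<in> fst c"
  shows "comps c q (lie_bracket X V q) =
    frechet_derivative (vcoef c V) (at (snd c q)) (vcoef c X (snd c q)) - frechet_derivative (vcoef c X) (at (snd c q)) (vcoef c V (snd c q))"
proof (rule euclidean_eqI)
  fix b :: 'b
  have qP: "q \<in> P" using chart_dom_subset[OF c(1)] c(2) by blast
  obtain u N where u: "\<And>b. u b \<in> C" "openin (mtop A) N" "q \<in> N" "N \<subseteq> fst c" "\<And>b r. r \<in> N \<Longrightarrow> u b r = snd c r \<bullet> b"
    by (rule global_coordinates[OF c]) blast
  have one: "Y q (\<lambda>r. Z r (u b)) = frechet_derivative (vcoef c Z) (at (snd c q)) (vcoef c Y (snd c q)) \<bullet> b"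
    if Y: "Y \<in> VF" and Z: "Z \<in> VF" for Y Z
  proof (rule VF_apply[OF Y c VF_smooth[OF Z u(1)] u(2,3)])
    show "Z r (u b) = vcoef c Z (snd c r) \<bullet> b" if "r \<in> N" for r
      using that u(4) by (intro vcoef_coordinate[OF Z c(1) _ u(1,2) that u(5)]) auto
    show "((\<lambda>x. vcoef c Z x \<bullet> b) has_derivative (\<lambda>w. frechet_derivative (vcoef c Z) (at (snd c q)) w \<bullet> b)) (at (snd c q))"
      by (rule has_derivative_inner_left[OF vcoef_has_derivative[OF Z c]])
  qed
  let ?w = "comps c q (lie_bracket X V q)"
  have "?w \<bullet> b = coord_vec A c q ?w (u b)"
    by (rule coord_vec_coordinate[OF c u(2,3,5) u(1), symmetric])
  also have "\<dots> = lie_bracket X V q (u b)" by (simp add: coord_vec_comps[OF c lie_bracket_tangent[OF X V qP]])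
  also have "\<dots> = (frechet_derivative (vcoef c V) (at (snd c q)) (vcoef c X (snd c q)) - frechet_derivative (vcoef c X) (at (snd c q)) (vcoef c V (snd c q))) \<bullet> b"
    by (simp add: lie_bracket_def one X V inner_diff_left)
  finally show "?w \<bullet> b = \<dots>" .
qed

text \<open>The derivatives of \<open>V\<close> and \<open>W\<close> that come from
  \<open>X (g(V, W))\<close> cancel against those in the two Lie brackets, by symmetry of the Gram
  map. What remains depends on the values of \<open>V\<close> and \<open>W\<close> at
  \<open>q\<close> only.\<close>

lemma lie_deriv_metric_eq_lie_form:
  assumes X: "X \<in> VF" and V: "V \<in> VF" and W: "W \<in> VF" and c: "c \<in> A" "q \<in> fst c"
  shows "lie_deriv_metric X g V W q = lie_form c X (snd c q) (comps c q (V q)) (comps c q (W q))"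
proof -
  let ?x = "snd c q"
  let ?D = "\<lambda>Z. frechet_derivative (vcoef c Z) (at ?x)"
  let ?\<xi> = "vcoef c X ?x" and ?v = "vcoef c V ?x" and ?w = "vcoef c W ?x"
  let ?G' = "frechet_derivative (\<lambda>y. gram c y ?v) (at ?x)"
  have x: "?x \<in> snd c ` fst c" using c by blast
  have qP: "q \<in> P" using chart_dom_subset[OF c(1)] c(2) by blast
  note lin = gram_linear[OF c(1) x] and sym = gram_sym[OF c(1) x]
  have 1: "X q (\<lambda>r. g r (V r) (W r)) = gram c ?x ?v \<bullet> ?D W ?\<xi> + (gram c ?x (?D V ?\<xi>) + ?G' ?\<xi>) \<bullet> ?w"
  proof (rule VF_apply[OF X c g_smooth[OF V W] openin_chart_dom[OF c(1)] c(2)])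
    fix r assume r: "r \<in> fst c"
    then have "r \<in> P" using chart_dom_subset[OF c(1)] by blast
    then show "g r (V r) (W r) = gram c (snd c r) (vcoef c V (snd c r)) \<bullet> vcoef c W (snd c r)"
      using g_comps[OF c(1) r VF_tangent[OF V] VF_tangent[OF W]] by (simp add: vcoef_chart[OF c(1) r])
  next
    show "((\<lambda>x. gram c x (vcoef c V x) \<bullet> vcoef c W x) has_derivative
      (\<lambda>u. gram c ?x ?v \<bullet> ?D W u + (gram c ?x (?D V u) + ?G' u) \<bullet> ?w)) (at ?x)"
      by (rule has_derivative_inner[OF has_derivative_family_apply[OF open_chart_range[OF c(1)] x gram_linear[OF c(1)] gram_smooth[OF c(1)]
            vcoef_has_derivative[OF V c]] vcoef_has_derivative[OF W c]])
  qed
  have br: "g q (lie_bracket X Z q) (Z' q) = gram c ?x (?D Z ?\<xi> - ?D X (vcoef c Z ?x)) \<bullet> vcoef c Z' ?x" if "Z \<in> VF" "Z' \<in> VF" for Z Z'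
    using g_comps[OF c lie_bracket_tangent[OF X that(1) qP] VF_tangent[OF that(2) qP]]
    by (simp add: comps_lie_bracket[OF X that(1) c] vcoef_chart[OF c])
  show ?thesis
    unfolding lie_deriv_metric_def 1 g_sym[of q "V q"] br[OF V W] br[OF W V] lie_form_def vcoef_chart[OF c, symmetric]
    using sym[of ?v "?D W ?\<xi>"] sym[of "?D X ?v" ?w] sym[of "?D X ?w" ?v]
    by (simp add: linear_diff[OF lin] inner_diff_left inner_add_left algebra_simps)
qed

text \<open>The first term is symmetric because the identity \<open>gram_sym\<close> holds on an
  open set and may be differentiated; the other two are interchanged.\<close>

lemma lie_form_sym:
  assumes c: "c \<in> A" and x: "x \<in> snd c ` fst c"
  shows "lie_form c X x v w = lie_form c X x w v"
proof -
  have D: "((\<lambda>y. gram c y v \<bullet> w) has_derivative (\<lambda>u. frechet_derivative (\<lambda>y. gram c y v) (at x) u \<bullet> w)) (at x)" for v w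
    by (rule has_derivative_inner_left[OF smooth_on_has_derivative[OF gram_smooth[OF c] x]])
  have "((\<lambda>y. gram c y v \<bullet> w) has_derivative (\<lambda>u. frechet_derivative (\<lambda>y. gram c y w) (at x) u \<bullet> v)) (at x)"
    by (rule has_derivative_transform_within_open[OF D open_chart_range[OF c] x]) (rule gram_sym[OF c])
  from fun_cong[OF has_derivative_unique[OF D this]]
  show ?thesis by (simp add: lie_form_def)
qed

lemma lie_form_linear:
  assumes X: "X \<in> VF" and c: "c \<in> A" and x: "x \<in> snd c ` fst c"
  shows "linear (lie_form c X x v)"
proof -
  obtain q where q: "q \<in> fst c" "x = snd c q" using x by blast
  have "linear (frechet_derivative (vcoef c X) (at x))"
    unfolding q(2) by (rule has_derivative_linear[OF vcoef_has_derivative[OF X c q(1)]])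
  then show ?thesis
    using gram_linear[OF c x]
    by (intro linearI) (simp_all add: lie_form_def linear_add linear_cmul inner_add_left inner_add_right algebra_simps)
qed

end

section \<open>Ideals on the cotangent bundle and the normalizer\<close>

context smooth_mfd
begin

interpretation T: smooth_mfd TA by (rule smooth_mfd_TA)

lemma chart_bracket_zero: "chart_bracket (tc c) f (\<lambda>_. 0) x = 0"
proof -
  have "(\<lambda>_. 0 :: real) \<circ> chart_inv (tc c) = (\<lambda>_. 0)" by auto
  then show ?thesis by (simp add: chart_bracket_def partial_p_def partial_q_def)
qed

lemma chart_bracket_vanish:
  assumes c: "c \<in> A" "x \<in> fst (tc c)" and K: "closedin (mtop TA) K" "x \<notin> K" and h: "\<And>r. r \<in> T.P \<Longrightarrow> r \<notin> K \<Longrightarrow> h r = 0"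
  shows "chart_bracket (tc c) f h x = 0"
proof -
  have x: "x \<in> T.P" using T.chart_dom_subset[OF tc_in[OF c(1)]] c(2) by blast
  have "chart_bracket (tc c) f h x = chart_bracket (tc c) f (\<lambda>_. 0) x"
  proof (rule chart_bracket_cong[OF c])
    show "openin (mtop TA) (T.P - K)" by (rule openin_diff[OF T.openin_points K(1)])
  qed (use x K(2) h in auto)
  then show ?thesis by (simp add: chart_bracket_zero)
qed

text \<open>The bracket is local, so it vanishes off the support of \<open>k\<close>. Hence brackets
  of admissible coefficients or cutoffs with \<open>H_g\<close> are admissible again.\<close>

lemma poisson_compact_support:
  assumes f: "f \<in> T.C" and k: "k \<in> smooth_funs_c TA W"
  shows "poisson A T.P f k \<in> smooth_funs_c TA W"
proof (rule T.smooth_funs_c_supp_subset[OF k])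
  note kC = T.smooth_funs_cD(1)[OF k]
  show "poisson A T.P f k \<in> T.C"
    by (rule poisson_smooth[OF T.openin_points T.C_smooth_at[OF f] T.C_smooth_at[OF kC]])
  fix x assume x: "x \<in> T.P" "x \<notin> supp TA k"
  obtain c where c: "c \<in> A" "x \<in> fst (tc c)" using in_tc[OF x(1)] by blast
  show "poisson A T.P f k x = 0"
    unfolding poisson_eq_chart_bracket[OF x(1) c T.C_smooth_at[OF f x(1)] T.C_smooth_at[OF kC x(1)]]
    by (rule chart_bracket_vanish[OF c T.closedin_supp x(2) T.supp_zero])
qed

section \<open>The zero section: cutoffs and fibre derivatives\<close>

lemma zero_cotangent: "(\<lambda>v. 0) \<in> cotangent_space A q"
  by (simp add: cotangent_space_iff)

lemma cocomps_zero: "cocomps c q (\<lambda>v. 0) = 0"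
  by (simp add: cocomps_def)

text \<open>Continuity of the zero section, which reads \<open>x \<mapsto> (x, 0)\<close> in every
  bundle chart.\<close>

lemma openin_zero_section_preimage:
  assumes V: "openin (mtop TA) V"
  shows "openin (mtop A) {r \<in> P. (r, \<lambda>v. 0) \<in> V}"
  unfolding openin_mtop_iff
proof (intro conjI ballI)
  fix c assume c: "c \<in> A"
  let ?O = "snd (tc c) ` (fst (tc c) \<inter> V)"
  have "snd c ` (fst c \<inter> {r \<in> P. (r, \<lambda>v. 0) \<in> V}) = (snd c ` fst c) \<inter> (\<lambda>x. (x, 0)) -` ?O"
  proof (intro set_eqI iffI)
    fix x assume "x \<in> snd c ` (fst c \<inter> {r \<in> P. (r, \<lambda>v. 0) \<in> V})"
    then obtain r where r: "r \<in> fst c" "(r, \<lambda>v. 0) \<in> V" "x = snd c r" by blast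
    have "snd (tc c) (r, \<lambda>v. 0) = (x, 0)" by (simp add: snd_tc r(3) cocomps_zero)
    moreover have "(r, \<lambda>v. 0) \<in> fst (tc c) \<inter> V" using r zero_cotangent by (simp add: fst_tc)
    ultimately have "(x, 0) \<in> ?O" by (metis imageI)
    then show "x \<in> (snd c ` fst c) \<inter> (\<lambda>x. (x, 0)) -` ?O" using r by simp
  next
    fix x assume "x \<in> (snd c ` fst c) \<inter> (\<lambda>x. (x, 0)) -` ?O"
    then obtain r p where r: "(r, p) \<in> fst (tc c)" "(r, p) \<in> V" "(x, 0) = snd (tc c) (r, p)" by auto
    then have "x = snd c r" "cocomps c r p = 0" "r \<in> fst c" "p \<in> cotangent_space A r" by (auto simp: snd_tc fst_tc)
    moreover from this have "p = (\<lambda>v. 0)"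
      using covec_cocomps[OF c] covec_cocomps[OF c _ zero_cotangent] by (metis cocomps_zero)
    ultimately show "x \<in> snd c ` (fst c \<inter> {r \<in> P. (r, \<lambda>v. 0) \<in> V})"
      using r chart_dom_subset[OF c] by auto
  qed
  moreover have "open ((snd c ` fst c) \<inter> (\<lambda>x. (x, 0)) -` ?O)"
    by (intro continuous_open_preimage continuous_intros open_chart_range[OF c] T.openin_mtop_imp_open_image[OF V tc_in[OF c]])
  ultimately show "open (snd c ` (fst c \<inter> {r \<in> P. (r, \<lambda>v. 0) \<in> V}))" by simp
qed simp

text \<open>Near a single zero covector a bump does it; compactness of \<open>K\<close> leaves
  finitely many bumps to be combined.\<close>

lemma cutoff_on_zero_section:
  assumes K: "compactin (mtop A) K"
  obtains \<rho> where "\<rho> \<in> smooth_funs_c TA T.P" "\<And>q. q \<in> K \<Longrightarrow> \<rho> (q, \<lambda>v. 0) = 1"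
proof -
  define \<U> where "\<U> = {N. openin (mtop A) N \<and> (\<exists>\<rho>\<in>smooth_funs_c TA T.P. \<forall>r\<in>N. \<rho> (r, \<lambda>v. 0) = 1)}"
  have "\<exists>N\<in>\<U>. q \<in> N" if q: "q \<in> K" for q
  proof -
    have qP: "q \<in> P" using compactin_subset_topspace[OF K] q by (auto simp: topspace_mtop)
    then have "(q, \<lambda>v. 0) \<in> T.P" by (simp add: points_TA zero_cotangent)
    then obtain \<eta> V where \<eta>: "\<eta> \<in> smooth_funs_c TA T.P" "openin (mtop TA) V" "(q, \<lambda>v. 0) \<in> V" "V \<subseteq> T.P" "\<And>r. r \<in> V \<Longrightarrow> \<eta> r = 1"
      by (rule T.bump_exists[OF T.openin_points]) blast
    show ?thesis
      by (rule bexI[of _ "{r \<in> P. (r, \<lambda>v. 0) \<in> V}"])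
        (use \<eta> qP openin_zero_section_preimage[OF \<eta>(2)] in \<open>auto simp: \<U>_def\<close>)
  qed
  then have cover: "K \<subseteq> \<Union>\<U>" by blast
  have op: "\<forall>N\<in>\<U>. openin (mtop A) N" by (simp add: \<U>_def)
  obtain \<F> where \<F>: "finite \<F>" "\<F> \<subseteq> \<U>" "K \<subseteq> \<Union>\<F>"
    using K cover op unfolding compactin_def by meson
  from \<F>(1,2) have "\<exists>\<rho>\<in>smooth_funs_c TA T.P. \<forall>r\<in>\<Union>\<F>. \<rho> (r, \<lambda>v. 0) = 1"
  proof (induction \<F> rule: finite_induct)
    case empty
    have "(\<lambda>x. 0) \<in> smooth_funs_c TA T.P"
      by (rule T.smooth_funs_cI[of _ "{}"]) (use T.C_const[of 0] in simp_all)
    then show ?case by auto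
  next
    case (insert N \<F>)
    then obtain \<rho> \<sigma> where \<rho>: "\<rho> \<in> smooth_funs_c TA T.P" "\<forall>r\<in>\<Union>\<F>. \<rho> (r, \<lambda>v. 0) = 1"
      and \<sigma>: "\<sigma> \<in> smooth_funs_c TA T.P" "\<forall>r\<in>N. \<sigma> (r, \<lambda>v. 0) = 1"
      by (auto simp: \<U>_def)
    \<comment> \<open>This is \<open>1 - (1 - \<rho>) (1 - \<sigma>)\<close>, which is 1 wherever
      one of the two is and still has compact support.\<close>
    have "(\<lambda>x. (\<rho> x + \<sigma> x) + (- 1) * (\<rho> x * \<sigma> x)) \<in> smooth_funs_c TA T.P"
      by (intro T.smooth_funs_c_add T.smooth_funs_c_scale T.smooth_funs_c_mult T.smooth_funs_cD(1)[OF \<rho>(1)] \<rho>(1) \<sigma>(1))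
    then show ?case
      by (rule bexI[rotated]) (use \<rho>(2) \<sigma>(2) in \<open>auto simp: algebra_simps\<close>)
  qed
  then show ?thesis using that \<F>(3) by blast
qed

lemma fibre_derivative:
  assumes h: "h \<in> T.C" and c: "c \<in> A" "q \<in> fst c" and p: "p \<in> cotangent_space A q"
  shows "((\<lambda>t. h (q, \<lambda>v. t * p v)) has_real_derivative
    frechet_derivative (h \<circ> chart_inv (tc c)) (at (snd c q, 0)) (0, cocomps c q p)) (at 0)"
proof -
  let ?y = "cocomps c q p" and ?h = "h \<circ> chart_inv (tc c)"
  have x: "(snd c q, 0) \<in> snd (tc c) ` fst (tc c)" using smooth_on_tc_range(2)[OF c(1)] c(2) by auto
  have D: "(?h has_derivative frechet_derivative ?h (at (snd c q, 0))) (at (snd c q, 0 *\<^sub>R ?y))"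
    using smooth_on_has_derivative[OF T.C_smooth_in_chart[OF h tc_in[OF c(1)]] x] by simp
  have "((\<lambda>t. (snd c q, t *\<^sub>R ?y)) has_derivative (\<lambda>t. (0, t *\<^sub>R ?y))) (at 0)"
    by (auto intro!: derivative_eq_intros)
  from has_derivative_compose[where f = "\<lambda>t. (snd c q, t *\<^sub>R ?y)" and g = ?h, OF this D]
  have "((\<lambda>t. ?h (snd c q, t *\<^sub>R ?y)) has_derivative (\<lambda>t. frechet_derivative ?h (at (snd c q, 0)) (0, t *\<^sub>R ?y))) (at 0)" .
  moreover have "?h (snd c q, t *\<^sub>R ?y) = h (q, \<lambda>v. t * p v)" for t
  proof -
    have "covec c q (t *\<^sub>R ?y) = (\<lambda>v. t * covec c q ?y v)" by (auto simp: covec_def)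
    then show ?thesis using covec_cocomps[OF c p] by (simp add: chart_inv_tc[OF c])
  qed
  moreover have "frechet_derivative ?h (at (snd c q, 0)) (0, t *\<^sub>R ?y) = frechet_derivative ?h (at (snd c q, 0)) (0, ?y) * t" for t
    using linear_cmul[OF has_derivative_linear[OF D], of t "(0, ?y)"] by simp
  ultimately show ?thesis by (simp add: has_field_derivative_def)
qed

end

text \<open>Meant for an identity that has been divided by \<open>t\<close> and is therefore known
  for \<open>t \<noteq> 0\<close> only; continuity supplies the value at 0.\<close>

lemma derivative_zero_if_vanishing_off_point:
  fixes f :: "real \<Rightarrow> real"
  assumes f: "(f has_real_derivative d) (at 0)" and z: "\<And>t. t \<noteq> 0 \<Longrightarrow> f t = 0"
  shows "d = 0"
proof -
  have "(f \<longlongrightarrow> f 0) (at 0)" using DERIV_isCont[OF f] by (simp add: isCont_def)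
  moreover have "(f \<longlongrightarrow> 0) (at 0)"
    by (rule Lim_transform_eventually[OF tendsto_const[of 0]]) (auto simp: eventually_at_filter z)
  ultimately have "f 0 = 0" using tendsto_unique[OF at_neq_bot] by blast
  then have "f = (\<lambda>_. 0)" using z by metis
  then show ?thesis using DERIV_unique[OF f] DERIV_const by metis
qed

lemma polarization:
  fixes B B' :: "'b::real_vector \<Rightarrow> 'b \<Rightarrow> real"
  assumes "\<And>v. linear (B v)" "\<And>v w. B v w = B w v" "\<And>v. linear (B' v)" "\<And>v w. B' v w = B' w v"
    and "\<And>v. B v v = B' v v"
  shows "B v w = B' v w"
proof -
  have *: "D (v + w) (v + w) = D v v + 2 * D v w + D w w" if "\<And>v. linear (D v)" "\<And>v w. D v w = D w v" for D :: "'b \<Rightarrow> 'b \<Rightarrow> real"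
    using that(2)[of "v + w"] that(2)[of w v] by (simp add: linear_add[OF that(1)])
  show ?thesis using *[OF assms(1,2)] *[OF assms(3,4)] assms(5)[of v] assms(5)[of w] assms(5)[of "v + w"] by simp
qed

locale foliated_mfd = riemannian_mfd +
  fixes F :: "('a \<Rightarrow> 'a tvec) set"
  assumes foliation: "F \<subseteq> vector_fields_c A"
begin

interpretation T: smooth_mfd TA by (rule smooth_mfd_TA)

abbreviation "J \<equiv> ideal_J A F"
abbreviation "TC\<^sub>c \<equiv> smooth_funs_c TA (points TA)"
abbreviation "H \<equiv> hamiltonian A g"

lemma F_VF: "X \<in> F \<Longrightarrow> X \<in> VF"
  and F_compact: "X \<in> F \<Longrightarrow> compactin (mtop A) (vf_supp A X)"
  using foliation by (auto simp: vector_fields_c_def)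

lemma ideal_J_generator:
  assumes "h \<in> TC\<^sub>c" "X \<in> F"
  shows "(\<lambda>x. h x * fibre_linear A X x) \<in> J"
  unfolding ideal_J_def
  by (rule CollectI, rule exI[of _ "Suc 0"], rule exI[of _ "\<lambda>_. h"], rule exI[of _ "\<lambda>_. X"]) (simp add: assms)

lemma ideal_J_zero: "(\<lambda>x. 0) \<in> J"
  unfolding ideal_J_def
  by (rule CollectI, rule exI[of _ 0]) simp

lemma ideal_J_E:
  assumes "f \<in> J"
  obtains n :: nat and h X where "f = (\<lambda>x. \<Sum>i<n. h i x * fibre_linear A (X i) x)" "\<And>i. i < n \<Longrightarrow> h i \<in> TC\<^sub>c" "\<And>i. i < n \<Longrightarrow> X i \<in> F"
proof -
  obtain n :: nat and h X where "f = (\<lambda>x. \<Sum>i<n. h i x * fibre_linear A (X i) x)" "\<forall>i<n. h i \<in> TC\<^sub>c \<and> X i \<in> F"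
    using assms unfolding ideal_J_def by (elim CollectE exE conjE)
  then show ?thesis by (intro that[of h X n]) simp_all
qed

lemma ideal_J_add:
  assumes "f \<in> J" "f' \<in> J"
  shows "(\<lambda>x. f x + f' x) \<in> J"
proof -
  obtain n :: nat and h X where 1: "f = (\<lambda>x. \<Sum>i<n. h i x * fibre_linear A (X i) x)" "\<And>i. i < n \<Longrightarrow> h i \<in> TC\<^sub>c" "\<And>i. i < n \<Longrightarrow> X i \<in> F"
    by (rule ideal_J_E[OF assms(1)]) blast
  obtain m :: nat and k Y where 2: "f' = (\<lambda>x. \<Sum>i<m. k i x * fibre_linear A (Y i) x)" "\<And>i. i < m \<Longrightarrow> k i \<in> TC\<^sub>c" "\<And>i. i < m \<Longrightarrow> Y i \<in> F"
    by (rule ideal_J_E[OF assms(2)]) blast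
  let ?h = "\<lambda>i. if i < n then h i else k (i - n)" and ?X = "\<lambda>i. if i < n then X i else Y (i - n)"
  have "(\<Sum>i<n + m. e i) = (\<Sum>i<n. e i) + (\<Sum>i<m. e (n + i))" for e :: "nat \<Rightarrow> real"
    by (induction m) (simp_all add: add.assoc)
  then have "(\<Sum>i<n + m. ?h i x * fibre_linear A (?X i) x) = f x + f' x" for x
    by (simp add: 1(1) 2(1))
  then have "(\<lambda>x. f x + f' x) = (\<lambda>x. \<Sum>i<n + m. ?h i x * fibre_linear A (?X i) x)" by simp
  moreover have "\<forall>i<n + m. ?h i \<in> TC\<^sub>c \<and> ?X i \<in> F" using 1(2,3) 2(2,3) by auto
  ultimately show ?thesis unfolding ideal_J_def
    by (intro CollectI exI[of _ "n + m"] exI[of _ ?h] exI[of _ ?X] conjI)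
qed

lemma ideal_J_sum: "(\<And>i. i < (n::nat) \<Longrightarrow> f i \<in> J) \<Longrightarrow> (\<lambda>x. \<Sum>i<n. f i x) \<in> J"
proof (induction n)
  case (Suc n)
  then show ?case using ideal_J_add[of "\<lambda>x. \<Sum>i<n. f i x" "f n"] by simp
qed (simp add: ideal_J_zero)

text \<open>On the diagonal \<open>sym_prod\<close> is a plain product, so at
  \<open>p = g(v, -)\<close> half of \<open>L_X g\<close> is the sum of
  \<open>\<omega>_i(v) g(Y_i, v) / 2\<close>. Here \<open>g(Y_i, v)\<close> is the fibre linear
  function of \<open>Y_i\<close> at \<open>p\<close>, and \<open>v\<close> is \<open>sharp\<close>
  of \<open>p\<close>.\<close>

lemma bracket_hamiltonian_fibre_linear:
  assumes "module_SRF A g F" and X: "X \<in> F"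
  obtains n :: nat and \<kappa> Y where "\<And>i. i < n \<Longrightarrow> \<kappa> i \<in> T.C" "\<And>i. i < n \<Longrightarrow> Y i \<in> F"
    "\<And>c x. c \<in> A \<Longrightarrow> x \<in> fst (tc c) \<Longrightarrow> chart_bracket (tc c) H (fibre_linear A X) x = (\<Sum>i<n. \<kappa> i x * fibre_linear A (Y i) x)"
proof -
  obtain n :: nat and \<omega> Y where \<omega>Y: "\<forall>i<n. \<omega> i \<in> one_forms A \<and> Y i \<in> F"
    and L': "\<forall>V\<in>VF. \<forall>W\<in>VF. lie_deriv_metric X g V W = (\<lambda>q. \<Sum>i<n. sym_prod (\<omega> i) (flat g (Y i)) q (V q) (W q))"
    using bspec[OF assms(1)[unfolded module_SRF_def] X] by (elim exE conjE) (rule that)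
  have Y: "\<And>i. i < n \<Longrightarrow> \<omega> i \<in> one_forms A" "\<And>i. i < n \<Longrightarrow> Y i \<in> F" using \<omega>Y by simp_all
  have L: "lie_deriv_metric X g V W = (\<lambda>q. \<Sum>i<n. sym_prod (\<omega> i) (flat g (Y i)) q (V q) (W q))"
    if "V \<in> VF" "W \<in> VF" for V W by (rule bspec[OF bspec[OF L' that(1)] that(2)])
  define \<kappa> where "\<kappa> i x = (if x \<in> T.P then \<omega> i (fst x) (sharp (fst x) (snd x)) / 2 else 0)" for i x
  note XV = F_VF[OF X]
  show ?thesis
  proof (rule that[of n \<kappa> Y])
    fix i assume i: "i < n"
    show "Y i \<in> F" by (rule Y(2)[OF i])
    show "\<kappa> i \<in> T.C"
    proof (rule smooth_funs_TA_I)
      show "smooth_on (snd c ` fst c \<times> UNIV) (\<lambda>z. (cocomps c (chart_inv c (fst z)) (\<omega> i (chart_inv c (fst z))) \<bullet> inv (gram c (fst z)) (snd z)) / 2)"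
        if c: "c \<in> A" for c
        by (intro smooth_on_divide smooth_on_inner smooth_on_tc_range[OF c] smooth_on_gram_inverse_fibre[OF c] smooth_on_const
            smooth_on_base[OF c one_form_coefficients_smooth[OF Y(1)[OF i] c]]) simp
      fix c q p assume c: "c \<in> A" and x: "(q, p) \<in> fst (tc c)"
      have q: "q \<in> fst c" "p \<in> cotangent_space A q" "q \<in> P" using x chart_dom_subset[OF c] by (auto simp: fst_tc)
      have \<omega>q: "\<omega> i q \<in> cotangent_space A q" using Y(1)[OF i] q(3) by (simp add: one_forms_def)
      show "\<kappa> i (q, p) = (cocomps c (chart_inv c (fst (snd c q, cocomps c q p))) (\<omega> i (chart_inv c (fst (snd c q, cocomps c q p)))) \<bullet>
          inv (gram c (fst (snd c q, cocomps c q p))) (snd (snd c q, cocomps c q p))) / 2"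
        using cotangent_eval[OF c q(1) \<omega>q g_sharp(1)[OF c q(1,2)]] q c
        by (simp add: \<kappa>_def points_TA g_sharp(3)[OF c q(1,2)])
    qed (simp add: \<kappa>_def)
  next
    fix c x assume c: "c \<in> A" and x: "x \<in> fst (tc c)"
    obtain q p where xq: "x = (q, p)" by fastforce
    have q: "q \<in> fst c" "p \<in> cotangent_space A q" "q \<in> P" using x chart_dom_subset[OF c] by (auto simp: fst_tc xq)
    define v where "v = sharp q p"
    have v: "v \<in> tangent_space A q" "g q v = p" using g_sharp[OF c q(1,2)] by (simp_all add: v_def)
    \<comment> \<open>The hypothesis speaks of fields, so the vector \<open>v\<close> is extended to
      one; only its value at \<open>q\<close> matters.\<close>
    obtain V N where V: "V \<in> VF" "openin (mtop A) N" "q \<in> N" "N \<subseteq> fst c" "\<And>r. r \<in> N \<Longrightarrow> V r = coord_vec A c r (comps c q v)"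
      by (rule VF_local_constant[OF c q(1), of "comps c q v"]) blast
    have Vq: "V q = v" using V(3,5) coord_vec_comps[OF c q(1) v(1)] by simp
    have "chart_bracket (tc c) H (fibre_linear A X) x = lie_deriv_metric X g V V q / 2"
      using chart_bracket_hamiltonian[OF XV c q(1) v(1)] lie_deriv_metric_eq_lie_form[OF XV V(1) V(1) c q(1)]
      by (simp add: v(2) xq Vq)
    also have "\<dots> = (\<Sum>i<n. \<kappa> i x * fibre_linear A (Y i) x)"
      using q v by (simp add: L[OF V(1) V(1)] Vq sym_prod_def flat_def \<kappa>_def fibre_linear_def points_TA xq v_def[symmetric]
          g_sym[of q "Y _ q" v] sum_divide_distrib)
    finally show "chart_bracket (tc c) H (fibre_linear A X) x = (\<Sum>i<n. \<kappa> i x * fibre_linear A (Y i) x)" .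
  qed
qed

text \<open>The coefficients \<open>\<kappa> i\<close> are linear on the fibres and in general not
  compactly supported; the factor \<open>k\<close> makes them admissible for
  \<open>ideal_J\<close>.\<close>

lemma ideal_J_poisson_hamiltonian:
  assumes srf: "module_SRF A g F" and X: "X \<in> F" and k: "k \<in> TC\<^sub>c"
  shows "(\<lambda>x. k x * poisson A T.P H (fibre_linear A X) x) \<in> J"
proof -
  obtain n :: nat and \<kappa> Y where \<kappa>: "\<And>i. i < n \<Longrightarrow> \<kappa> i \<in> T.C" "\<And>i. i < n \<Longrightarrow> Y i \<in> F"
    "\<And>c x. c \<in> A \<Longrightarrow> x \<in> fst (tc c) \<Longrightarrow> chart_bracket (tc c) H (fibre_linear A X) x = (\<Sum>i<n. \<kappa> i x * fibre_linear A (Y i) x)"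
    by (rule bracket_hamiltonian_fibre_linear[OF srf X]) blast
  have "(\<lambda>x. \<Sum>i<n. (\<kappa> i x * k x) * fibre_linear A (Y i) x) \<in> J"
    by (intro ideal_J_sum ideal_J_generator T.smooth_funs_c_mult k \<kappa>(1,2))
  moreover have "(\<lambda>x. k x * poisson A T.P H (fibre_linear A X) x) = (\<lambda>x. \<Sum>i<n. (\<kappa> i x * k x) * fibre_linear A (Y i) x)"
  proof
    fix x
    show "k x * poisson A T.P H (fibre_linear A X) x = (\<Sum>i<n. (\<kappa> i x * k x) * fibre_linear A (Y i) x)"
    proof (cases "x \<in> T.P")
      case True
      then obtain c where c: "c \<in> A" "x \<in> fst (tc c)" using in_tc by blast
      show ?thesis
        unfolding poisson_eq_chart_bracket[OF True c T.C_smooth_at[OF hamiltonian_smooth True] T.C_smooth_at[OF fibre_linear_smooth[OF F_VF[OF X]] True]] \<kappa>(3)[OF c]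
        by (simp add: sum_distrib_left mult_ac)
    next
      case False
      then show ?thesis using T.C_outside[OF T.smooth_funs_cD(1)[OF k]] by simp
    qed
  qed
  ultimately show ?thesis by (simp only:)
qed

theorem module_SRF_imp_normalizer:
  assumes srf: "module_SRF A g F"
  shows "H \<in> normalizer A (ideal_I A F)"
  unfolding normalizer_def
proof (intro CollectI conjI allI impI ballI)
  show HC: "H \<in> T.C" by (rule hamiltonian_smooth)
  fix U h assume U: "openin (mtop TA) U" and h: "h \<in> ideal_I A F U"
  let ?H = "\<lambda>x. if x \<in> U then H x else 0"
  have UP: "U \<subseteq> T.P" using openin_subset[OF U] by (simp add: T.topspace_mtop)
  have hs: "smooth_at TA h x" if "x \<in> U" for x
    using h that unfolding ideal_I_def T.smooth_funs_iff[OF U] by blast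
  have h0: "h x = 0" if "x \<notin> U" for x
    using h that unfolding ideal_I_def T.smooth_funs_iff[OF U] by blast
  have hJ: "(\<lambda>x. \<rho> x * h x) \<in> J" if "\<rho> \<in> smooth_funs_c TA U" for \<rho>
    using h that unfolding ideal_I_def by blast
  have Hs: "smooth_at TA ?H x" if "x \<in> U" for x
    using that UP by (intro T.smooth_at_cong[OF T.C_smooth_at[OF HC] U]) auto
  show "poisson A U ?H h \<in> ideal_I A F U"
    unfolding ideal_I_def
  proof (intro CollectI conjI ballI)
    show "poisson A U ?H h \<in> smooth_funs TA U" by (rule poisson_smooth[OF U Hs hs])
    fix \<rho> assume \<rho>: "\<rho> \<in> smooth_funs_c TA U"
    note \<rho>C = T.smooth_funs_cD(1)[OF \<rho>]
    obtain n :: nat and k X where \<rho>h: "(\<lambda>x. \<rho> x * h x) = (\<lambda>x. \<Sum>i<n. k i x * fibre_linear A (X i) x)"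
      and k: "\<And>i. i < n \<Longrightarrow> k i \<in> TC\<^sub>c" and X: "\<And>i. i < n \<Longrightarrow> X i \<in> F"
      by (rule ideal_J_E[OF hJ[OF \<rho>]]) blast
    \<comment> \<open>\<open>?R1\<close> is \<open>{H_g, \<rho> h}\<close>, expanded from the
      representation of \<open>\<rho> h\<close> in \<open>J\<close>. \<open>?R2\<close> is
      \<open>- {H_g, \<rho>} h\<close>, which lies in \<open>J\<close> because
      \<open>{H_g, \<rho>}\<close> is itself a cutoff supported in \<open>U\<close>.\<close>
    let ?R1 = "\<lambda>x. \<Sum>i<n. k i x * poisson A T.P H (fibre_linear A (X i)) x + poisson A T.P H (k i) x * fibre_linear A (X i) x"
    let ?R2 = "\<lambda>x. ((- 1) * poisson A T.P H \<rho> x) * h x"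
    have "(\<lambda>x. ?R1 x + ?R2 x) \<in> J"
      by (intro ideal_J_add ideal_J_sum ideal_J_generator ideal_J_poisson_hamiltonian srf hJ T.smooth_funs_c_scale poisson_compact_support HC \<rho> k X)
    moreover have "(\<lambda>x. \<rho> x * poisson A U ?H h x) = (\<lambda>x. ?R1 x + ?R2 x)"
    proof (rule ext, goal_cases)
      case (1 x)
      show ?case
      proof (cases "x \<in> T.P")
        case False
        then have "k i x = 0" if "i < n" for i using T.C_outside[OF T.smooth_funs_cD(1)[OF k[OF that]]] by simp
        then show ?thesis using False UP by (auto simp: poisson_def)
      next
        case xP: True
        obtain c where c: "c \<in> A" "x \<in> fst (tc c)" using in_tc[OF xP] by blast
        have Hx: "smooth_at TA H x" by (rule T.C_smooth_at[OF HC xP])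
        have kx: "smooth_at TA (k i) x" if "i < n" for i by (rule T.C_smooth_at[OF T.smooth_funs_cD(1)[OF k[OF that]] xP])
        have Xx: "smooth_at TA (fibre_linear A (X i)) x" if "i < n" for i
          by (rule T.C_smooth_at[OF fibre_linear_smooth[OF F_VF[OF X[OF that]]] xP])
        have \<rho>x: "smooth_at TA \<rho> x" by (rule T.C_smooth_at[OF \<rho>C xP])
        have "?R1 x = (\<Sum>i<n. k i x * chart_bracket (tc c) H (fibre_linear A (X i)) x + fibre_linear A (X i) x * chart_bracket (tc c) H (k i) x)"
          by (intro sum.cong refl)
            (simp add: poisson_eq_chart_bracket[OF xP c Hx kx] poisson_eq_chart_bracket[OF xP c Hx Xx])
        also have "\<dots> = (\<Sum>i<n. chart_bracket (tc c) H (\<lambda>x. k i x * fibre_linear A (X i) x) x)"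
          by (intro sum.cong refl chart_bracket_mult[symmetric] c kx Xx) simp_all
        also have "\<dots> = chart_bracket (tc c) H (\<lambda>x. \<rho> x * h x) x"
          unfolding \<rho>h by (rule chart_bracket_sum[symmetric, OF c]) (simp add: T.smooth_at_mult kx Xx)
        finally have R1: "?R1 x = chart_bracket (tc c) H (\<lambda>x. \<rho> x * h x) x" .
        show ?thesis
        proof (cases "x \<in> U")
          case True
          have "poisson A U ?H h x = chart_bracket (tc c) ?H h x" by (rule poisson_eq_chart_bracket[OF True c Hs[OF True] hs[OF True]])
          also have "\<dots> = chart_bracket (tc c) H h x" by (rule chart_bracket_cong[OF c U True]) simp_all
          finally show ?thesis
            unfolding R1 chart_bracket_mult[OF c \<rho>x hs[OF True]] poisson_eq_chart_bracket[OF xP c Hx \<rho>x] by simp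
        next
          \<comment> \<open>\<open>poisson A U\<close> is 0 off \<open>U\<close> by convention. The
            right hand side is 0 too: \<open>\<rho> h\<close> vanishes near \<open>x\<close>, since
            \<open>x\<close> is off the closed support of \<open>\<rho>\<close>, and
            \<open>h x = 0\<close> by extension by zero.\<close>
          case False
          then have "x \<notin> supp TA \<rho>" using T.smooth_funs_cD(3)[OF \<rho>] by blast
          then have "chart_bracket (tc c) H (\<lambda>x. \<rho> x * h x) x = 0"
            by (rule chart_bracket_vanish[OF c T.closedin_supp]) (simp add: T.supp_zero)
          then show ?thesis unfolding R1 using False by (simp add: poisson_def h0)
        qed
      qed
    qed
    ultimately show "(\<lambda>x. \<rho> x * poisson A U ?H h x) \<in> J" by (simp only:)
  qed
qed

text \<open>The fibre derivative at the zero section is a vector field, which the metric turns into a one-form;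
  the factor 2 cancels the 1/2 of the Hamiltonian.\<close>

definition fibre_form :: "('a \<times> 'a covec \<Rightarrow> real) \<Rightarrow> 'a \<Rightarrow> 'a covec" where
  "fibre_form h q v = (if q \<in> P \<and> v \<in> tangent_space A q then 2 * deriv (\<lambda>t. h (q, \<lambda>w. t * g q v w)) 0 else 0)"

lemma fibre_form_eq:
  assumes h: "h \<in> T.C" and c: "c \<in> A" "q \<in> fst c" and v: "v \<in> tangent_space A q"
  shows "fibre_form h q v = 2 * frechet_derivative (h \<circ> chart_inv (tc c)) (at (snd c q, 0)) (0, gram c (snd c q) (comps c q v))"
proof -
  have q: "q \<in> P" using chart_dom_subset[OF c(1)] c(2) by blast
  show ?thesis
    using DERIV_imp_deriv[OF fibre_derivative[OF h c g_cotangent[OF q v]]] q v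
    by (simp add: fibre_form_def cocomps_g[OF c v])
qed

lemma fibre_form_one_form:
  assumes h: "h \<in> T.C"
  shows "fibre_form h \<in> one_forms A"
  unfolding one_forms_def
proof (intro CollectI conjI ballI allI impI)
  fix q assume q: "q \<in> P"
  then obtain c where c: "c \<in> A" "q \<in> fst c" by (auto simp: points_def)
  have x: "(snd c q, 0) \<in> snd (tc c) ` fst (tc c)" using smooth_on_tc_range(2)[OF c(1)] c(2) by auto
  let ?D = "frechet_derivative (h \<circ> chart_inv (tc c)) (at (snd c q, 0))"
  have lin: "linear ?D"
    by (rule has_derivative_linear[OF smooth_on_has_derivative[OF T.C_smooth_in_chart[OF h tc_in[OF c(1)]] x]])
  have sx: "snd c q \<in> snd c ` fst c" using c by blast
  note G = gram_linear[OF c(1) sx] and eq = fibre_form_eq[OF h c]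
  show "fibre_form h q \<in> cotangent_space A q"
    unfolding cotangent_space_iff
  proof (intro conjI allI impI ballI)
    fix v w assume v: "v \<in> tangent_space A q" and w: "w \<in> tangent_space A q"
    show "fibre_form h q (\<lambda>f. v f + w f) = fibre_form h q v + fibre_form h q w"
      using linear_add[OF lin, of "(0, gram c (snd c q) (comps c q v))" "(0, gram c (snd c q) (comps c q w))"]
      by (simp add: eq[OF v] eq[OF w] eq[OF comps_add(2)[OF c v w]] comps_add(1)[OF c v w] linear_add[OF G])
  next
    fix v a assume v: "v \<in> tangent_space A q"
    show "fibre_form h q (\<lambda>f. a * v f) = a * fibre_form h q v"
      using linear_cmul[OF lin, of a "(0, gram c (snd c q) (comps c q v))"]
      by (simp add: eq[OF v] eq[OF comps_scale(2)[OF c v]] comps_scale(1)[OF c v] linear_cmul[OF G])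
  qed (simp add: fibre_form_def)
next
  fix q assume "q \<notin> P" then show "fibre_form h q = (\<lambda>v. 0)" by (auto simp: fibre_form_def)
next
  fix V assume V: "V \<in> VF"
  show "(\<lambda>q. fibre_form h q (V q)) \<in> C"
    unfolding C_iff
  proof (intro conjI ballI allI impI)
    fix q assume q: "q \<in> P"
    then obtain c where c: "c \<in> A" "q \<in> fst c" by (auto simp: points_def)
    let ?S = "snd c ` fst c"
    note S = open_chart_range[OF c(1)]
    let ?D = "\<lambda>b z. frechet_derivative (h \<circ> chart_inv (tc c)) (at z) (0, b)"
    have emb: "smooth_on ?S (\<lambda>x. (x, 0 :: 'b))" by (intro smooth_on_Pair S smooth_on_ident smooth_on_const)
    have D: "smooth_on ?S (\<lambda>x. ?D b (x, 0))" for b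
      by (rule smooth_on_compose[where g = "?D b" and f = "\<lambda>x. (x, 0)", OF S smooth_on_frechet_derivative[OF T.C_smooth_in_chart[OF h tc_in[OF c(1)]]] emb])
        (use smooth_on_tc_range(2)[OF c(1)] in auto)
    \<comment> \<open>The Gram map applied to the components of \<open>V\<close>, expanded because
      both vary with the point.\<close>
    have gv: "smooth_on ?S (\<lambda>x. \<Sum>b\<in>Basis. (vcoef c V x \<bullet> b) *\<^sub>R gram c x b)"
      by (intro smooth_on_sum smooth_on_scaleR smooth_on_inner S vcoef_smooth[OF V c(1)] smooth_on_const gram_smooth[OF c(1)])
    have sm: "smooth_on ?S (\<lambda>x. 2 * (\<Sum>e\<in>Basis. ((\<Sum>b\<in>Basis. (vcoef c V x \<bullet> b) *\<^sub>R gram c x b) \<bullet> e) * ?D e (x, 0)))"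
      by (intro smooth_on_mult smooth_on_sum smooth_on_inner S gv D smooth_on_const)
    show "smooth_at A (\<lambda>q. fibre_form h q (V q)) q"
    proof (rule smooth_at_chartI[OF c S _ sm])
      show "snd c q \<in> ?S" using c by blast
      fix r assume r: "r \<in> fst c"
      then have rP: "r \<in> P" and rS: "snd c r \<in> ?S" using chart_dom_subset[OF c(1)] by auto
      have x: "(snd c r, 0) \<in> snd (tc c) ` fst (tc c)" using smooth_on_tc_range(2)[OF c(1)] r by auto
      have "linear (frechet_derivative (h \<circ> chart_inv (tc c)) (at (snd c r, 0)))"
        by (rule has_derivative_linear[OF smooth_on_has_derivative[OF T.C_smooth_in_chart[OF h tc_in[OF c(1)]] x]])
      then have "linear (\<lambda>b. ?D b (snd c r, 0))"
        using linear_compose[OF linearI[of "\<lambda>u. (0, u)"]] by (simp add: o_def)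
      from linear_basis_expansion[OF this, of "gram c (snd c r) (vcoef c V (snd c r))"]
      show "fibre_form h r (V r) = 2 * (\<Sum>e\<in>Basis. ((\<Sum>b\<in>Basis. (vcoef c V (snd c r) \<bullet> b) *\<^sub>R gram c (snd c r) b) \<bullet> e) * ?D e (snd c r, 0))"
        unfolding linear_basis_expansion[OF gram_linear[OF c(1) rS], of "vcoef c V (snd c r)", symmetric]
        by (simp add: fibre_form_eq[OF h c(1) r VF_tangent[OF V rP]] vcoef_chart[OF c(1) r])
    qed
  qed (simp add: fibre_form_def)
qed

text \<open>Off its closed support \<open>X\<close> is zero on a whole neighbourhood, so the
  derivative of its components vanishes together with their values.\<close>

lemma lie_form_vanish:
  assumes c: "c \<in> A" "q \<in> fst c" and q: "q \<notin> vf_supp A X"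
  shows "lie_form c X (snd c q) v w = 0"
proof -
  have "q \<in> P" using chart_dom_subset[OF c(1)] c(2) by blast
  let ?N = "P - vf_supp A X"
  have N: "openin (mtop A) ?N" by (rule openin_diff[OF openin_points]) (simp add: vf_supp_def)
  have zero: "X r = (\<lambda>f. 0)" if "r \<in> ?N" for r
    using that closure_of_subset[of "{q \<in> P. X q \<noteq> (\<lambda>f. 0)}" "mtop A"] by (auto simp: vf_supp_def topspace_mtop)
  have vz: "vcoef c X (snd c r) = 0" if "r \<in> ?N" "r \<in> fst c" for r
    using comps_coord_vec[OF c(1) that(2), of 0] by (simp add: vcoef_chart[OF c(1) that(2)] zero[OF that(1)] coord_vec_zero[OF c(1) that(2)])
  have qN: "snd c q \<in> snd c ` (fst c \<inter> ?N)" using c q \<open>q \<in> P\<close> by blast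
  have "((\<lambda>x. 0) has_derivative (\<lambda>u. 0)) (at (snd c q))" by simp
  then have "(vcoef c X has_derivative (\<lambda>u. 0)) (at (snd c q))"
    by (rule has_derivative_transform_within_open[OF _ openin_mtop_imp_open_image[OF N c(1)] qN]) (use vz in auto)
  from frechet_derivative_at[OF this, symmetric] show ?thesis
    using vz[of q] q c \<open>q \<in> P\<close> linear_0[OF has_derivative_linear[OF smooth_on_has_derivative[OF gram_smooth[OF c(1), of v], of "snd c q"]]]
    by (simp add: lie_form_def)
qed

theorem normalizer_imp_module_SRF:
  assumes norm: "H \<in> normalizer A (ideal_I A F)"
  shows "module_SRF A g F"
  unfolding module_SRF_def
proof (intro ballI)
  fix X assume X: "X \<in> F"
  note XV = F_VF[OF X]
  have HC: "H \<in> T.C" by (rule hamiltonian_smooth)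
  let ?X = "fibre_linear A X"
  have XC: "?X \<in> T.C" by (rule fibre_linear_smooth[OF XV])
  have "?X \<in> ideal_I A F T.P"
    unfolding ideal_I_def using XC ideal_J_generator[OF _ X] by blast
  moreover have "(\<lambda>x. if x \<in> T.P then H x else 0) = H" using T.C_outside[OF HC] by auto
  moreover have "\<forall>k\<in>ideal_I A F T.P. poisson A T.P (\<lambda>x. if x \<in> T.P then H x else 0) k \<in> ideal_I A F T.P"
    using norm T.openin_points unfolding normalizer_def by blast
  ultimately have "poisson A T.P H ?X \<in> ideal_I A F T.P" by simp
  then have PJ: "(\<lambda>x. \<rho> x * poisson A T.P H ?X x) \<in> J" if "\<rho> \<in> TC\<^sub>c" for \<rho>
    using that unfolding ideal_I_def by blast
  \<comment> \<open>The support of \<open>X\<close> is compact in the base; the cutoff is prescribed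
    only on the zero section over it.\<close>
  obtain \<rho> where \<rho>: "\<rho> \<in> TC\<^sub>c" "\<And>q. q \<in> vf_supp A X \<Longrightarrow> \<rho> (q, \<lambda>v. 0) = 1"
    by (rule cutoff_on_zero_section[OF F_compact[OF X]]) blast
  obtain n :: nat and h Y where eq: "(\<lambda>x. \<rho> x * poisson A T.P H ?X x) = (\<lambda>x. \<Sum>i<n. h i x * fibre_linear A (Y i) x)"
    and h: "\<And>i. i < n \<Longrightarrow> h i \<in> TC\<^sub>c" and Y: "\<And>i. i < n \<Longrightarrow> Y i \<in> F"
    by (rule ideal_J_E[OF PJ[OF \<rho>(1)]]) blast
  have hC: "h i \<in> T.C" if "i < n" for i by (rule T.smooth_funs_cD(1)[OF h[OF that]])
  have \<rho>C: "\<rho> \<in> T.C" by (rule T.smooth_funs_cD(1)[OF \<rho>(1)])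
  have diag: "(\<Sum>i<n. fibre_form (h i) q v * g q (Y i q) v) = lie_form c X (snd c q) (comps c q v) (comps c q v)"
    if c: "c \<in> A" "q \<in> fst c" and v: "v \<in> tangent_space A q" for c q v
  proof -
    have q: "q \<in> P" using chart_dom_subset[OF c(1)] c(2) by blast
    let ?p = "g q v" and ?w = "comps c q v"
    let ?L = "lie_form c X (snd c q) ?w ?w" and ?a = "\<lambda>i. ?p (Y i q)"
    have p: "?p \<in> cotangent_space A q" by (rule g_cotangent[OF q v])
    have sx: "snd c q \<in> snd c ` fst c" using c by blast
    \<comment> \<open>The ray through \<open>p = g(v, -)\<close> consists of the covectors of
      \<open>t v\<close>, so the bracket formula applies all along it.\<close>
    have tp: "(\<lambda>w. t * ?p w) = g q (\<lambda>f. t * v f)" for t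
    proof
      fix w show "t * ?p w = g q (\<lambda>f. t * v f) w"
      proof (cases "w \<in> tangent_space A q")
        case True
        then show ?thesis
          by (simp add: g_comps[OF c v True] g_comps[OF c comps_scale(2)[OF c v] True] comps_scale(1)[OF c v] linear_cmul[OF gram_linear[OF c(1) sx]])
      next
        case False
        then show ?thesis using g_outside[of q w] g_sym[of q _ w] by simp
      qed
    qed
    have tpx: "(q, \<lambda>w. t * ?p w) \<in> fst (tc c)" for t
      using c(2) g_cotangent[OF q comps_scale(2)[OF c v]] by (simp add: fst_tc tp)
    have tpP: "(q, \<lambda>w. t * ?p w) \<in> T.P" for t
      using T.chart_dom_subset[OF tc_in[OF c(1)]] tpx by blast
    have br: "poisson A T.P H ?X (q, \<lambda>w. t * ?p w) = t * t * ?L / 2" for t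
    proof -
      have "poisson A T.P H ?X (q, \<lambda>w. t * ?p w) = lie_form c X (snd c q) (t *\<^sub>R ?w) (t *\<^sub>R ?w) / 2"
        unfolding poisson_eq_chart_bracket[OF tpP c(1) tpx T.C_smooth_at[OF HC tpP] T.C_smooth_at[OF XC tpP]]
        unfolding tp chart_bracket_hamiltonian[OF XV c comps_scale(2)[OF c v]] comps_scale(1)[OF c v] ..
      also have "lie_form c X (snd c q) (t *\<^sub>R ?w) (t *\<^sub>R ?w) = t * lie_form c X (snd c q) (t *\<^sub>R ?w) ?w"
        using linear_cmul[OF lie_form_linear[OF XV c(1) sx]] by simp
      also have "lie_form c X (snd c q) (t *\<^sub>R ?w) ?w = t * ?L"
        unfolding lie_form_sym[OF c(1) sx, where v = "t *\<^sub>R ?w"] using linear_cmul[OF lie_form_linear[OF XV c(1) sx]] by simp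
      finally show ?thesis by simp
    qed
    have fl: "fibre_linear A (Y i) (q, \<lambda>w. t * ?p w) = t * ?a i" for t i
      using tpP by (simp add: fibre_linear_def)
    let ?d = "\<lambda>k. frechet_derivative (k \<circ> chart_inv (tc c)) (at (snd c q, 0)) (0, cocomps c q ?p)"
    \<comment> \<open>The identity for \<open>\<rho> {H_g, X}\<close> at \<open>(q, t p)\<close>,
      divided by \<open>t\<close>. At 0 the factor \<open>t\<close> of the second term leaves only
      the value of \<open>\<rho>\<close> there, and the derivative of \<open>\<rho>\<close> drops
      out.\<close>
    let ?\<phi> = "\<lambda>t. (\<Sum>i<n. h i (q, \<lambda>w. t * ?p w) * ?a i) - t * (\<rho> (q, \<lambda>w. t * ?p w) * (?L / 2))"
    have "(?\<phi> has_real_derivative (\<Sum>i<n. ?d (h i) * ?a i) - (1 * (\<rho> (q, \<lambda>w. 0 * ?p w) * (?L / 2)) + (?d \<rho> * (?L / 2)) * 0)) (at 0)"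
      by (intro DERIV_diff DERIV_sum DERIV_cmult_right DERIV_mult DERIV_ident fibre_derivative[OF _ c p] hC \<rho>C) simp
    moreover have "?\<phi> t = 0" if "t \<noteq> 0" for t
    proof -
      have "\<rho> (q, \<lambda>w. t * ?p w) * (t * t * ?L / 2) = (\<Sum>i<n. h i (q, \<lambda>w. t * ?p w) * (t * ?a i))"
        using fun_cong[OF eq, of "(q, \<lambda>w. t * ?p w)"] by (simp only: br fl)
      also have "\<dots> = t * (\<Sum>i<n. h i (q, \<lambda>w. t * ?p w) * ?a i)" by (simp add: sum_distrib_left mult_ac)
      finally have "t * ?\<phi> t = 0" unfolding right_diff_distrib by (simp only: mult_ac times_divide_eq_right diff_self)
      then show ?thesis using that by simp
    qed
    ultimately have "(\<Sum>i<n. ?d (h i) * ?a i) - (1 * (\<rho> (q, \<lambda>w. 0 * ?p w) * (?L / 2)) + (?d \<rho> * (?L / 2)) * 0) = 0"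
      by (rule derivative_zero_if_vanishing_off_point)
    then have 1: "2 * (\<Sum>i<n. ?d (h i) * ?a i) = \<rho> (q, \<lambda>w. 0) * ?L" by simp
    \<comment> \<open>Over the support of \<open>X\<close> the cutoff is 1; elsewhere its value is
      unknown, but \<open>?L\<close> is 0.\<close>
    have "\<rho> (q, \<lambda>w. 0) * ?L = ?L"
      using \<rho>(2)[of q] lie_form_vanish[OF c, of X] by (cases "q \<in> vf_supp A X") auto
    moreover have "fibre_form (h i) q v * g q (Y i q) v = 2 * (?d (h i) * ?a i)" if "i < n" for i
      using fibre_form_eq[OF hC[OF that] c v] g_sym[of q "Y i q" v] by (simp add: cocomps_g[OF c v])
    ultimately show ?thesis using 1 by (simp add: sum_distrib_left)
  qed
  have "lie_deriv_metric X g V W q = (\<Sum>i<n. sym_prod (fibre_form (h i)) (flat g (Y i)) q (V q) (W q))"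
    if V: "V \<in> VF" and W: "W \<in> VF" for V W q
  proof (cases "q \<in> P")
    case False
    then show ?thesis
      using g_outside[of q] VF_outside[OF XV False] by (simp add: lie_deriv_metric_def sym_prod_def fibre_form_def)
  next
    case q: True
    then obtain c where c: "c \<in> A" "q \<in> fst c" by (auto simp: points_def)
    have sx: "snd c q \<in> snd c ` fst c" using c by blast
    let ?v = "coord_vec A c q"
    let ?B = "\<lambda>v w. \<Sum>i<n. sym_prod (fibre_form (h i)) (flat g (Y i)) q (?v v) (?v w)"
    have lf: "linear (\<lambda>w. fibre_form (h i) q (?v w))" if "i < n" for i
      using fibre_form_one_form[OF hC[OF that]] q by (intro cotangent_linear[OF c]) (simp add: one_forms_def)
    have lg: "linear (\<lambda>w. g q (Y i q) (?v w))" if "i < n" for i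
      by (intro cotangent_linear[OF c] g_cotangent[OF q] VF_tangent[OF F_VF[OF Y[OF that]] q])
    \<comment> \<open>The fibre derivatives determine the forms on the diagonal only. Both sides are
      symmetric and bilinear in the components, so \<open>diag\<close> is enough.\<close>
    have "lie_form c X (snd c q) (comps c q (V q)) (comps c q (W q)) = ?B (comps c q (V q)) (comps c q (W q))"
    proof (rule polarization[where B = "lie_form c X (snd c q)" and B' = ?B])
      show "linear (lie_form c X (snd c q) v)" for v by (rule lie_form_linear[OF XV c(1) sx])
      show "lie_form c X (snd c q) v w = lie_form c X (snd c q) w v" for v w by (rule lie_form_sym[OF c(1) sx])
      show "linear (?B v)" for v
        unfolding sym_prod_def flat_def
        by (intro linearI)
          (simp_all add: linear_add[OF lf] linear_add[OF lg] linear_cmul[OF lf] linear_cmul[OF lg] sum.distrib[symmetric] sum_distrib_left algebra_simps add_divide_distrib)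
      show "?B v w = ?B w v" for v w by (simp add: sym_prod_def add.commute)
      show "lie_form c X (snd c q) v v = ?B v v" for v
        using diag[OF c coord_vec_tangent[OF c], of v] by (simp add: sym_prod_def flat_def comps_coord_vec[OF c] mult.commute)
    qed
    then show ?thesis
      using lie_deriv_metric_eq_lie_form[OF XV V W c]
      by (simp add: coord_vec_comps[OF c VF_tangent[OF V q]] coord_vec_comps[OF c VF_tangent[OF W q]])
  qed
  then have "\<forall>V\<in>VF. \<forall>W\<in>VF. lie_deriv_metric X g V W = (\<lambda>q. \<Sum>i<n. sym_prod (fibre_form (h i)) (flat g (Y i)) q (V q) (W q))"
    by (intro ballI ext)
  moreover have "\<forall>i<n. fibre_form (h i) \<in> one_forms A \<and> Y i \<in> F" using fibre_form_one_form[OF hC] Y by simp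
  ultimately show "\<exists>(n::nat) \<omega> Y. (\<forall>i<n. \<omega> i \<in> one_forms A \<and> Y i \<in> F) \<and>
      (\<forall>V\<in>VF. \<forall>W\<in>VF. lie_deriv_metric X g V W = (\<lambda>q. \<Sum>i<n. sym_prod (\<omega> i) (flat g (Y i)) q (V q) (W q)))"
    by (intro exI[of _ n] exI[of _ "\<lambda>i. fibre_form (h i)"] exI[of _ Y] conjI)
qed

end

theorem proposition5p9:
  fixes A :: "('a, 'b::euclidean_space) atlas"
    and g :: "'a \<Rightarrow> 'a tvec \<Rightarrow> 'a tvec \<Rightarrow> real"
    and F :: "('a \<Rightarrow> 'a tvec) set"
  assumes "smooth_manifold A"
    and "riemannian_metric A g"
    and "singular_foliation A F"
  shows "module_SRF A g F \<longleftrightarrow> hamiltonian A g \<in> normalizer A (ideal_I A F)"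
proof -
  interpret foliated_mfd A g F
    using assms by unfold_locales (simp_all add: smooth_manifold_def singular_foliation_def)
  show ?thesis using module_SRF_imp_normalizer normalizer_imp_module_SRF by blast
qed

end
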